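(* There is an absolute constant $a>0$, and for every $K\ge1$ and $m>0$ a constant $k_{K,m}\in\mathbb{N}$, such that the following holds. Let $A$ be a $K$-approximate group such that $\langle A\rangle$ is abelian. Then for every $m>0$ there exists an $m$-proper coset progression $HP$ of rank at most $K^{a}$ such that $$A\subset HP\subset A^{k_{K,m}}.$$
   Context: For subsets $A,B$ of a group write $AB=\{ab:a\in A,b\in B\}$ and $A^n=\{a_1\cdots a_n:a_i\in A\}$; $\langle A\rangle$ is the subgroup generated by $A$. $K$-approximate group: a finite subset $A$ of a group $G$ that is symmetric ($A=A^{-1}$), contains the identity, and for which there is $X\subset G$ with $|X|\le K$ and $A^2\subset XA$. Coset progression (abelian setting): a set $HP$ where $H$ is a finite subgroup of an abelian group and $P=\{u_1^{\ell_1}\cdots u_d^{\ell_d}:\ell_i\in\mathbb{Z},|\ell_i|\le L_i\}$ for some elements $u_1,\ldots,u_d$ of that group and positive integers $L_1,\ldots,L_d$; $d$ is its rank ($d=0$, $P=\{1\}$, is allowed). It is $m$-proper if the images in $\langle HP\rangle/H$ of the elements $u_1^{\ell_1}\cdots u_d^{\ell_d}$ are all distinct as the $\ell_i$ range over integers with $|\ell_i|\le mL_i$. *)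

theory Defs
  imports Complex_Main "HOL-Algebra.Elementary_Groups" "HOL-Algebra.FiniteProduct"
begin

primrec set_power :: "('a, 'b) monoid_scheme \<Rightarrow> 'a set \<Rightarrow> nat \<Rightarrow> 'a set" where
  "set_power G A 0 = {\<one>\<^bsub>G\<^esub>}"
| "set_power G A (Suc n) = set_power G A n <#>\<^bsub>G\<^esub> A"

definition approximate_group :: "('a, 'b) monoid_scheme \<Rightarrow> real \<Rightarrow> 'a set \<Rightarrow> bool" where
  "approximate_group G K A \<longleftrightarrow>
     A \<subseteq> carrier G \<and> finite A \<and> set_inv\<^bsub>G\<^esub> A = A \<and> \<one>\<^bsub>G\<^esub> \<in> A \<and>
     (\<exists>X. X \<subseteq> carrier G \<and> finite X \<and> real (card X) \<le> K \<and>
          set_power G A 2 \<subseteq> X <#>\<^bsub>G\<^esub> A)"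

(* The generators and side lengths of a progression of rank d are u 0, ..., u (d - 1) and
   L 0, ..., L (d - 1); the values of u and L at other arguments are irrelevant. *)

definition monomial :: "('a, 'b) monoid_scheme \<Rightarrow> nat \<Rightarrow> (nat \<Rightarrow> 'a) \<Rightarrow> (nat \<Rightarrow> int) \<Rightarrow> 'a" where
  "monomial G d u l = (\<Otimes>\<^bsub>G\<^esub>i\<in>{..<d}. u i [^]\<^bsub>G\<^esub> l i)"

definition progression :: "('a, 'b) monoid_scheme \<Rightarrow> nat \<Rightarrow> (nat \<Rightarrow> 'a) \<Rightarrow> (nat \<Rightarrow> nat) \<Rightarrow> 'a set" where
  "progression G d u L =
     monomial G d u ` (\<Pi>\<^sub>E i\<in>{..<d}. {j. \<bar>j\<bar> \<le> int (L i)})"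

definition coset_progression ::
  "('a, 'b) monoid_scheme \<Rightarrow> 'a set \<Rightarrow> nat \<Rightarrow> (nat \<Rightarrow> 'a) \<Rightarrow> (nat \<Rightarrow> nat) \<Rightarrow> 'a set" where
  "coset_progression G H d u L = H <#>\<^bsub>G\<^esub> progression G d u L"

definition is_coset_progression ::
  "('a, 'b) monoid_scheme \<Rightarrow> 'a set \<Rightarrow> nat \<Rightarrow> (nat \<Rightarrow> 'a) \<Rightarrow> (nat \<Rightarrow> nat) \<Rightarrow> bool" where
  "is_coset_progression G H d u L \<longleftrightarrow>
     comm_group G \<and> subgroup H G \<and> finite H \<and> (\<forall>i<d. u i \<in> carrier G \<and> 0 < L i)"

(* H #> x is the image of x in the quotient by H.  The coset of x is the same set whether it is
   formed in G or in the subgroup generated by H P, to which all the monomials belong. *)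
definition proper_coset_progression ::
  "('a, 'b) monoid_scheme \<Rightarrow> real \<Rightarrow> 'a set \<Rightarrow> nat \<Rightarrow> (nat \<Rightarrow> 'a) \<Rightarrow> (nat \<Rightarrow> nat) \<Rightarrow> bool" where
  "proper_coset_progression G m H d u L \<longleftrightarrow>
     is_coset_progression G H d u L \<and>
     inj_on (\<lambda>l. H #>\<^bsub>G\<^esub> monomial G d u l)
       (\<Pi>\<^sub>E i\<in>{..<d}. {j. real_of_int \<bar>j\<bar> \<le> m * real (L i)})"

definition abelian_freiman ::
  "('a, 'b) monoid_scheme \<Rightarrow> real \<Rightarrow> (real \<Rightarrow> real \<Rightarrow> nat) \<Rightarrow> bool" where
  "abelian_freiman G a k \<longleftrightarrow>
     (\<forall>K A. 1 \<le> K \<and> approximate_group G K A \<and> comm_group (subgroup_generated G A) \<longrightarrow>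
       (\<forall>m>0. \<exists>H d u L.
          proper_coset_progression (subgroup_generated G A) m H d u L \<and>
          real d \<le> K powr a \<and>
          A \<subseteq> coset_progression (subgroup_generated G A) H d u L \<and>
          coset_progression (subgroup_generated G A) H d u L \<subseteq> set_power G A (k K m)))"

(* An existential statement about all groups over a type 'g would let the constants depend on 'g.
   To express that they are absolute, one asserts that a and k exist for all groups
   with elements in nat, and that every such a and k serve for groups over an arbitrary type. *)

end

theory Submission
  imports Defs "HOL-Library.Countable_Set"
begin

text \<open>
  Let \<open>A\<close> be covered as \<open>A <#> A \<subseteq> X <#> A\<close> with at most \<open>r\<close> translates in an abelian group generated by \<open>A\<close>. Iterating
  gives \<open>A\<^sup>n\<^sup>+\<^sup>1 \<subseteq> X\<^sup>n <#> A\<close>, hence polynomial growth of degree \<open>r\<close>. With it, Fourier analysis over a finite group of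
  characters separating the points of a large power of \<open>A\<close> yields boundedly many characters such that the elements of
  \<open>A\<^sup>8\<close> on which all of them are close to 1 lie in \<open>A\<^sup>4\<close>. The arguments of these characters embed this
  neighbourhood, modulo a finite subgroup, in a cube as a set closed under short differences, and successive shortest
  vectors present such a set as a progression. Finitely many translates then cover \<open>A\<close>, and each relation that
  violates properness is used to lower the rank. A sufficiently proper progression has rank at most \<open>r\<close>, because its
  coordinates turn \<open>A\<close> into a set of integer vectors that spans the whole space and still has growth of degree \<open>r\<close>;
  thus the exponent 1 suffices.
\<close>

section \<open>Finite local subgroups of a cube\<close>

text \<open>All constants must be fixed before the group is, and the group may be infinite.
  Polynomial growth supplies the uniformity: below a bound depending only on \<open>r\<close> and
  \<open>e\<close> there is an \<open>N\<close> for which \<open>A^(N+2)\<close> is at most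
  \<open>1 + e\<close> times as large as \<open>A^N\<close>, and the energy is then nearly maximal.
  No Haar measure on a dual is involved, since only finitely many points must be told apart.
  Arguments of characters serve as coordinates only near 1, where they add; hence local subgroups of
  a cube in place of lattices. Covering \<open>A\<close> by translates makes the rank very large,
  which is harmless because the final rank bound uses properness alone. But properness is bought
  with larger exponents, and the rank bound needs properness beyond the exponent reached. The circle
  is broken because each failure of properness lowers the rank, so there are boundedly many rounds.
  The claim about types holds because only the subgroup generated by \<open>A\<close> matters: it is
  countable, so constants that serve all groups on \<open>nat\<close> serve every type.\<close>

lemma local_subgroup_diff_multiple:
  fixes E :: "('i \<Rightarrow> real) set" and x w :: "'i \<Rightarrow> real"
  assumes cube: "\<And>x i. x \<in> E \<Longrightarrow> i \<in> I \<Longrightarrow> \<bar>x i\<bar> \<le> 1"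
    and diff: "\<And>x y. x \<in> E \<Longrightarrow> y \<in> E \<Longrightarrow> (\<forall>i\<in>I. \<bar>x i - y i\<bar> \<le> 1) \<Longrightarrow> (\<lambda>i. x i - y i) \<in> E"
    and zero: "(\<lambda>_. 0) \<in> E"
    and x: "x \<in> E" and w: "w \<in> E"
    and small: "\<forall>i\<in>I. \<bar>x i - of_int j * w i\<bar> \<le> 1"
  shows "(\<lambda>i. x i - of_int j * w i) \<in> E"
proof -
  have nat_case: "(\<lambda>i. x i - real n * w i) \<in> E"
    if "w \<in> E" "\<forall>i\<in>I. \<bar>x i - real n * w i\<bar> \<le> 1" for n and w :: "'i \<Rightarrow> real"
    using that
  proof (induction n)
    case 0
    then show ?case using x by simp
  next
    case (Suc n)
    \<comment> \<open>The cube is convex and \<open>x - n w\<close> lies on the segment from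
      \<open>x\<close> to \<open>x - (n + 1) w\<close>, so no intermediate point leaves the
      cube.\<close>
    have conv: "\<bar>x i - real n * w i\<bar> \<le> 1" if "i \<in> I" for i
    proof -
      have "\<bar>x i - real (Suc n) * w i\<bar> \<le> 1" "\<bar>x i\<bar> \<le> 1"
        using Suc.prems that cube[OF x that] by auto
      then show ?thesis
        by (cases "w i \<ge> 0") (auto simp: algebra_simps abs_le_iff,
            smt (verit) mult_nonneg_nonneg of_nat_0_le_iff,
            smt (verit) mult_nonneg_nonpos of_nat_0_le_iff)
    qed
    then have "(\<lambda>i. x i - real n * w i) \<in> E" using Suc by blast
    from diff[OF this Suc.prems(1)] Suc.prems(2)
    show ?case by (simp add: algebra_simps)
  qed
  have mw: "(\<lambda>i. - w i) \<in> E"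
    using diff[OF zero w] cube[OF w] by simp
  show ?thesis
  proof (cases "j \<ge> 0")
    case True
    then show ?thesis using nat_case[OF w, of "nat j"] small by simp
  next
    case False
    then show ?thesis using nat_case[OF mw, of "nat (-j)"] small by simp
  qed
qed

text \<open>The generators are subtracted one at a time. The bound on \<open>c\<close> plus the sum
  of the \<open>L k * s k\<close> pays for all of them in advance, so every partial difference stays
  in the cube, whatever the signs of the coefficients.\<close>

lemma local_subgroup_diff_combination:
  fixes E :: "('i \<Rightarrow> real) set" and x :: "'i \<Rightarrow> real" and d :: nat
  assumes cube: "\<And>x i. x \<in> E \<Longrightarrow> i \<in> I \<Longrightarrow> \<bar>x i\<bar> \<le> 1"
    and diff: "\<And>x y. x \<in> E \<Longrightarrow> y \<in> E \<Longrightarrow> (\<forall>i\<in>I. \<bar>x i - y i\<bar> \<le> 1) \<Longrightarrow> (\<lambda>i. x i - y i) \<in> E"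
    and zero: "(\<lambda>_. 0) \<in> E"
    and x: "x \<in> E" and xc: "\<And>i. i \<in> I \<Longrightarrow> \<bar>x i\<bar> \<le> c"
    and v: "\<And>k. k < d \<Longrightarrow> v k \<in> E" "\<And>k i. k < d \<Longrightarrow> i \<in> I \<Longrightarrow> \<bar>v k i\<bar> \<le> s k"
    and s: "\<And>k. k < d \<Longrightarrow> 0 \<le> s k"
    and l: "\<And>k. k < d \<Longrightarrow> \<bar>l k\<bar> \<le> int (L k)"
    and tot: "c + (\<Sum>k<d. real (L k) * s k) \<le> 1"
  shows "(\<lambda>i. x i - (\<Sum>k<d. of_int (l k) * v k i)) \<in> E \<and>
     (\<forall>i\<in>I. \<bar>x i - (\<Sum>k<d. of_int (l k) * v k i)\<bar> \<le> c + (\<Sum>k<d. real (L k) * s k))"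
  using v s l tot
proof (induction d)
  case 0
  then show ?case using x xc by simp
next
  case (Suc d)
  have "0 \<le> real (L d) * s d" using Suc.prems(3)[of d] by simp
  then have t: "c + (\<Sum>k<d. real (L k) * s k) \<le> 1" using Suc.prems(5) by simp
  let ?y = "\<lambda>i. x i - (\<Sum>k<d. of_int (l k) * v k i)"
  have y: "?y \<in> E" "\<forall>i\<in>I. \<bar>?y i\<bar> \<le> c + (\<Sum>k<d. real (L k) * s k)"
    using Suc.IH Suc.prems t by auto
  have lv: "\<bar>of_int (l d) * v d i\<bar> \<le> real (L d) * s d" if "i \<in> I" for i
    unfolding abs_mult
  proof (rule mult_mono)
    show "\<bar>real_of_int (l d)\<bar> \<le> real (L d)"
      using Suc.prems(4)[of d] by (metis lessI of_int_abs of_int_le_iff of_int_of_nat_eq)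
  qed (use Suc.prems(2)[OF lessI that] in auto)
  have b: "\<forall>i\<in>I. \<bar>?y i - of_int (l d) * v d i\<bar> \<le> c + (\<Sum>k<Suc d. real (L k) * s k)"
  proof
    fix i assume i: "i \<in> I"
    have "\<bar>?y i - of_int (l d) * v d i\<bar> \<le> \<bar>?y i\<bar> + \<bar>of_int (l d) * v d i\<bar>" by linarith
    also have "\<dots> \<le> (c + (\<Sum>k<d. real (L k) * s k)) + real (L d) * s d"
      using y(2) i lv[OF i] by (intro add_mono) auto
    finally show "\<bar>?y i - of_int (l d) * v d i\<bar> \<le> c + (\<Sum>k<Suc d. real (L k) * s k)" by simp
  qed
  have "(\<lambda>i. ?y i - of_int (l d) * v d i) \<in> E"
    by (rule local_subgroup_diff_multiple[where I = I])
      (use cube diff zero y(1) Suc.prems(1)[OF lessI] b Suc.prems(5) in \<open>auto intro: order_trans\<close>)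
  then show ?case using b by (simp add: algebra_simps)
qed

text \<open>Here \<open>s k\<close> bounds the sup norm of \<open>v k\<close>. The budget on the sum
  of the \<open>L k * s k\<close> confines the whole progression to the cube, where arguments of
  characters can later be added without wrapping round. Only a neighbourhood of 0 is covered; its
  radius loses a factor 16 per dimension, 2 from a projection and 8 from a dilation.\<close>

definition progression_cover ::
  "'i set \<Rightarrow> ('i \<Rightarrow> real) set \<Rightarrow> nat \<Rightarrow> (nat \<Rightarrow> 'i \<Rightarrow> real) \<Rightarrow> (nat \<Rightarrow> nat) \<Rightarrow> (nat \<Rightarrow> real) \<Rightarrow> bool" where
  "progression_cover I E d v L s \<longleftrightarrow> d \<le> card I \<and>
    (\<forall>k<d. v k \<in> E \<and> 0 < L k \<and> 0 \<le> s k \<and> (\<forall>i\<in>I. \<bar>v k i\<bar> \<le> s k)) \<and>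
    (\<Sum>k<d. real (L k) * s k) \<le> 1 \<and>
    (\<forall>x\<in>E. (\<forall>i\<in>I. \<bar>x i\<bar> \<le> (1/16) ^ card I) \<longrightarrow>
      (\<exists>l :: nat \<Rightarrow> int. (\<forall>k<d. \<bar>l k\<bar> \<le> int (L k)) \<and> (\<forall>i. x i = (\<Sum>k<d. of_int (l k) * v k i))))"

text \<open>Induction on the dimension: let \<open>w\<close> be a shortest nonzero vector of \<open>E\<close> and project along \<open>w\<close>
  onto the hyperplane where the largest coordinate of \<open>w\<close> vanishes. Every point of the projection of \<open>E\<close>
  close to the origin has a lift in \<open>E\<close> whose deleted coordinate is at most half that of \<open>w\<close>, so the
  projection is again closed under short differences, and lifts are at most twice as long.\<close>

lemma local_subgroup_progression:
  fixes E :: "('i \<Rightarrow> real) set"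
  assumes "finite I" and "finite E"
    and zero: "(\<lambda>_. 0) \<in> E"
    and supp: "\<And>x i. x \<in> E \<Longrightarrow> i \<notin> I \<Longrightarrow> x i = 0"
    and cube: "\<And>x i. x \<in> E \<Longrightarrow> i \<in> I \<Longrightarrow> \<bar>x i\<bar> \<le> 1"
    and diff: "\<And>x y. x \<in> E \<Longrightarrow> y \<in> E \<Longrightarrow> (\<forall>i\<in>I. \<bar>x i - y i\<bar> \<le> 1) \<Longrightarrow> (\<lambda>i. x i - y i) \<in> E"
  shows "\<exists>d v L s. progression_cover I E d v L s"
  using assms
proof (induction "card I" arbitrary: I E)
  case 0
  then have "I = {}" by simp
  then have "x = (\<lambda>_. 0)" if "x \<in> E" for x using 0 that by auto
  then show ?case unfolding progression_cover_def by (intro exI[of _ 0]) force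
next
  case (Suc n)
  note zero = Suc.prems(3) and supp = Suc.prems(4) and cube = Suc.prems(5) and diff = Suc.prems(6)
  note fin = Suc.prems(1,2)
  have "I \<noteq> {}" using Suc.hyps by auto
  have cI: "card I = Suc n" using Suc.hyps by simp
  show ?case
  \<comment> \<open>Without a nonzero vector of size at most 1/8 the neighbourhood to be covered is
    \<open>{0}\<close>, and rank 0 suffices. Otherwise the shortest vector has size at most 1/8,
    which leaves room for rounding errors.\<close>
  proof (cases "\<forall>x\<in>E. (\<forall>i\<in>I. \<bar>x i\<bar> \<le> 1/8) \<longrightarrow> x = (\<lambda>_. 0)")
    case True
    have "(1/16::real) ^ card I \<le> (1/16) ^ 1"
      unfolding cI by (rule power_decreasing) auto
    then have "x = (\<lambda>_. 0)" if "x \<in> E" "\<forall>i\<in>I. \<bar>x i\<bar> \<le> (1/16) ^ card I" for x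
      using that True by force
    then show ?thesis unfolding progression_cover_def by (intro exI[of _ 0]) force
  next
    case False
    then obtain x0 where x0: "x0 \<in> E" "\<forall>i\<in>I. \<bar>x0 i\<bar> \<le> 1/8" "x0 \<noteq> (\<lambda>_. 0)" by blast
    define nm where "nm x = Max ((\<lambda>i. \<bar>x i\<bar>) ` I)" for x :: "'i \<Rightarrow> real"
    have nm: "\<And>x i. i \<in> I \<Longrightarrow> \<bar>x i\<bar> \<le> nm x" "\<And>x. \<exists>i\<in>I. nm x = \<bar>x i\<bar>"
      unfolding nm_def using fin(1) \<open>I \<noteq> {}\<close>
       apply simp
      by (metis (mono_tags, lifting) Max_in finite_imageI imageE image_is_empty \<open>I \<noteq> {}\<close> fin(1))
    let ?E0 = "E - {\<lambda>_. 0}"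
    have "finite ?E0" "?E0 \<noteq> {}" using fin x0 by auto
    then obtain w where w: "w \<in> ?E0" "\<And>x. x \<in> ?E0 \<Longrightarrow> nm w \<le> nm x"
      using arg_min_if_finite[of ?E0 nm] by (metis not_le)
    define lam where "lam = nm w"
    obtain i0 where i0: "i0 \<in> I" "lam = \<bar>w i0\<bar>" using nm(2) lam_def by blast
    have wE: "w \<in> E" and wle: "\<And>i. i \<in> I \<Longrightarrow> \<bar>w i\<bar> \<le> lam" using w nm lam_def by auto
    have wle': "\<bar>w i\<bar> \<le> lam" for i using wle[of i] supp[OF wE, of i] i0(2) by (cases "i \<in> I") auto
    have lam0: "lam > 0"
    proof (rule ccontr)
      assume "\<not> lam > 0"
      then have "w i = 0" for i using wle'[of i] by simp
      then show False using w(1) by auto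
    qed
    then have w0: "w i0 \<noteq> 0" using i0 by auto
    have lam8: "lam \<le> 1/8"
      using w(2)[of x0] x0 nm(2)[of x0] unfolding lam_def by force
    have mini: "x = (\<lambda>_. 0)" if "x \<in> E" "\<And>i. i \<in> I \<Longrightarrow> \<bar>x i\<bar> < lam" for x
      using w(2)[of x] nm(2)[of x] that unfolding lam_def by fastforce
    define p where "p x i = x i - (x i0 / w i0) * w i" for x i
    have p_i0: "p x i0 = 0" for x using w0 by (simp add: p_def)
    have ratio: "\<bar>t / w i0 * w i\<bar> \<le> \<bar>t\<bar>" for t i
    proof -
      have "\<bar>t / w i0 * w i\<bar> = \<bar>t\<bar> / lam * \<bar>w i\<bar>" by (simp add: abs_mult i0(2))
      also have "\<dots> \<le> \<bar>t\<bar> / lam * lam" by (intro mult_left_mono) (use lam0 wle' in auto)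
      finally show ?thesis using lam0 by simp
    qed
    have p_le: "\<bar>p x i\<bar> \<le> \<bar>x i\<bar> + \<bar>x i0\<bar>" for x i
      using ratio[of "x i0" i] unfolding p_def by linarith
    have le_p: "\<bar>x i\<bar> \<le> \<bar>p x i\<bar> + \<bar>x i0\<bar>" for x i
      using ratio[of "x i0" i] unfolding p_def by linarith
    have p_diff: "p (\<lambda>i. x i - y i) i = p x i - p y i" for x y i
      by (simp add: p_def algebra_simps diff_divide_distrib)
    \<comment> \<open>Subtracting the multiple of \<open>w\<close> nearest in coordinate
      \<open>i0\<close> keeps the projection and leaves at most half of \<open>lam\<close> there;
      the other coordinates are then controlled by \<open>le_p\<close>.\<close>
    have reduce: "\<exists>x'\<in>E. (\<forall>i. p x' i = p x i) \<and> \<bar>x' i0\<bar> \<le> lam / 2"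
      if "x \<in> E" "\<forall>i\<in>I. \<bar>8 * p x i\<bar> \<le> 1" for x
    proof -
      have px: "\<bar>p x i\<bar> \<le> 1/8" if "i \<in> I" for i
        using \<open>\<forall>i\<in>I. \<bar>8 * p x i\<bar> \<le> 1\<close> that by (auto simp: abs_mult)
      define j where "j = round (x i0 / w i0)"
      let ?x = "\<lambda>i. x i - of_int j * w i"
      have "\<bar>x i0 / w i0 - of_int j\<bar> \<le> 1/2"
        unfolding j_def using of_int_round_abs_le[of "x i0 / w i0"] by (simp add: abs_minus_commute)
      then have "\<bar>x i0 / w i0 - of_int j\<bar> * \<bar>w i0\<bar> \<le> 1/2 * \<bar>w i0\<bar>" by (rule mult_right_mono) simp
      moreover have "\<bar>x i0 / w i0 - of_int j\<bar> * \<bar>w i0\<bar> = \<bar>?x i0\<bar>"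
        unfolding abs_mult[symmetric] using w0 by (simp add: algebra_simps)
      ultimately have a: "\<bar>?x i0\<bar> \<le> lam / 2" using i0 by simp
      have b: "p ?x i = p x i" for i using w0 by (simp add: p_def field_simps)
      have "\<bar>?x i\<bar> \<le> 1" if "i \<in> I" for i
        using le_p[of ?x i] a b[of i] lam8 px[OF that] by linarith
      then have "?x \<in> E"
        by (intro local_subgroup_diff_multiple[where I = I]) (use cube diff zero that wE in auto)
      then show ?thesis using a b by auto
    qed
    \<comment> \<open>The projection is kept only where it has size at most 1/8, and is dilated back
      to the unit cube. Reduced lifts of two such points have size at most 1/8 + 1/16, so their
      difference is short enough to stay in \<open>E\<close>.\<close>
    define E' where "E' = {y. \<exists>x\<in>E. y = (\<lambda>i. 8 * p x i) \<and> (\<forall>i\<in>I. \<bar>8 * p x i\<bar> \<le> 1)}"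
    let ?I = "I - {i0}"
    have "n = card ?I" "finite ?I" using cI i0 fin by auto
    have "\<exists>d v L s. progression_cover ?I E' d v L s"
    proof (rule Suc.hyps(1)[OF \<open>n = card ?I\<close> \<open>finite ?I\<close>])
      have "E' \<subseteq> (\<lambda>x i. 8 * p x i) ` E" unfolding E'_def by auto
      then show "finite E'" using fin(2) finite_surj by blast
      show "(\<lambda>_. 0) \<in> E'" unfolding E'_def using zero by (auto simp: p_def intro!: bexI[of _ "\<lambda>_. 0"])
      show "x i = 0" if "x \<in> E'" "i \<notin> ?I" for x i
        using that p_i0 supp supp[OF wE] unfolding E'_def by (auto simp: p_def)
      show "\<bar>x i\<bar> \<le> 1" if "x \<in> E'" "i \<in> ?I" for x i
        using that unfolding E'_def by auto
      fix y y' assume y: "y \<in> E'" "y' \<in> E'" "\<forall>i\<in>?I. \<bar>y i - y' i\<bar> \<le> 1"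
      obtain x x' where x: "x \<in> E" "y = (\<lambda>i. 8 * p x i)" "\<forall>i\<in>I. \<bar>8 * p x i\<bar> \<le> 1"
        and x': "x' \<in> E" "y' = (\<lambda>i. 8 * p x' i)" "\<forall>i\<in>I. \<bar>8 * p x' i\<bar> \<le> 1"
        using y unfolding E'_def by auto
      obtain z where z: "z \<in> E" "\<forall>i. p z i = p x i" "\<bar>z i0\<bar> \<le> lam / 2"
        using reduce[OF x(1,3)] by blast
      obtain z' where z': "z' \<in> E" "\<forall>i. p z' i = p x' i" "\<bar>z' i0\<bar> \<le> lam / 2"
        using reduce[OF x'(1,3)] by blast
      have "\<bar>z i - z' i\<bar> \<le> 1" if "i \<in> I" for i
      proof -
        have "\<bar>z i\<bar> \<le> 1/8 + lam/2" "\<bar>z' i\<bar> \<le> 1/8 + lam/2"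
          using le_p[of z i] le_p[of z' i] z z' x(3) x'(3) that by (force simp: abs_mult)+
        then show ?thesis using lam8 by linarith
      qed
      then have "(\<lambda>i. z i - z' i) \<in> E" using diff z z' by blast
      moreover have eq: "y i - y' i = 8 * p (\<lambda>i. z i - z' i) i" for i
        using z(2) z'(2) x(2) x'(2) by (simp add: p_diff)
      moreover have "\<bar>8 * p (\<lambda>i. z i - z' i) i\<bar> \<le> 1" if "i \<in> I" for i
        unfolding eq[symmetric] using y(3) p_i0 x(2) x'(2) that by (cases "i = i0") auto
      ultimately show "(\<lambda>i. y i - y' i) \<in> E'"
        unfolding E'_def by blast
    qed
    then obtain d v' L s where "progression_cover ?I E' d v' L s" by blast
    note H = this[unfolded progression_cover_def]
    from H have d: "d \<le> card ?I"
      and v': "\<And>k. k < d \<Longrightarrow> v' k \<in> E'" and L0: "\<And>k. k < d \<Longrightarrow> 0 < L k"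
      and s0: "\<And>k. k < d \<Longrightarrow> (0::real) \<le> s k"
      and vs: "\<And>k i. k < d \<Longrightarrow> i \<in> ?I \<Longrightarrow> \<bar>v' k i\<bar> \<le> s k"
      and tot: "(\<Sum>k<d. real (L k) * s k) \<le> 1"
      by blast+
    from H have cov: "(\<forall>i\<in>?I. \<bar>x i\<bar> \<le> (1/16) ^ card ?I) \<longrightarrow>
        (\<exists>l :: nat \<Rightarrow> int. (\<forall>k<d. \<bar>l k\<bar> \<le> int (L k)) \<and> (\<forall>i. x i = (\<Sum>k<d. of_int (l k) * v' k i)))"
      if "x\<in>E'" for x using that by blast
    have "\<exists>x\<in>E. (\<forall>i. v' k i = 8 * p x i) \<and> \<bar>x i0\<bar> \<le> lam / 2" if "k < d" for k
    proof -
      obtain x where x: "x \<in> E" "v' k = (\<lambda>i. 8 * p x i)" "\<forall>i\<in>I. \<bar>8 * p x i\<bar> \<le> 1"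
        using v'[OF \<open>k < d\<close>] unfolding E'_def by auto
      show ?thesis using reduce[OF x(1,3)] unfolding x(2) by metis
    qed
    then obtain u where u: "\<And>k. k < d \<Longrightarrow> u k \<in> E" "\<And>k i. k < d \<Longrightarrow> v' k i = 8 * p (u k) i"
      "\<And>k. k < d \<Longrightarrow> \<bar>u k i0\<bar> \<le> lam / 2" by metis
    \<comment> \<open>Minimality of \<open>w\<close> enters: a nonzero \<open>u k\<close> has a
      coordinate of size at least \<open>lam\<close>, and it is not \<open>i0\<close>. The
      projection has size at least \<open>lam / 2\<close> there, so
      \<open>lam / 2 \<le> s k / 8\<close>, and the whole lift is bounded by twice
      \<open>s k / 8\<close>.\<close>
    have us: "\<bar>u k i\<bar> \<le> s k / 4" if "k < d" "i \<in> I" for k i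
    proof (cases "u k = (\<lambda>_. 0)")
      case True
      then show ?thesis using s0 that by simp
    next
      case False
      then obtain i' where i': "i' \<in> I" "\<bar>u k i'\<bar> \<ge> lam"
        using mini[OF u(1)[OF \<open>k < d\<close>]] by (metis not_le)
      have "i' \<noteq> i0" using i'(2) u(3)[OF that(1)] lam0 by auto
      then have "8 * \<bar>p (u k) i'\<bar> \<le> s k" using vs[OF that(1), of i'] u(2)[OF that(1), of i'] i'(1) by (auto simp: abs_mult)
      then have "lam / 2 \<le> s k / 8" using le_p[of "u k" i'] i'(2) u(3)[OF that(1)] by linarith
      moreover have "8 * \<bar>p (u k) i\<bar> \<le> s k"
        using vs[OF that(1), of i] u(2)[OF that(1), of i] that(2) s0[OF that(1)] p_i0[of "u k"]
        by (cases "i = i0") (auto simp: abs_mult)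
      ultimately show ?thesis using le_p[of "u k" i] u(3)[OF that(1)] by linarith
    qed
    \<comment> \<open>Once the other generators are subtracted, a vector of size at most 5/16 = 1/16
      + 1/4 remains. Rounding up costs at most one \<open>lam\<close>, so
      \<open>M * lam \<le> 7/16\<close>, and together with the 1/4 spent on the lifts the budget 1
      is respected.\<close>
    define M where "M = nat \<lceil>(5/16) / lam\<rceil>"
    have M0: "0 < M" unfolding M_def using lam0 by simp
    have M: "real M * lam \<le> 7/16" "(5/16) / lam \<le> real M"
    proof -
      have "real M \<le> (5/16) / lam + 1" unfolding M_def using lam0 by simp
      then have "real M * lam \<le> ((5/16) / lam + 1) * lam" using lam0 by (intro mult_right_mono) auto
      also have "\<dots> = 5/16 + lam" using lam0 by (simp add: field_simps)
      finally show "real M * lam \<le> 7/16" using lam8 by simp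
      show "(5/16) / lam \<le> real M" unfolding M_def by linarith
    qed
    have tot4: "(\<Sum>k<d. real (L k) * (s k / 4)) \<le> 1/4"
      using tot by (simp add: sum_divide_distrib[symmetric])
    have cov': "\<exists>l :: nat \<Rightarrow> int. (\<forall>k<Suc d. \<bar>l k\<bar> \<le> int ((L(d := M)) k)) \<and>
        (\<forall>i. x i = (\<Sum>k<Suc d. of_int (l k) * (u(d := w)) k i))"
      if x: "x \<in> E" "\<forall>i\<in>I. \<bar>x i\<bar> \<le> (1/16) ^ card I" for x
    proof -
      have xi: "\<bar>x i\<bar> \<le> (1/16) ^ Suc n" if "i \<in> I" for i using x that cI by simp
      have pn: "(1/16::real) ^ n \<le> 1" by (simp add: power_le_one)
      have px: "\<bar>8 * p x i\<bar> \<le> (1/16) ^ n" if "i \<in> I" for i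
        using p_le[of x i] xi[OF that] xi[OF i0(1)] by (simp add: abs_mult)
      have "(\<lambda>i. 8 * p x i) \<in> E'" unfolding E'_def
        using x(1) px pn by (auto intro!: bexI[of _ x] intro: order_trans)
      moreover have "\<forall>i\<in>?I. \<bar>8 * p x i\<bar> \<le> (1/16) ^ card ?I"
        using px \<open>n = card ?I\<close> by auto
      ultimately obtain l where l': "(\<forall>k<d. \<bar>l k\<bar> \<le> int (L k)) \<and> (\<forall>i. 8 * p x i = (\<Sum>k<d. of_int (l k) * v' k i))"
        using cov by blast
      then have l: "\<And>k. k < d \<Longrightarrow> \<bar>l k\<bar> \<le> int (L k)"
        "\<And>i. 8 * p x i = (\<Sum>k<d. of_int (l k) * v' k i)"
        by blast+
      define y where "y i = x i - (\<Sum>k<d. of_int (l k) * u k i)" for i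
      have "y \<in> E \<and> (\<forall>i\<in>I. \<bar>y i\<bar> \<le> 1/16 + (\<Sum>k<d. real (L k) * (s k / 4)))"
        unfolding y_def
      proof (rule local_subgroup_diff_combination[where I = I])
        fix i assume "i \<in> I"
        then show "\<bar>x i\<bar> \<le> 1/16" using xi[of i] pn by simp
      qed (use cube diff zero x u us s0 l tot4 in auto)
      then have y: "y \<in> E" "\<And>i. i \<in> I \<Longrightarrow> \<bar>y i\<bar> \<le> 5/16" using tot4 by force+
      have py: "p y i = 0" for i
      proof -
        have "p y i = p x i - (\<Sum>k<d. of_int (l k) * p (u k) i)"
          unfolding p_def y_def
          by (simp add: algebra_simps diff_divide_distrib sum_subtractf sum_distrib_left sum_divide_distrib)
        also have "8 * (\<Sum>k<d. of_int (l k) * p (u k) i) = 8 * p x i"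
          using l(2)[of i] u(2) by (simp add: sum_distrib_left algebra_simps)
        then have "p x i - (\<Sum>k<d. of_int (l k) * p (u k) i) = 0" by simp
        finally show ?thesis .
      qed
      have yw: "y i = (y i0 / w i0) * w i" for i
        using py[of i] unfolding p_def right_minus_eq .
      \<comment> \<open>The remainder projects to 0, hence is a real multiple of \<open>w\<close>.
        Were the multiple not an integer, the rounding error would give a nonzero vector of
        \<open>E\<close> shorter than \<open>w\<close>.\<close>
      define j where "j = round (y i0 / w i0)"
      let ?z = "\<lambda>i. y i - of_int j * w i"
      have zi: "\<bar>?z i\<bar> \<le> lam / 2" for i
      proof -
        have "?z i = (y i0 / w i0 - of_int j) * w i" by (subst yw) (simp add: algebra_simps)
        moreover have "\<bar>y i0 / w i0 - of_int j\<bar> \<le> 1/2"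
          unfolding j_def using of_int_round_abs_le[of "y i0 / w i0"] by (simp add: abs_minus_commute)
        then have "\<bar>y i0 / w i0 - of_int j\<bar> * \<bar>w i\<bar> \<le> 1/2 * lam"
          by (intro mult_mono wle') auto
        ultimately have "\<bar>?z i\<bar> \<le> 1/2 * lam" by (simp add: abs_mult)
        then show ?thesis by simp
      qed
      have "?z \<in> E"
      proof (rule local_subgroup_diff_multiple[where I = I])
        show "\<forall>i\<in>I. \<bar>?z i\<bar> \<le> 1"
        proof
          fix i show "\<bar>?z i\<bar> \<le> 1" using zi[of i] lam8 by linarith
        qed
      qed (use cube diff zero y wE in auto)
      moreover have "\<bar>?z i\<bar> < lam" for i using zi[of i] lam0 by linarith
      ultimately have "?z = (\<lambda>_. 0)" using mini[of ?z] by blast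
      then have yj: "y i = of_int j * w i" for i by (metis eq_iff_diff_eq_0)
      have "\<bar>of_int j\<bar> * lam \<le> 5/16" using y(2)[OF i0(1)] yj[of i0] i0(2) by (simp add: abs_mult)
      then have "\<bar>of_int j\<bar> \<le> (5/16) / lam" using lam0 by (simp add: pos_le_divide_eq)
      then have "\<bar>real_of_int j\<bar> \<le> real M" using M(2) by linarith
      then have "\<bar>j\<bar> \<le> int M" by linarith
      then show ?thesis
        using l(1) yj unfolding y_def
        by (intro exI[of _ "l(d := j)"]) (auto simp: less_Suc_eq diff_eq_eq add.commute)
    qed
    have "Suc d \<le> card I" using d cI \<open>n = card ?I\<close> by simp
    moreover have "(\<Sum>k<Suc d. real ((L(d := M)) k) * ((\<lambda>k. s k / 4)(d := lam)) k) \<le> 1"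
      using M(1) tot4 by simp
    moreover have "\<forall>k<Suc d. (u(d := w)) k \<in> E \<and> 0 < (L(d := M)) k \<and>
        0 \<le> ((\<lambda>k. s k / 4)(d := lam)) k \<and> (\<forall>i\<in>I. \<bar>(u(d := w)) k i\<bar> \<le> ((\<lambda>k. s k / 4)(d := lam)) k)"
      using u(1) L0 s0 us wE M0 lam0 wle by (auto simp: less_Suc_eq)
    ultimately show ?thesis unfolding progression_cover_def using cov'
      by (intro exI[of _ "Suc d"] exI[of _ "u(d := w)"] exI[of _ "L(d := M)"]
          exI[of _ "(\<lambda>k. s k / 4)(d := lam)"] conjI ballI impI)
  qed
qed

section \<open>Rational functionals separating a point from a lattice\<close>

text \<open>This is duality: characters of finite order separate the points of a free abelian group
  modulo a subgroup \<open>R\<close>. A functional with integral \<open>M * p i\<close> turns into a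
  character whose values are \<open>M\<close>-th roots of unity. The last coordinate is eliminated
  as in the Hermite normal form.\<close>

lemma sublattice_separating_functional:
  fixes R :: "(nat \<Rightarrow> int) set" and v :: "nat \<Rightarrow> int"
  assumes "\<And>x i. x \<in> R \<Longrightarrow> i \<ge> n \<Longrightarrow> x i = 0" and "(\<lambda>_. 0) \<in> R"
    and "\<And>x y. x \<in> R \<Longrightarrow> y \<in> R \<Longrightarrow> (\<lambda>i. x i - y i) \<in> R"
    and "\<And>i. i \<ge> n \<Longrightarrow> v i = 0" and "v \<notin> R"
  shows "\<exists>(p :: nat \<Rightarrow> real) (M :: nat). M > 0 \<and> (\<forall>i<n. real M * p i \<in> \<int>) \<and>
    (\<forall>x\<in>R. (\<Sum>i<n. p i * of_int (x i)) \<in> \<int>) \<and> (\<Sum>i<n. p i * of_int (v i)) \<notin> \<int>"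
  using assms
proof (induction n arbitrary: R v)
  case 0
  then have "v = (\<lambda>_. 0)" by auto
  then show ?case using 0 by simp
next
  case (Suc n)
  note supp = Suc.prems(1) and zero = Suc.prems(2) and diff = Suc.prems(3) and vsupp = Suc.prems(4) and vR = Suc.prems(5)
  have neg: "(\<lambda>i. - x i) \<in> R" if "x \<in> R" for x using diff[OF zero that] by simp
  have add: "(\<lambda>i. x i + y i) \<in> R" if "x \<in> R" "y \<in> R" for x y using diff[OF that(1) neg[OF that(2)]] by simp
  have nmult: "(\<lambda>i. int j * x i) \<in> R" if "x \<in> R" for x j
    by (induction j) (use zero add[OF that] in \<open>simp_all add: distrib_right\<close>)
  have mult: "(\<lambda>i. j * x i) \<in> R" if "x \<in> R" for x j
    using nmult[OF that, of "nat j"] neg[OF nmult[OF that, of "nat (-j)"]] by (cases "j \<ge> 0") auto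
  let ?R = "{x \<in> R. x n = 0}"
  have IH: "\<exists>(p :: nat \<Rightarrow> real) (M :: nat). M > 0 \<and> (\<forall>i<n. real M * p i \<in> \<int>) \<and>
    (\<forall>x\<in>?R. (\<Sum>i<n. p i * of_int (x i)) \<in> \<int>) \<and> (\<Sum>i<n. p i * of_int (v' i)) \<notin> \<int>"
    if "\<And>i. i \<ge> Suc n \<Longrightarrow> v' i = 0" "v' n = 0" "v' \<notin> R" for v'
  proof (rule Suc.IH)
    show "x i = 0" if "x \<in> ?R" "i \<ge> n" for x i
      using that supp[of x i] by (cases "i = n") auto
    show "v' i = 0" if "i \<ge> n" for i using that \<open>v' n = 0\<close> \<open>\<And>i. i \<ge> Suc n \<Longrightarrow> v' i = 0\<close>[of i]
      by (cases "i = n") auto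
  qed (use zero diff that in auto)
  show ?case
  proof (cases "\<forall>x\<in>R. x n = 0")
    case True
    show ?thesis
    proof (cases "v n = 0")
      case v: True
      obtain p M where p: "M > 0" "\<forall>i<n. real M * p i \<in> \<int>"
        "\<forall>x\<in>?R. (\<Sum>i<n. p i * of_int (x i)) \<in> \<int>" "(\<Sum>i<n. p i * of_int (v i)) \<notin> \<int>"
        using IH[of v] v vsupp vR by blast
      then show ?thesis
        using True v by (intro exI[of _ "p(n := 0)"] exI[of _ M]) (auto simp: less_Suc_eq)
    next
      case False
      define M where "M = nat (2 * \<bar>v n\<bar>)"
      have M: "M > 0" "real M = 2 * \<bar>of_int (v n)\<bar>" using False by (auto simp: M_def)
      \<comment> \<open>No element of \<open>R\<close> sees the last coordinate, so its coefficient
        is free; it is chosen to give \<open>v\<close> the value 1/2.\<close>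
      let ?p = "(\<lambda>_. 0 :: real)(n := 1 / (2 * of_int (v n)))"
      have "(\<Sum>i<Suc n. ?p i * of_int (v i)) = 1 / 2" using False by simp
      moreover have "1 / 2 \<notin> (\<int> :: real set)"
      proof
        assume "1 / 2 \<in> (\<int> :: real set)"
        then obtain z where "1 / 2 = (of_int z :: real)" by (elim Ints_cases)
        then have "of_int 1 = (of_int (2 * z) :: real)" by simp
        then have "1 = 2 * z" by (simp only: of_int_eq_iff)
        then show False by presburger
      qed
      moreover have "real M * (1 / (2 * of_int (v n))) = of_int (sgn (v n))"
        using False M(2) by (auto simp: sgn_if)
      then have "real M * (1 / (2 * of_int (v n))) \<in> \<int>" by (simp only: Ints_of_int)
      ultimately show ?thesis using True M False
        by (intro exI[of _ ?p] exI[of _ M]) (auto simp: less_Suc_eq)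
    qed
  next
    case False
    \<comment> \<open>The last coordinates of \<open>R\<close> form an ideal of the integers;
      \<open>q\<close> is its positive generator and \<open>w\<close> an element of \<open>R\<close>
      attaining it.\<close>
    let ?P = "\<lambda>k::nat. k > 0 \<and> (\<exists>x\<in>R. x n = int k)"
    have "\<exists>k. ?P k"
    proof -
      obtain x where x: "x \<in> R" "x n \<noteq> 0" using False by blast
      show ?thesis
      proof (cases "x n > 0")
        case True
        then show ?thesis using x(1) by (intro exI[of _ "nat (x n)"]) auto
      next
        case False
        then show ?thesis using x neg[OF x(1)] by (intro exI[of _ "nat (- x n)"]) auto
      qed
    qed
    define q where "q = (LEAST k. ?P k)"
    have "?P q" unfolding q_def by (rule LeastI_ex) fact
    then obtain w where w: "w \<in> R" "w n = int q" and q: "q > 0" by blast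
    have dvd: "int q dvd x n" if "x \<in> R" for x
    proof -
      have "(\<lambda>i. x i - (x n div int q) * w i) \<in> R" by (intro diff mult that w)
      moreover have "x n - (x n div int q) * w n = x n mod int q"
        by (simp add: w minus_div_mult_eq_mod)
      moreover have "x n mod int q < int q" "x n mod int q \<ge> 0" using q by auto
      ultimately have "nat (x n mod int q) > 0 \<Longrightarrow> ?P (nat (x n mod int q))" by force
      moreover have "nat (x n mod int q) < q" using \<open>x n mod int q < int q\<close> q by linarith
      ultimately have "nat (x n mod int q) = 0" unfolding q_def using not_less_Least by blast
      then show ?thesis using \<open>x n mod int q \<ge> 0\<close> by (simp add: mod_eq_0_iff_dvd)
    qed
    show ?thesis
    proof (cases "int q dvd v n")
      case False
      let ?p = "(\<lambda>_. 0 :: real)(n := 1 / real q)"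
      have "of_int (v n) / real q \<notin> \<int>"
      proof
        assume "of_int (v n) / real q \<in> \<int>"
        then obtain z where "of_int (v n) / real q = of_int z" by (elim Ints_cases)
        then have "real_of_int (v n) = of_int (int q * z)" using q by (simp add: field_simps)
        then have "v n = int q * z" by (simp only: of_int_eq_iff)
        then show False using False by simp
      qed
      moreover have "of_int (x n) / real q \<in> \<int>" if "x \<in> R" for x
        using dvd[OF that] q by (auto elim!: dvdE)
      ultimately show ?thesis using q
        by (intro exI[of _ ?p] exI[of _ q]) (auto simp: less_Suc_eq)
    next
      case True
      \<comment> \<open>Modulo \<open>R\<close> the last coordinate of \<open>v\<close> can be
        cleared. The coefficient \<open>t\<close> below makes the extended functional vanish on
        \<open>w\<close>, so it takes the same value on a vector as on its reduction by
        \<open>w\<close>; its denominator costs the extra factor \<open>q\<close>.\<close>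
      define v' where "v' i = v i - (v n div int q) * w i" for i
      have "v' \<notin> R"
      proof
        assume "v' \<in> R"
        from add[OF this mult[OF w(1), of "v n div int q"]] have "v \<in> R" by (simp add: v'_def)
        then show False using vR by simp
      qed
      moreover have "v' n = 0" using True w by (simp add: v'_def)
      moreover have "v' i = 0" if "i \<ge> Suc n" for i using that vsupp supp[OF w(1)] by (simp add: v'_def)
      ultimately obtain p M where p: "M > 0" "\<forall>i<n. real M * p i \<in> \<int>"
        "\<forall>x\<in>?R. (\<Sum>i<n. p i * of_int (x i)) \<in> \<int>" "(\<Sum>i<n. p i * of_int (v' i)) \<notin> \<int>"
        using IH[of v'] by blast
      define t where "t = - (\<Sum>i<n. p i * of_int (w i)) / real q"
      let ?p = "p(n := t)"
      have S: "(\<Sum>i<Suc n. ?p i * of_int (x i)) = (\<Sum>i<n. p i * of_int (x i - (x n div int q) * w i))"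
        if "int q dvd x n" for x
      proof -
        obtain y where y: "x n = int q * y" using \<open>int q dvd x n\<close> unfolding dvd_def by blast
        have "(\<Sum>i<Suc n. ?p i * of_int (x i)) = (\<Sum>i<n. p i * of_int (x i)) + t * real q * of_int y"
          by (simp add: y)
        also have "t * real q = - (\<Sum>i<n. p i * of_int (w i))" using q by (simp add: t_def)
        finally show ?thesis using q
          by (simp add: y algebra_simps sum_subtractf sum_distrib_left)
      qed
      have "(\<Sum>i<Suc n. ?p i * of_int (x i)) \<in> \<int>" if "x \<in> R" for x
      proof -
        have "(\<lambda>i. x i - (x n div int q) * w i) \<in> ?R"
          using dvd[OF that] w by (auto intro!: diff mult that)
        then show ?thesis unfolding S[of x, OF dvd[OF that]] using bspec[OF p(3)] by fast
      qed
      moreover have "(\<Sum>i<Suc n. ?p i * of_int (v i)) \<notin> \<int>"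
        unfolding S[of v, OF True] using p(4) by (simp add: v'_def)
      moreover have "real (M * q) * ?p i \<in> \<int>" if "i < Suc n" for i
      proof (cases "i = n")
        case True
        have "t * real q = - (\<Sum>i<n. p i * of_int (w i))" using q by (simp add: t_def)
        then have "real M * (t * real q) = - (\<Sum>i<n. (real M * p i) * of_int (w i))"
          by (simp add: sum_distrib_left mult.assoc)
        then have "real (M * q) * t = - (\<Sum>i<n. (real M * p i) * of_int (w i))"
          by (simp add: mult_ac)
        also have "\<dots> \<in> \<int>" using p(2) by (auto intro!: Ints_minus Ints_sum Ints_mult[of "real M * p _"])
        finally show ?thesis using True by simp
      next
        case False
        then have "real M * p i \<in> \<int>" using p(2) that by auto
        from Ints_mult[OF this, of "real q"] have "(real M * p i) * real q \<in> \<int>" by simp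
        then show ?thesis using False by (simp add: algebra_simps)
      qed
      ultimately show ?thesis using p(1) q by (intro exI[of _ ?p] exI[of _ "M * q"]) auto
    qed
  qed
qed

section \<open>Monomials and product sets\<close>

context comm_group
begin

lemma monomial_closed:
  assumes "u \<in> {..<d} \<rightarrow> carrier G"
  shows "monomial G d u l \<in> carrier G"
  unfolding monomial_def using assms by (intro finprod_closed) auto

lemma monomial_cong:
  assumes "u \<in> {..<d} \<rightarrow> carrier G" and "\<And>i. i < d \<Longrightarrow> u i = u' i" and "\<And>i. i < d \<Longrightarrow> l i = l' i"
  shows "monomial G d u l = monomial G d u' l'"
  unfolding monomial_def using assms by (intro finprod_cong') (auto simp: Pi_iff)

lemma monomial_0: "monomial G 0 u l = \<one>"
  by (simp add: monomial_def)

lemma monomial_Suc: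
  assumes "u \<in> {..<Suc d} \<rightarrow> carrier G"
  shows "monomial G (Suc d) u l = monomial G d u l \<otimes> u d [^] l d"
proof -
  have "monomial G (Suc d) u l = u d [^] l d \<otimes> monomial G d u l"
    unfolding monomial_def lessThan_Suc using assms by (subst finprod_insert) auto
  also have "\<dots> = monomial G d u l \<otimes> u d [^] l d"
    using assms by (intro m_comm monomial_closed) auto
  finally show ?thesis .
qed

lemma monomial_zero:
  assumes "u \<in> {..<d} \<rightarrow> carrier G"
  shows "monomial G d u (\<lambda>_. 0) = \<one>"
  unfolding monomial_def by (intro finprod_one_eqI) (simp add: int_pow_0)

lemma monomial_add:
  assumes "u \<in> {..<d} \<rightarrow> carrier G"
  shows "monomial G d u (\<lambda>i. l i + l' i) = monomial G d u l \<otimes> monomial G d u l'"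
proof -
  have "monomial G d u (\<lambda>i. l i + l' i) = (\<Otimes>i\<in>{..<d}. u i [^] l i \<otimes> u i [^] l' i)"
    unfolding monomial_def using assms by (intro finprod_cong') (auto simp: int_pow_mult Pi_iff)
  also have "\<dots> = monomial G d u l \<otimes> monomial G d u l'"
    unfolding monomial_def using assms by (intro finprod_multf) auto
  finally show ?thesis .
qed

lemma monomial_mult:
  assumes "u \<in> {..<d} \<rightarrow> carrier G"
  shows "monomial G d u (\<lambda>i. n * l i) = monomial G d u l [^] n"
  using assms
proof (induction d)
  case 0
  then show ?case by (simp add: monomial_0)
next
  case (Suc d)
  have u: "u \<in> {..<d} \<rightarrow> carrier G" "u d \<in> carrier G" using Suc.prems by auto
  have "monomial G (Suc d) u (\<lambda>i. n * l i) = monomial G d u l [^] n \<otimes> (u d [^] l d) [^] n"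
    using Suc.IH[OF u(1)] u(2) by (simp only: monomial_Suc[OF Suc.prems] int_pow_pow mult.commute)
  also have "\<dots> = monomial G (Suc d) u l [^] n"
    using monomial_closed[OF u(1)] u(2) by (simp only: monomial_Suc[OF Suc.prems] int_pow_distrib int_pow_closed)
  finally show ?case .
qed

lemma monomial_minus:
  assumes "u \<in> {..<d} \<rightarrow> carrier G"
  shows "monomial G d u (\<lambda>i. - l i) = inv (monomial G d u l)"
proof -
  have "monomial G d u (\<lambda>i. l i + - l i) = monomial G d u l \<otimes> monomial G d u (\<lambda>i. - l i)"
    by (rule monomial_add[OF assms])
  then have "monomial G d u l \<otimes> monomial G d u (\<lambda>i. - l i) = \<one>"
    by (simp only: right_minus monomial_zero[OF assms])
  then show ?thesis
    using inv_equality[of "monomial G d u (\<lambda>i. - l i)" "monomial G d u l"] monomial_closed[OF assms] m_comm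
    by metis
qed

lemma monomial_diff:
  assumes "u \<in> {..<d} \<rightarrow> carrier G"
  shows "monomial G d u (\<lambda>i. l i - l' i) = monomial G d u l \<otimes> inv (monomial G d u l')"
  using monomial_add[OF assms, of l "\<lambda>i. - l' i"] monomial_minus[OF assms] by simp

lemma monomial_single:
  assumes "u \<in> {..<d} \<rightarrow> carrier G" and "k < d"
  shows "monomial G d u (\<lambda>i. if i = k then n else 0) = u k [^] n"
proof -
  have "monomial G d u (\<lambda>i. if i = k then n else 0) = (\<Otimes>i\<in>{..<d}. if k = i then u i [^] n else \<one>)"
    unfolding monomial_def using assms by (intro finprod_cong') (auto simp: Pi_iff)
  also have "\<dots> = u k [^] n"
    using assms by (subst finprod_singleton) (auto simp: Pi_iff)
  finally show ?thesis .
qed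

lemma monomial_monomial:
  assumes "u \<in> {..<d} \<rightarrow> carrier G"
  shows "monomial G e (\<lambda>k. monomial G d u (z k)) n = monomial G d u (\<lambda>i. \<Sum>k<e. n k * z k i)"
proof (induction e)
  case 0
  then show ?case using monomial_zero[OF assms] by (simp add: monomial_0)
next
  case (Suc e)
  then show ?case using assms
    by (simp add: monomial_Suc monomial_closed monomial_add monomial_mult)
qed

section \<open>Progressions, cosets and properness\<close>

lemma mem_progression:
  assumes "u \<in> {..<d} \<rightarrow> carrier G"
  shows "x \<in> progression G d u L \<longleftrightarrow> (\<exists>l. (\<forall>i<d. \<bar>l i\<bar> \<le> int (L i)) \<and> x = monomial G d u l)"
proof
  assume "\<exists>l. (\<forall>i<d. \<bar>l i\<bar> \<le> int (L i)) \<and> x = monomial G d u l"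
  then obtain l where l: "\<forall>i<d. \<bar>l i\<bar> \<le> int (L i)" "x = monomial G d u l" by blast
  have "monomial G d u l = monomial G d u (restrict l {..<d})"
    by (rule monomial_cong) (use assms in auto)
  then show "x \<in> progression G d u L" unfolding progression_def l(2)
    by (rule ssubst) (rule imageI, use l(1) in \<open>auto simp: PiE_iff extensional_def\<close>)
qed (auto simp: progression_def PiE_iff)

lemma mem_coset_progression:
  assumes "u \<in> {..<d} \<rightarrow> carrier G"
  shows "x \<in> coset_progression G H d u L \<longleftrightarrow>
    (\<exists>h\<in>H. \<exists>l. (\<forall>i<d. \<bar>l i\<bar> \<le> int (L i)) \<and> x = h \<otimes> monomial G d u l)"
proof -
  have "x \<in> coset_progression G H d u L \<longleftrightarrow> (\<exists>h\<in>H. \<exists>y. y \<in> progression G d u L \<and> x = h \<otimes> y)"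
    by (auto simp: coset_progression_def set_mult_def)
  also have "\<dots> \<longleftrightarrow> (\<exists>h\<in>H. \<exists>l. (\<forall>i<d. \<bar>l i\<bar> \<le> int (L i)) \<and> x = h \<otimes> monomial G d u l)"
    (is "?P \<longleftrightarrow> ?Q")
  proof
    assume ?P
    then obtain h y where "h \<in> H" "y \<in> progression G d u L" "x = h \<otimes> y" by blast
    then show ?Q unfolding mem_progression[OF assms] by (elim exE conjE) (intro bexI exI conjI; assumption?; simp)
  next
    assume ?Q
    then obtain h l where "h \<in> H" "\<forall>i<d. \<bar>l i\<bar> \<le> int (L i)" "x = h \<otimes> monomial G d u l" by blast
    then show ?P unfolding mem_progression[OF assms]
      by (intro bexI[of _ h] exI[of _ "monomial G d u l"] conjI exI[of _ l]) simp_all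
  qed
  finally show ?thesis .
qed

lemma rcos_eq_iff:
  assumes "subgroup H G" "x \<in> carrier G" "y \<in> carrier G"
  shows "H #> x = H #> y \<longleftrightarrow> x \<otimes> inv y \<in> H"
proof -
  have "x \<in> H #> y \<longleftrightarrow> x \<otimes> inv y \<in> H"
    using subgroup.rcos_module[OF assms(1) is_group assms(3,2)] .
  moreover have "H #> x = H #> y \<longleftrightarrow> x \<in> H #> y"
    using rcos_self[OF assms(2,1)] repr_independence[OF _ assms(3,1), of x] by (intro iffI) auto
  ultimately show ?thesis by simp
qed

text \<open>Two points of the box of size \<open>m\<close> differ by a point of the box of size
  \<open>2 * m\<close>. A failure of properness thus yields a nontrivial relation in the larger box,
  which is the input of rank reduction.\<close>

lemma properI:
  assumes H: "is_coset_progression G H d u L"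
    and rel: "\<And>l. (\<And>i. i < d \<Longrightarrow> \<bar>of_int (l i)\<bar> \<le> 2 * m * real (L i)) \<Longrightarrow> monomial G d u l \<in> H \<Longrightarrow> \<forall>i<d. l i = 0"
  shows "proper_coset_progression G m H d u L"
  unfolding proper_coset_progression_def
proof (intro conjI H inj_onI)
  have sub: "subgroup H G" and u: "u \<in> {..<d} \<rightarrow> carrier G"
    using H unfolding is_coset_progression_def by auto
  let ?B = "\<Pi>\<^sub>E i\<in>{..<d}. {j. real_of_int \<bar>j\<bar> \<le> m * real (L i)}"
  fix l l' assume l: "l \<in> ?B" "l' \<in> ?B" "H #> monomial G d u l = H #> monomial G d u l'"
  have "monomial G d u l \<otimes> inv (monomial G d u l') \<in> H"
    using l(3) rcos_eq_iff[OF sub] monomial_closed[OF u] by blast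
  then have "monomial G d u (\<lambda>i. l i - l' i) \<in> H" by (simp add: monomial_diff[OF u])
  moreover have "\<bar>of_int (l i - l' i)\<bar> \<le> 2 * m * real (L i)" if "i < d" for i
  proof -
    have "real_of_int \<bar>l i\<bar> \<le> m * real (L i)" "real_of_int \<bar>l' i\<bar> \<le> m * real (L i)"
      using l(1,2) that by (auto simp: PiE_iff)
    then show ?thesis by (simp add: algebra_simps)
  qed
  ultimately have eq: "\<forall>i<d. l i - l' i = 0" using rel[of "\<lambda>i. l i - l' i"] by blast
  show "l = l'" by (rule PiE_ext[OF l(1,2)]) (use eq in simp)
qed

lemma properD:
  assumes P: "proper_coset_progression G m H d u L"
    and l: "\<forall>i<d. \<bar>of_int (l i)\<bar> \<le> m * real (L i)" and "m \<ge> 0" "monomial G d u l \<in> H" "i < d"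
  shows "l i = 0"
proof -
  have H: "subgroup H G" and u: "u \<in> {..<d} \<rightarrow> carrier G"
    using P unfolding is_coset_progression_def proper_coset_progression_def by auto
  have "H #> monomial G d u (restrict l {..<d}) = H #> monomial G d u (restrict (\<lambda>_. 0) {..<d})"
  proof -
    have "monomial G d u (restrict l {..<d}) = monomial G d u l"
      "monomial G d u (restrict (\<lambda>_. 0) {..<d}) = monomial G d u (\<lambda>_. 0)"
      by (intro monomial_cong; use u in auto)+
    moreover have "H #> monomial G d u l = H #> \<one>"
      using rcos_eq_iff[OF H monomial_closed[OF u] one_closed] assms(4) monomial_closed[OF u, of l] by simp
    ultimately show ?thesis by (simp add: monomial_zero[OF u])
  qed
  then have "restrict l {..<d} = restrict (\<lambda>_. 0) {..<d}"
    using P l assms(3) unfolding proper_coset_progression_def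
    by (elim conjE, elim inj_onD) (auto simp: PiE_iff)
  then show ?thesis using assms(5) by (metis lessThan_iff restrict_apply')
qed

section \<open>Powers of a set: covering and growth\<close>

lemma set_power_closed: "B \<subseteq> carrier G \<Longrightarrow> set_power G B n \<subseteq> carrier G"
  by (induction n) (auto simp: set_mult_def)

lemma finite_set_power: "finite B \<Longrightarrow> finite (set_power G B n)"
proof (induction n)
  case (Suc n)
  have "set_power G B (Suc n) = (\<lambda>(x, y). x \<otimes> y) ` (set_power G B n \<times> B)"
    by (auto simp: set_mult_def)
  then show ?case using Suc by simp
qed simp

lemma set_power_Suc_memI: "x \<in> set_power G B n \<Longrightarrow> y \<in> B \<Longrightarrow> x \<otimes> y \<in> set_power G B (Suc n)"
  by (auto simp: set_mult_def)

lemma set_power_add: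
  assumes "B \<subseteq> carrier G"
  shows "set_power G B (m + n) = set_power G B m <#> set_power G B n"
proof (induction n)
  case 0
  show ?case using set_power_closed[OF assms, of m] by (force simp: set_mult_def)
next
  case (Suc n)
  then show ?case using set_mult_assoc[OF set_power_closed[OF assms, of m] set_power_closed[OF assms, of n] assms]
    by (simp only: add_Suc_right set_power.simps)
qed

lemma set_power_memI:
  assumes "B \<subseteq> carrier G" "x \<in> set_power G B m" "y \<in> set_power G B n"
  shows "x \<otimes> y \<in> set_power G B (m + n)"
  unfolding set_power_add[OF assms(1)] using assms(2,3) by (auto simp: set_mult_def)

lemma set_power_1: "B \<subseteq> carrier G \<Longrightarrow> set_power G B (Suc 0) = B"
  by (auto simp: set_mult_def subset_eq)

lemma set_power_mono:
  assumes "B \<subseteq> carrier G" "\<one> \<in> B" "m \<le> n"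
  shows "set_power G B m \<subseteq> set_power G B n"
  using assms(3)
proof (induction rule: dec_induct)
  case (step k)
  have "x \<in> set_power G B (Suc k)" if "x \<in> set_power G B k" for x
    using set_power_Suc_memI[OF that assms(2)] set_power_closed[OF assms(1)] that by fastforce
  then show ?case using step by blast
qed simp

lemma one_in_set_power: "\<one> \<in> B \<Longrightarrow> B \<subseteq> carrier G \<Longrightarrow> \<one> \<in> set_power G B n"
  using set_power_mono[of B 0 n] by auto

lemma set_power_inv:
  assumes "B \<subseteq> carrier G" "\<forall>x\<in>B. inv x \<in> B" "x \<in> set_power G B n"
  shows "inv x \<in> set_power G B n"
  using assms(3)
proof (induction n arbitrary: x)
  case (Suc n)
  then obtain y z where "y \<in> set_power G B n" "z \<in> B" "x = y \<otimes> z" by (auto simp: set_mult_def)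
  moreover from this have "y \<in> carrier G" "z \<in> carrier G" using set_power_closed[OF assms(1)] assms(1) by auto
  ultimately show ?case using set_power_Suc_memI[OF Suc.IH, of y "inv z"] assms(2) by (simp only: inv_mult)
qed simp

lemma set_power_pow:
  assumes "B \<subseteq> carrier G" "x \<in> set_power G B m"
  shows "x [^] (n::nat) \<in> set_power G B (m * n)"
proof (induction n)
  case 0
  show ?case by simp
next
  case (Suc n)
  have e: "m * Suc n = m * n + m" by simp
  show ?case unfolding e nat_pow_Suc by (rule set_power_memI[OF assms(1) Suc assms(2)])
qed

lemma set_power_int_pow:
  assumes "B \<subseteq> carrier G" "\<forall>x\<in>B. inv x \<in> B" "x \<in> set_power G B m"
  shows "x [^] (n::int) \<in> set_power G B (m * nat \<bar>n\<bar>)"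
proof (cases n rule: int_cases2)
  case (nonneg k)
  show ?thesis unfolding nonneg int_pow_int using set_power_pow[OF assms(1,3), of k] by simp
next
  case (nonpos k)
  have "x \<in> carrier G" using set_power_closed assms by blast
  then show ?thesis unfolding nonpos
    using set_power_inv[OF assms(1,2) set_power_pow[OF assms(1,3), of k]] by (simp add: int_pow_neg_int)
qed

lemma set_power_subset_set_power:
  assumes "B \<subseteq> carrier G" "C \<subseteq> set_power G B k"
  shows "set_power G C n \<subseteq> set_power G B (k * n)"
proof (induction n)
  case (Suc n)
  have "set_power G C (Suc n) \<subseteq> set_power G B (k * n) <#> set_power G B k"
    unfolding set_power.simps by (intro mono_set_mult Suc assms(2))
  moreover have "k * Suc n = k * n + k" by simp
  ultimately show ?case using set_power_add[OF assms(1), of "k * n" k] by (simp only:)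
qed simp

lemma set_power_covering:
  assumes "B \<subseteq> carrier G" "X \<subseteq> carrier G" "B <#> B \<subseteq> X <#> B"
  shows "set_power G B (Suc n) \<subseteq> set_power G X n <#> B"
proof (induction n)
  case 0
  then show ?case by simp
next
  case (Suc n)
  have "set_power G B (Suc (Suc n)) \<subseteq> (set_power G X n <#> B) <#> B"
    using mono_set_mult[OF Suc order_refl, of G B] by simp
  also have "\<dots> = set_power G X n <#> (B <#> B)"
    by (intro set_mult_assoc set_power_closed assms)
  also have "\<dots> \<subseteq> set_power G X n <#> (X <#> B)"
    by (intro mono_set_mult assms order_refl)
  also have "\<dots> = set_power G X (Suc n) <#> B"
    using set_mult_assoc[OF set_power_closed[OF assms(2)] assms(2) assms(1)] by simp
  finally show ?case .
qed

text \<open>Commutativity is what makes growth polynomial: a product of \<open>n\<close> factors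
  from \<open>X\<close> depends only on the multiplicities, and each of these is at most
  \<open>n\<close>.\<close>

lemma set_power_subset_monomials:
  assumes "X \<subseteq> carrier G" "bij_betw f {..<c} X" "x \<in> set_power G X n"
  shows "\<exists>l. (\<forall>i<c. l i \<in> {0..int n}) \<and> x = monomial G c f l"
  using assms(3)
proof (induction n arbitrary: x)
  case 0
  have "f \<in> {..<c} \<rightarrow> carrier G" using assms(1,2) by (auto simp: bij_betw_def)
  then show ?case using 0 monomial_zero[of f c] by (intro exI[of _ "\<lambda>_. 0"]) auto
next
  case (Suc n)
  have f: "f \<in> {..<c} \<rightarrow> carrier G" using assms(1,2) by (auto simp: bij_betw_def)
  obtain y z where yz: "y \<in> set_power G X n" "z \<in> X" "x = y \<otimes> z" using Suc.prems by (auto simp: set_mult_def)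
  obtain l where l: "\<forall>i<c. l i \<in> {0..int n}" "y = monomial G c f l" using Suc.IH[OF yz(1)] by blast
  obtain k where k: "k < c" "z = f k" using yz(2) assms(2) by (auto simp: bij_betw_def)
  have "x = monomial G c f (\<lambda>i. l i + (if i = k then 1 else 0))"
    using monomial_add[OF f, of l] monomial_single[OF f k(1), of 1] yz(3) l(2) k f
    by (simp add: int_pow_1 Pi_iff del: One_nat_def)
  then show ?case using l(1) by (intro exI[of _ "\<lambda>i. l i + (if i = k then 1 else 0)"]) auto
qed

lemma card_set_power_le:
  assumes "X \<subseteq> carrier G" "finite X"
  shows "card (set_power G X n) \<le> Suc n ^ card X"
proof -
  obtain f where f: "bij_betw f {..<card X} X" using ex_bij_betw_nat_finite[OF assms(2)] by (auto simp: atLeast0LessThan)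
  let ?B = "\<Pi>\<^sub>E i\<in>{..<card X}. {0..int n}"
  have fc: "f \<in> {..<card X} \<rightarrow> carrier G" using assms(1) f by (auto simp: bij_betw_def)
  have "set_power G X n \<subseteq> monomial G (card X) f ` ?B"
  proof
    fix x assume "x \<in> set_power G X n"
    then obtain l where l: "\<forall>i<card X. l i \<in> {0..int n}" "x = monomial G (card X) f l"
      using set_power_subset_monomials[OF assms(1) f] by blast
    have x: "x = monomial G (card X) f (restrict l {..<card X})"
      unfolding l(2) by (rule monomial_cong) (use fc in auto)
    show "x \<in> monomial G (card X) f ` ?B"
      by (subst x) (rule imageI, use l(1) in \<open>auto simp: PiE_iff extensional_def\<close>)
  qed
  then have "card (set_power G X n) \<le> card ?B"
    by (intro surj_card_le finite_PiE) auto
  also have "\<dots> = Suc n ^ card X" by (simp add: card_PiE nat_add_distrib)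
  finally show ?thesis .
qed

lemma card_set_mult_le:
  assumes "finite B" "finite C"
  shows "card (B <#> C) \<le> card B * card C"
proof -
  have "B <#> C = (\<lambda>(x, y). x \<otimes> y) ` (B \<times> C)" by (auto simp: set_mult_def)
  then show ?thesis using card_image_le[of "B \<times> C" "\<lambda>(x, y). x \<otimes> y"] assms by (simp add: card_cartesian_product)
qed

lemma polynomial_growth:
  assumes "B \<subseteq> carrier G" "finite B" "X \<subseteq> carrier G" "finite X" "B <#> B \<subseteq> X <#> B"
  shows "card (set_power G B (Suc n)) \<le> Suc n ^ card X * card B"
proof -
  have fin: "finite (set_power G X n <#> B)"
  proof -
    have "set_power G X n <#> B = (\<lambda>(x, y). x \<otimes> y) ` (set_power G X n \<times> B)" by (auto simp: set_mult_def)
    then show ?thesis using finite_set_power[OF assms(4)] assms(2) by simp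
  qed
  have "card (set_power G B (Suc n)) \<le> card (set_power G X n <#> B)"
    by (rule card_mono[OF fin set_power_covering[OF assms(1,3,5)]])
  also have "\<dots> \<le> card (set_power G X n) * card B"
    by (rule card_set_mult_le[OF finite_set_power[OF assms(4)] assms(2)])
  also have "\<dots> \<le> Suc n ^ card X * card B"
    by (intro mult_right_mono card_set_power_le assms) simp
  finally show ?thesis .
qed

end

section \<open>Fourier analysis of approximate groups\<close>

text \<open>The Cauchy-Schwarz inequality against the constant 1, obtained by expanding the squared
  deviations from the mean, scaled by \<open>card S\<close>.\<close>

lemma sum_power2_le_card:
  fixes f :: "'b \<Rightarrow> real"
  assumes "finite S"
  shows "(\<Sum>x\<in>S. f x)\<^sup>2 \<le> real (card S) * (\<Sum>x\<in>S. (f x)\<^sup>2)"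
proof (cases "S = {}")
  case False
  define n where "n = real (card S)"
  define t where "t = (\<Sum>x\<in>S. f x)"
  have n: "n > 0" using False assms by (simp add: n_def card_gt_0_iff)
  have "0 \<le> (\<Sum>x\<in>S. (n * f x - t)\<^sup>2)" by (simp add: sum_nonneg)
  also have "\<dots> = (\<Sum>x\<in>S. n\<^sup>2 * (f x)\<^sup>2 - 2 * n * t * f x + t\<^sup>2)"
    by (intro sum.cong refl) (simp add: power2_eq_square algebra_simps)
  also have "\<dots> = n\<^sup>2 * (\<Sum>x\<in>S. (f x)\<^sup>2) - 2 * n * t * (\<Sum>x\<in>S. f x) + n * t\<^sup>2"
    by (simp add: sum.distrib sum_subtractf sum_distrib_left n_def)
  also have "\<dots> = n * (n * (\<Sum>x\<in>S. (f x)\<^sup>2) - t\<^sup>2)"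
    by (simp add: t_def[symmetric] power2_eq_square algebra_simps)
  finally have "0 \<le> n * (\<Sum>x\<in>S. (f x)\<^sup>2) - t\<^sup>2" using n by (simp add: zero_le_mult_iff)
  then show ?thesis by (simp add: n_def t_def)
qed simp

text \<open>\<open>R\<close> stands for closeness and is not assumed transitive. Separation will
  bound the size of \<open>T\<close> by a packing argument, and maximality makes \<open>T\<close> a
  net.\<close>

lemma ex_maximal_separated_subset:
  assumes "finite S" and "\<And>x. x \<in> S \<Longrightarrow> R x x" and "\<And>x y. R x y \<Longrightarrow> R y x"
  shows "\<exists>T\<subseteq>S. (\<forall>x\<in>T. \<forall>y\<in>T. R x y \<longrightarrow> x = y) \<and> (\<forall>x\<in>S. \<exists>y\<in>T. R x y)"
  using assms(1,2)
proof (induction S)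
  case (insert a S)
  then obtain T where T: "T \<subseteq> S" "\<forall>x\<in>T. \<forall>y\<in>T. R x y \<longrightarrow> x = y" "\<forall>x\<in>S. \<exists>y\<in>T. R x y" by blast
  show ?case
  proof (cases "\<exists>y\<in>T. R a y")
    case True
    then show ?thesis using T by (intro exI[of _ T]) auto
  next
    case False
    then show ?thesis using T insert.prems[of a] assms(3)
      by (intro exI[of _ "insert a T"]) auto
  qed
qed simp

lemma exponential_beats_polynomial:
  assumes "e > (0::real)"
  shows "\<exists>j. (1 + 2 * real j) ^ r < (1 + e) ^ j"
proof (cases "r = 0")
  case True
  then show ?thesis using assms by (intro exI[of _ 1]) simp
next
  case False
  \<comment> \<open>With \<open>j = r * i\<close> the power \<open>r\<close> can be removed from
    both sides: it remains to beat the linear function \<open>1 + 2 * r * i\<close> by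
    \<open>(1 + e) ^ i\<close>.\<close>
  have "(\<lambda>n. real n / (1 + e) ^ n) \<longlonglongrightarrow> 0" using assms by (intro lim_n_over_pown) simp
  then have "eventually (\<lambda>n. real n / (1 + e) ^ n < 1 / (1 + 2 * real r)) sequentially"
    by (rule order_tendstoD(2)) simp
  then obtain N where N: "\<And>n. n \<ge> N \<Longrightarrow> real n / (1 + e) ^ n < 1 / (1 + 2 * real r)"
    unfolding eventually_sequentially by blast
  define i where "i = max N 1"
  have i: "i \<ge> N" "i \<ge> 1" by (simp_all add: i_def)
  have "1 + 2 * real (r * i) \<le> real i * (1 + 2 * real r)" using i by (simp add: algebra_simps)
  also have "\<dots> < (1 + e) ^ i" using N[OF i(1)] assms by (simp add: field_simps)
  finally have "(1 + 2 * real (r * i)) ^ r < ((1 + e) ^ i) ^ r"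
    using False by (intro power_strict_mono) auto
  then show ?thesis by (intro exI[of _ "r * i"]) (simp add: power_mult mult.commute)
qed

text \<open>If every step of length 2 up to \<open>N0\<close> multiplied \<open>f\<close> by more
  than \<open>1 + e\<close>, then \<open>f\<close> would outgrow degree \<open>r\<close>.
  \<open>N0\<close> depends only on \<open>e\<close> and \<open>r\<close>, which keeps later
  constants independent of the group. The step has length 2 because \<open>A^N\<close> will be
  multiplied by \<open>A <#> A\<close>.\<close>

lemma polynomial_growth_pigeonhole:
  assumes "e > (0::real)"
  shows "\<exists>N0. \<forall>f :: nat \<Rightarrow> real. 0 < f 1 \<longrightarrow> (\<forall>n. f (Suc n) \<le> real (Suc n) ^ r * f 1) \<longrightarrow>
    (\<exists>N\<le>N0. 1 \<le> N \<and> f (N + 2) \<le> (1 + e) * f N)"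
proof -
  obtain j where j: "(1 + 2 * real j) ^ r < (1 + e) ^ j" using exponential_beats_polynomial[OF assms] by blast
  have "\<exists>N\<le>2 * j + 1. 1 \<le> N \<and> f (N + 2) \<le> (1 + e) * f N"
    if f: "0 < f 1" "\<forall>n. f (Suc n) \<le> real (Suc n) ^ r * f 1" for f :: "nat \<Rightarrow> real"
  proof (rule ccontr)
    assume neg: "\<not> (\<exists>N\<le>2 * j + 1. 1 \<le> N \<and> f (N + 2) \<le> (1 + e) * f N)"
    have "(1 + e) ^ i * f 1 \<le> f (1 + 2 * i)" if "i \<le> j" for i
      using that
    proof (induction i)
      case (Suc i)
      then have "(1 + e) * ((1 + e) ^ i * f 1) \<le> (1 + e) * f (1 + 2 * i)"
        using assms by (intro mult_left_mono) auto
      moreover have "(1 + e) * f (1 + 2 * i) < f (1 + 2 * i + 2)"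
        using neg Suc.prems by (metis Suc_leD add.commute le_add1 mult_le_mono2 nat_add_left_cancel_le not_le)
      ultimately show ?case by simp
    qed simp
    from this[of j] have "(1 + e) ^ j * f 1 \<le> f (Suc (2 * j))" by simp
    also have "\<dots> \<le> real (Suc (2 * j)) ^ r * f 1" using f(2) by blast
    also have "\<dots> < (1 + e) ^ j * f 1" using j f(1) by (simp add: add.commute)
    finally show False by simp
  qed
  then show ?thesis by meson
qed

text \<open>A finite substitute for the dual of a possibly infinite group: a finite group of
  unimodular functions under pointwise multiplication, with conjugates as inverses. Norm 1 is
  required at every point of the type, so that pointwise products can be cancelled without reference
  to the carrier.\<close>

locale dual_family = comm_group G for G (structure) +
  fixes \<Xi> :: "('a \<Rightarrow> complex) set"
  assumes finite_dual: "finite \<Xi>" and dual_nonempty: "\<Xi> \<noteq> {}"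
    and char_mult: "\<chi> \<in> \<Xi> \<Longrightarrow> x \<in> carrier G \<Longrightarrow> y \<in> carrier G \<Longrightarrow> \<chi> (x \<otimes> y) = \<chi> x * \<chi> y"
    and norm_char: "\<chi> \<in> \<Xi> \<Longrightarrow> norm (\<chi> x) = 1"
    and dual_mult: "\<chi> \<in> \<Xi> \<Longrightarrow> \<psi> \<in> \<Xi> \<Longrightarrow> (\<lambda>x. \<chi> x * \<psi> x) \<in> \<Xi>"
    and dual_cnj: "\<chi> \<in> \<Xi> \<Longrightarrow> (\<lambda>x. cnj (\<chi> x)) \<in> \<Xi>"
begin

definition separates :: "'a set \<Rightarrow> bool" where
  "separates S \<longleftrightarrow> (\<forall>x\<in>S. \<forall>y\<in>S. (\<forall>\<chi>\<in>\<Xi>. \<chi> x = \<chi> y) \<longrightarrow> x = y)"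

definition ft :: "'a set \<Rightarrow> ('a \<Rightarrow> complex) \<Rightarrow> complex" where
  "ft B \<chi> = (\<Sum>b\<in>B. \<chi> b)"

lemma separates_subset: "separates S \<Longrightarrow> T \<subseteq> S \<Longrightarrow> separates T"
  unfolding separates_def by blast

lemma char_mult_cnj: "\<chi> \<in> \<Xi> \<Longrightarrow> \<chi> x * cnj (\<chi> x) = 1"
  using norm_char[of \<chi> x] by (simp add: complex_norm_square[symmetric])

lemma char_one: "\<chi> \<in> \<Xi> \<Longrightarrow> \<chi> \<one> = 1"
  using char_mult[of \<chi> \<one> \<one>] norm_char[of \<chi> \<one>] by auto

lemma char_inv: "\<chi> \<in> \<Xi> \<Longrightarrow> x \<in> carrier G \<Longrightarrow> \<chi> (inv x) = cnj (\<chi> x)"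
proof -
  assume \<chi>: "\<chi> \<in> \<Xi>" and x: "x \<in> carrier G"
  have "\<chi> x * \<chi> (inv x) = \<chi> x * cnj (\<chi> x)"
    using char_mult[OF \<chi> x, of "inv x"] x char_one[OF \<chi>] char_mult_cnj[OF \<chi>] by simp
  then show ?thesis using norm_char[OF \<chi>, of x] by auto
qed

lemma card_dual_pos: "card \<Xi> > 0"
  using finite_dual dual_nonempty by (simp add: card_gt_0_iff)

text \<open>Multiplication by \<open>\<chi>\<^sub>0\<close> permutes the family and multiplies the
  sum by \<open>\<chi>\<^sub>0 x * cnj (\<chi>\<^sub>0 y)\<close>, which is not 1.\<close>

lemma orthogonality:
  assumes "\<chi>\<^sub>0 \<in> \<Xi>" and "\<chi>\<^sub>0 x \<noteq> \<chi>\<^sub>0 y"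
  shows "(\<Sum>\<chi>\<in>\<Xi>. \<chi> x * cnj (\<chi> y)) = 0"
proof -
  let ?c = "\<chi>\<^sub>0 x * cnj (\<chi>\<^sub>0 y)"
  have u: "cnj (\<chi>\<^sub>0 z) * \<chi>\<^sub>0 z = 1" for z using char_mult_cnj[OF assms(1)] by (simp add: mult.commute)
  have "(\<Sum>\<chi>\<in>\<Xi>. \<chi> x * cnj (\<chi> y)) = (\<Sum>\<chi>\<in>\<Xi>. (\<chi>\<^sub>0 x * \<chi> x) * cnj (\<chi>\<^sub>0 y * \<chi> y))"
    by (rule sum.reindex_bij_witness[where i = "\<lambda>\<chi> z. \<chi>\<^sub>0 z * \<chi> z" and j = "\<lambda>\<chi> z. cnj (\<chi>\<^sub>0 z) * \<chi> z"])
      (use assms(1) dual_mult dual_cnj[OF assms(1)] in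
        \<open>auto simp: mult.assoc[symmetric] char_mult_cnj u\<close>)
  also have "\<dots> = ?c * (\<Sum>\<chi>\<in>\<Xi>. \<chi> x * cnj (\<chi> y))"
    by (simp add: sum_distrib_left algebra_simps)
  finally have "(?c - 1) * (\<Sum>\<chi>\<in>\<Xi>. \<chi> x * cnj (\<chi> y)) = 0" by (simp add: algebra_simps)
  moreover have "?c \<noteq> 1"
  proof
    assume "?c = 1"
    then have "?c * \<chi>\<^sub>0 y = \<chi>\<^sub>0 y" by simp
    then show False using assms(2) u[of y] by (simp add: mult.assoc)
  qed
  ultimately show ?thesis by simp
qed

text \<open>Orthogonality is available only for pairs that some character distinguishes, hence the
  restriction to functions living on a separated set.\<close>

lemma parseval:
  fixes f :: "'a \<Rightarrow> real"
  assumes "finite S" and "separates S"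
  shows "(\<Sum>\<chi>\<in>\<Xi>. (norm (\<Sum>y\<in>S. of_real (f y) * \<chi> y))\<^sup>2) = real (card \<Xi>) * (\<Sum>y\<in>S. (f y)\<^sup>2)"
proof -
  have sep: "(\<Sum>\<chi>\<in>\<Xi>. \<chi> y * cnj (\<chi> z)) = (if y = z then of_nat (card \<Xi>) else 0)"
    if "y \<in> S" "z \<in> S" for y z
  proof (cases "y = z")
    case False
    then obtain \<chi> where "\<chi> \<in> \<Xi>" "\<chi> y \<noteq> \<chi> z"
      using assms(2) \<open>y \<in> S\<close> \<open>z \<in> S\<close> unfolding separates_def by blast
    then show ?thesis using orthogonality False by simp
  qed (simp add: char_mult_cnj)
  have "complex_of_real (\<Sum>\<chi>\<in>\<Xi>. (norm (\<Sum>y\<in>S. of_real (f y) * \<chi> y))\<^sup>2)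
      = (\<Sum>\<chi>\<in>\<Xi>. (\<Sum>y\<in>S. of_real (f y) * \<chi> y) * cnj (\<Sum>y\<in>S. of_real (f y) * \<chi> y))"
    by (simp only: of_real_sum complex_norm_square)
  also have "\<dots> = (\<Sum>\<chi>\<in>\<Xi>. \<Sum>y\<in>S. \<Sum>z\<in>S. of_real (f y * f z) * (\<chi> y * cnj (\<chi> z)))"
    by (simp add: sum_product algebra_simps)
  also have "\<dots> = (\<Sum>y\<in>S. \<Sum>z\<in>S. of_real (f y * f z) * (\<Sum>\<chi>\<in>\<Xi>. \<chi> y * cnj (\<chi> z)))"
    by (simp only: sum.swap[of _ \<Xi>] sum_distrib_left)
  also have "\<dots> = (\<Sum>y\<in>S. \<Sum>z\<in>S. if y = z then of_real (f y * f z) * of_nat (card \<Xi>) else 0)"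
    by (intro sum.cong refl) (simp add: sep)
  also have "\<dots> = (\<Sum>y\<in>S. of_real (f y * f y) * of_nat (card \<Xi>))"
    using assms(1) by (simp add: sum.delta)
  also have "\<dots> = complex_of_real (real (card \<Xi>) * (\<Sum>y\<in>S. (f y)\<^sup>2))"
    by (simp add: sum_distrib_left power2_eq_square algebra_simps)
  finally show ?thesis by (simp only: of_real_eq_iff)
qed

lemma parseval_ft:
  assumes "finite S" and "separates S"
  shows "(\<Sum>\<chi>\<in>\<Xi>. (norm (ft S \<chi>))\<^sup>2) = real (card \<Xi>) * real (card S)"
  using parseval[OF assms, of "\<lambda>_. 1"] by (simp add: ft_def)

lemma norm_ft_le: "\<chi> \<in> \<Xi> \<Longrightarrow> norm (ft S \<chi>) \<le> real (card S)"
  unfolding ft_def using norm_sum[of \<chi> S] norm_char[of \<chi>] by simp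

text \<open>The numbers \<open>f y\<close> of representations of \<open>y\<close> as a product have
  total \<open>card B * card C\<close>. By Cauchy-Schwarz their squares have a large sum when the
  product set is small, and Parseval rewrites that sum, because the transform of \<open>f\<close> is
  \<open>ft B \<chi> * ft C \<chi>\<close>.\<close>

lemma energy_lower_bound:
  assumes "finite B" "finite C" "B \<subseteq> carrier G" "C \<subseteq> carrier G" and sep: "separates (B <#> C)"
  shows "real (card \<Xi>) * (real (card B) * real (card C))\<^sup>2
    \<le> real (card (B <#> C)) * (\<Sum>\<chi>\<in>\<Xi>. (norm (ft B \<chi>))\<^sup>2 * (norm (ft C \<chi>))\<^sup>2)"
proof -
  let ?S = "B <#> C" and ?m = "\<lambda>(b, c). b \<otimes> c"
  have S: "?S = ?m ` (B \<times> C)" by (auto simp: set_mult_def)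
  have fS: "finite ?S" unfolding S using assms by simp
  define f where "f y = real (card {p \<in> B \<times> C. ?m p = y})" for y
  have conv: "(\<Sum>y\<in>?S. of_real (f y) * g y) = (\<Sum>p\<in>B \<times> C. g (?m p))" for g :: "'a \<Rightarrow> complex"
  proof -
    have "(\<Sum>p\<in>B \<times> C. g (?m p)) = (\<Sum>y\<in>?S. \<Sum>p\<in>{p \<in> B \<times> C. ?m p = y}. g (?m p))"
      unfolding S using assms by (intro sum.image_gen) simp
    also have "\<dots> = (\<Sum>y\<in>?S. of_real (f y) * g y)"
      by (intro sum.cong refl) (simp add: f_def)
    finally show ?thesis by simp
  qed
  have prod: "(\<Sum>y\<in>?S. of_real (f y) * \<chi> y) = ft B \<chi> * ft C \<chi>" if "\<chi> \<in> \<Xi>" for \<chi>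
  proof -
    have "(\<Sum>p\<in>B \<times> C. \<chi> (?m p)) = (\<Sum>p\<in>B \<times> C. \<chi> (fst p) * \<chi> (snd p))"
      using assms(3,4) by (intro sum.cong refl) (auto intro!: char_mult[OF that])
    also have "\<dots> = ft B \<chi> * ft C \<chi>"
      unfolding ft_def sum_product sum.cartesian_product by (simp add: case_prod_unfold)
    finally show ?thesis by (simp add: conv)
  qed
  have "complex_of_real (\<Sum>y\<in>?S. f y) = of_real (real (card B) * real (card C))"
    using conv[of "\<lambda>_. 1"] assms by (simp add: card_cartesian_product)
  then have tot: "(\<Sum>y\<in>?S. f y) = real (card B) * real (card C)" by (simp only: of_real_eq_iff)
  have "(real (card B) * real (card C))\<^sup>2 \<le> real (card ?S) * (\<Sum>y\<in>?S. (f y)\<^sup>2)"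
    using sum_power2_le_card[OF fS, of f] by (simp add: tot)
  then have "real (card \<Xi>) * (real (card B) * real (card C))\<^sup>2
      \<le> real (card \<Xi>) * (real (card ?S) * (\<Sum>y\<in>?S. (f y)\<^sup>2))"
    by (rule mult_left_mono) simp
  also have "\<dots> = real (card ?S) * (\<Sum>\<chi>\<in>\<Xi>. (norm (\<Sum>y\<in>?S. of_real (f y) * \<chi> y))\<^sup>2)"
    by (simp add: parseval[OF fS sep])
  also have "(\<Sum>\<chi>\<in>\<Xi>. (norm (\<Sum>y\<in>?S. of_real (f y) * \<chi> y))\<^sup>2) = (\<Sum>\<chi>\<in>\<Xi>. (norm (ft B \<chi>))\<^sup>2 * (norm (ft C \<chi>))\<^sup>2)"
    by (intro sum.cong refl) (simp add: prod norm_mult power_mult_distrib)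
  finally show ?thesis .
qed

end

text \<open>The covering set \<open>X\<close> is a parameter because the rank bound maps its
  elements to integer vectors; \<open>r\<close> is a natural number, the integer part of
  \<open>K\<close> in the application.\<close>

locale approximate_subgroup = comm_group G for G (structure) +
  fixes A X :: "'a set" and r :: nat
  assumes A_carrier: "A \<subseteq> carrier G" and finite_A: "finite A" and one_A: "\<one> \<in> A"
    and inv_A: "\<forall>x\<in>A. inv x \<in> A"
    and X_carrier: "X \<subseteq> carrier G" and finite_X: "finite X" and card_X: "card X \<le> r"
    and AA: "A <#> A \<subseteq> X <#> A"
begin

lemma A_nonempty: "card A > 0"
  using finite_A one_A by (auto simp: card_gt_0_iff)

lemma r_pos: "r > 0"
proof -
  have "\<one> \<otimes> \<one> \<in> A <#> A" using one_A by (force simp: set_mult_def)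
  then have "X \<noteq> {}" using AA by (auto simp: set_mult_def)
  then show ?thesis using finite_X card_X by (metis card_gt_0_iff gr0I leD)
qed

lemma set_power_A_2: "set_power G A 2 = A <#> A"
  using set_power_1[OF A_carrier] by (simp add: numeral_2_eq_2)

lemma growth: "card (set_power G A (Suc n)) \<le> Suc n ^ r * card A"
proof -
  have "card (set_power G A (Suc n)) \<le> Suc n ^ card X * card A"
    by (rule polynomial_growth[OF A_carrier finite_A X_carrier finite_X AA])
  also have "\<dots> \<le> Suc n ^ r * card A" using card_X by (intro mult_right_mono power_increasing) auto
  finally show ?thesis .
qed

lemma card_AA: "card (A <#> A) \<le> r * card A"
proof -
  have "finite (X <#> A)"
  proof -
    have "X <#> A = (\<lambda>(x, y). x \<otimes> y) ` (X \<times> A)" by (auto simp: set_mult_def)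
    then show ?thesis using finite_X finite_A by simp
  qed
  then have "card (A <#> A) \<le> card (X <#> A)" by (rule card_mono[OF _ AA])
  also have "\<dots> \<le> card X * card A" by (rule card_set_mult_le[OF finite_X finite_A])
  also have "\<dots> \<le> r * card A" using card_X by simp
  finally show ?thesis .
qed

end

locale approximate_subgroup_dual = approximate_subgroup G A X r + dual_family G \<Xi>
  for G (structure) and A X r \<Xi>
begin

definition near_one :: "real \<Rightarrow> ('a \<Rightarrow> complex) set" where
  "near_one \<delta> = {\<chi> \<in> \<Xi>. \<forall>s\<in>A. norm (\<chi> s - 1) \<le> \<delta>}"

definition spectrum :: "real \<Rightarrow> ('a \<Rightarrow> complex) set" where
  "spectrum \<rho> = {\<chi> \<in> \<Xi>. \<rho> * real (card A) \<le> norm (ft A \<chi>)}"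

text \<open>A character with an almost maximal Fourier coefficient on \<open>A <#> A\<close> has small variance there; comparing
  \<open>a\<close> with \<open>s \<otimes> a\<close> for \<open>a \<in> A\<close> then bounds its distance from 1 at every single point \<open>s\<close> of \<open>A\<close>.\<close>

lemma char_near_one_of_large_coefficient:
  assumes \<chi>: "\<chi> \<in> \<Xi>" and s: "s \<in> A"
    and large: "(1 - 2 * e) * (real (card (A <#> A)))\<^sup>2 \<le> (norm (ft (A <#> A) \<chi>))\<^sup>2"
  shows "(norm (\<chi> s - 1))\<^sup>2 \<le> 8 * e * real r"
proof -
  let ?C = "A <#> A"
  have AC: "A \<subseteq> ?C"
    using set_power_mono[OF A_carrier one_A, of 1 2] set_power_1[OF A_carrier] set_power_A_2 by simp
  have finC: "finite ?C" using finite_set_power[OF finite_A, of 2] set_power_A_2 by simp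
  define n where "n = real (card ?C)"
  have n0: "n > 0" using AC finC A_nonempty one_A unfolding n_def by (auto simp: card_gt_0_iff)
  define c where "c = ft ?C \<chi> / of_real n"
  have ftc: "ft ?C \<chi> = of_real n * c" using n0 by (simp add: c_def)
  have deviation: "(norm (\<chi> x - c))\<^sup>2 = 1 + (norm c)\<^sup>2 - 2 * Re (\<chi> x * cnj c)" for x
  proof -
    have "(Re (\<chi> x))\<^sup>2 + (Im (\<chi> x))\<^sup>2 = 1" using norm_char[OF \<chi>, of x] by (simp add: cmod_power2[symmetric])
    then show ?thesis by (simp add: cmod_power2 power2_diff algebra_simps)
  qed
  have "(\<Sum>x\<in>?C. (norm (\<chi> x - c))\<^sup>2) = n * (1 + (norm c)\<^sup>2) - 2 * Re ((\<Sum>x\<in>?C. \<chi> x) * cnj c)"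
    unfolding deviation by (simp add: sum_subtractf n_def sum_distrib_left sum_distrib_right)
  also have "(\<Sum>x\<in>?C. \<chi> x) * cnj c = of_real (n * (norm c)\<^sup>2)"
    using ftc unfolding ft_def by (simp add: complex_norm_square mult.assoc del: of_real_power)
  finally have var: "(\<Sum>x\<in>?C. (norm (\<chi> x - c))\<^sup>2) = n * (1 - (norm c)\<^sup>2)"
    by (simp add: algebra_simps)
  have "(1 - 2 * e) * n\<^sup>2 \<le> n\<^sup>2 * (norm c)\<^sup>2"
    using large unfolding ftc n_def[symmetric] by (simp add: norm_mult power_mult_distrib)
  then have "n\<^sup>2 * (1 - (norm c)\<^sup>2) \<le> n\<^sup>2 * (2 * e)" by (simp add: algebra_simps)
  then have "1 - (norm c)\<^sup>2 \<le> 2 * e" using n0 by simp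
  then have V: "(\<Sum>x\<in>?C. (norm (\<chi> x - c))\<^sup>2) \<le> n * (2 * e)"
    unfolding var using n0 by (intro mult_left_mono) auto
  have V1: "(\<Sum>a\<in>A. (norm (\<chi> a - c))\<^sup>2) \<le> n * (2 * e)"
    using sum_mono2[OF finC AC, of "\<lambda>x. (norm (\<chi> x - c))\<^sup>2"] V by simp
  have sC: "s \<in> carrier G" using s A_carrier by blast
  have inj: "inj_on (\<lambda>a. s \<otimes> a) A" using A_carrier sC by (intro inj_onI) (metis Units_eq Units_l_cancel subsetD)
  have "(\<Sum>a\<in>A. (norm (\<chi> (s \<otimes> a) - c))\<^sup>2) = (\<Sum>x\<in>(\<lambda>a. s \<otimes> a) ` A. (norm (\<chi> x - c))\<^sup>2)"
    using inj by (simp add: sum.reindex)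
  also have "\<dots> \<le> (\<Sum>x\<in>?C. (norm (\<chi> x - c))\<^sup>2)"
    using s by (intro sum_mono2 finC) (auto simp: set_mult_def)
  finally have V2: "(\<Sum>a\<in>A. (norm (\<chi> (s \<otimes> a) - c))\<^sup>2) \<le> n * (2 * e)" using V by linarith
  have sq: "(norm (\<chi> s - 1))\<^sup>2 \<le> 2 * (norm (\<chi> (s \<otimes> a) - c))\<^sup>2 + 2 * (norm (\<chi> a - c))\<^sup>2"
    if a: "a \<in> A" for a
  proof -
    have "norm (\<chi> s - 1) = norm ((\<chi> s - 1) * \<chi> a)" using norm_char[OF \<chi>] by (simp add: norm_mult)
    also have "(\<chi> s - 1) * \<chi> a = (\<chi> (s \<otimes> a) - c) - (\<chi> a - c)"
      using char_mult[OF \<chi> sC, of a] a A_carrier by (auto simp: algebra_simps)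
    finally have le: "norm (\<chi> s - 1) \<le> norm (\<chi> (s \<otimes> a) - c) + norm (\<chi> a - c)"
      using norm_triangle_ineq4 by metis
    have "(norm (\<chi> s - 1))\<^sup>2 \<le> (norm (\<chi> (s \<otimes> a) - c) + norm (\<chi> a - c))\<^sup>2"
      using le by (intro power_mono) auto
    then show ?thesis
      using sum_squares_bound[of "norm (\<chi> (s \<otimes> a) - c)" "norm (\<chi> a - c)"] by (simp add: power2_sum)
  qed
  have "real (card A) * (norm (\<chi> s - 1))\<^sup>2 = (\<Sum>a\<in>A. (norm (\<chi> s - 1))\<^sup>2)" by simp
  also have "\<dots> \<le> (\<Sum>a\<in>A. 2 * (norm (\<chi> (s \<otimes> a) - c))\<^sup>2 + 2 * (norm (\<chi> a - c))\<^sup>2)"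
    by (intro sum_mono sq)
  \<comment> \<open>One factor 2 comes from squaring a sum, one from having two sums, and one from
    the bound \<open>n * (2 * e)\<close> on each.\<close>
  also have "\<dots> \<le> 8 * e * n"
    using V1 V2 by (simp add: sum.distrib sum_distrib_left[symmetric] algebra_simps)
  also have "\<dots> \<le> 8 * e * (real r * real (card A))"
  proof -
    have "0 \<le> (\<Sum>x\<in>?C. (norm (\<chi> x - c))\<^sup>2)" by (simp add: sum_nonneg)
    then have "0 \<le> e" using V n0 by (smt (verit) mult_le_0_iff zero_le_mult_iff)
    moreover have "n \<le> real r * real (card A)" using card_AA unfolding n_def of_nat_mult[symmetric] of_nat_le_iff .
    ultimately show ?thesis by (intro mult_left_mono) auto
  qed
  finally have "real (card A) * (norm (\<chi> s - 1))\<^sup>2 \<le> real (card A) * (8 * e * real r)"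
    by (simp add: algebra_simps)
  then show ?thesis using A_nonempty by simp
qed

text \<open>With respect to the weights \<open>(norm (ft B \<chi>))\<^sup>2\<close>, where \<open>B = set_power G A N\<close>, the energy of \<open>B\<close> and \<open>A <#> A\<close>
  forces the normalised coefficient of \<open>A <#> A\<close> to be close to 1 on average.\<close>

lemma card_near_one_ge:
  assumes sep: "separates (set_power G A (N + 2))" and "e > 0"
    and N: "real (card (set_power G A (N + 2))) \<le> (1 + e) * real (card (set_power G A N))"
    and \<delta>: "8 * e * real r \<le> \<delta>\<^sup>2" "\<delta> \<ge> 0"
  shows "real (card \<Xi>) \<le> 2 * real (card (set_power G A N)) * real (card (near_one \<delta>))"
proof -
  let ?B = "set_power G A N" and ?C = "A <#> A"
  define b where "b = real (card ?B)"
  define n where "n = real (card ?C)"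
  define q where "q = real (card \<Xi>)"
  have C2: "?C = set_power G A 2" by (simp add: set_power_A_2)
  have B: "finite ?B" "?B \<subseteq> carrier G" by (simp_all add: finite_set_power finite_A set_power_closed A_carrier)
  have C: "finite ?C" "?C \<subseteq> carrier G"
    unfolding C2 by (simp_all only: finite_set_power finite_A set_power_closed A_carrier)
  have BC: "?B <#> ?C = set_power G A (N + 2)" unfolding C2 by (rule set_power_add[OF A_carrier, symmetric])
  have "\<one> \<in> ?B" "\<one> \<in> ?C" unfolding C2 by (rule one_in_set_power[OF one_A A_carrier])+
  then have pos: "b > 0" "n > 0" "q > 0"
    using B C card_dual_pos unfolding b_def n_def q_def by (auto simp: card_gt_0_iff)
  have sepB: "separates ?B"
    by (rule separates_subset[OF sep]) (rule set_power_mono[OF A_carrier one_A], simp)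
  \<comment> \<open>The threshold gives up \<open>2 * e\<close> where the growth hypothesis gives up
    only a factor \<open>1 + e\<close>; this gap forces the characters in \<open>good\<close> to
    carry at least half of the total weight \<open>q * b\<close>.\<close>
  define good where "good = {\<chi> \<in> \<Xi>. (1 - 2 * e) * n\<^sup>2 \<le> (norm (ft ?C \<chi>))\<^sup>2}"
  have good_sub: "good \<subseteq> near_one \<delta>"
  proof
    fix \<chi> assume "\<chi> \<in> good"
    then have \<chi>: "\<chi> \<in> \<Xi>" "(1 - 2 * e) * (real (card ?C))\<^sup>2 \<le> (norm (ft ?C \<chi>))\<^sup>2"
      unfolding good_def n_def by auto
    have "norm (\<chi> s - 1) \<le> \<delta>" if "s \<in> A" for s
    proof -
      have "(norm (\<chi> s - 1))\<^sup>2 \<le> \<delta>\<^sup>2"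
        using char_near_one_of_large_coefficient[OF \<chi>(1) that \<chi>(2)] \<delta> by linarith
      then show ?thesis using \<delta>(2) by (rule power2_le_imp_le)
    qed
    then show "\<chi> \<in> near_one \<delta>" using \<chi>(1) by (simp add: near_one_def)
  qed
  define p where "p \<chi> = (norm (ft ?B \<chi>))\<^sup>2" for \<chi>
  have p0: "p \<chi> \<ge> 0" for \<chi> by (simp add: p_def)
  have psum: "(\<Sum>\<chi>\<in>\<Xi>. p \<chi>) = q * b"
    unfolding p_def q_def b_def by (rule parseval_ft[OF B(1) sepB])
  have gsub: "good \<subseteq> \<Xi>" by (auto simp: good_def)
  have fg: "finite good" using gsub finite_dual finite_subset by blast
  have "q * (b * n)\<^sup>2 \<le> real (card (?B <#> ?C)) * (\<Sum>\<chi>\<in>\<Xi>. p \<chi> * (norm (ft ?C \<chi>))\<^sup>2)"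
    unfolding q_def b_def n_def p_def
    by (rule energy_lower_bound[OF B(1) C(1) B(2) C(2)]) (simp only: BC sep)
  also have "\<dots> \<le> ((1 + e) * b) * (\<Sum>\<chi>\<in>\<Xi>. p \<chi> * (norm (ft ?C \<chi>))\<^sup>2)"
    unfolding BC b_def using N p0 by (intro mult_right_mono sum_nonneg) auto
  also have "(\<Sum>\<chi>\<in>\<Xi>. p \<chi> * (norm (ft ?C \<chi>))\<^sup>2)
      \<le> (\<Sum>\<chi>\<in>\<Xi>. n\<^sup>2 * ((1 - 2 * e) * p \<chi> + (if \<chi> \<in> good then 2 * e * p \<chi> else 0)))"
  proof (rule sum_mono)
    fix \<chi> assume \<chi>: "\<chi> \<in> \<Xi>"
    have "(norm (ft ?C \<chi>))\<^sup>2 \<le> n\<^sup>2" unfolding n_def using norm_ft_le[OF \<chi>] by (intro power_mono) auto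
    moreover have "\<chi> \<notin> good \<Longrightarrow> (norm (ft ?C \<chi>))\<^sup>2 \<le> (1 - 2 * e) * n\<^sup>2" using \<chi> by (simp add: good_def)
    ultimately have "(norm (ft ?C \<chi>))\<^sup>2 \<le> n\<^sup>2 * ((1 - 2 * e) + (if \<chi> \<in> good then 2 * e else 0))"
      by (simp add: mult.commute)
    from mult_left_mono[OF this p0[of \<chi>]]
    show "p \<chi> * (norm (ft ?C \<chi>))\<^sup>2 \<le> n\<^sup>2 * ((1 - 2 * e) * p \<chi> + (if \<chi> \<in> good then 2 * e * p \<chi> else 0))"
      by (cases "\<chi> \<in> good") (simp_all add: algebra_simps)
  qed
  also have "\<dots> = n\<^sup>2 * ((1 - 2 * e) * (q * b) + 2 * e * (\<Sum>\<chi>\<in>good. p \<chi>))"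
  proof -
    have "(\<Sum>\<chi>\<in>\<Xi>. if \<chi> \<in> good then 2 * e * p \<chi> else 0) = 2 * e * (\<Sum>\<chi>\<in>good. p \<chi>)"
      using gsub finite_dual by (simp add: sum.inter_restrict[symmetric] Int_absorb1 sum_distrib_left)
    then show ?thesis by (simp add: sum_distrib_left[symmetric] sum.distrib psum)
  qed
  finally have "q * (b * n)\<^sup>2 \<le> ((1 + e) * b) * (n\<^sup>2 * ((1 - 2 * e) * (q * b) + 2 * e * (\<Sum>\<chi>\<in>good. p \<chi>)))"
    using assms(2) pos by (simp add: mult_left_mono)
  then have "(b * n\<^sup>2) * (q * b) \<le> (b * n\<^sup>2) * ((1 + e) * ((1 - 2 * e) * (q * b) + 2 * e * (\<Sum>\<chi>\<in>good. p \<chi>)))"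
    by (simp add: power2_eq_square algebra_simps)
  then have "q * b \<le> (1 + e) * ((1 - 2 * e) * (q * b) + 2 * e * (\<Sum>\<chi>\<in>good. p \<chi>))"
    using pos by (simp add: mult_le_cancel_left_pos)
  then have "e * (q * b) * (1 + 2 * e) \<le> e * (2 * (1 + e) * (\<Sum>\<chi>\<in>good. p \<chi>))"
    by (simp add: algebra_simps power2_eq_square)
  then have "(q * b) * (1 + 2 * e) \<le> 2 * (1 + e) * (\<Sum>\<chi>\<in>good. p \<chi>)"
    using assms(2) by (simp add: mult.assoc mult_le_cancel_left_pos)
  moreover have "(1 + e) * (q * b) \<le> (q * b) * (1 + 2 * e)"
    using pos assms(2) by (simp add: algebra_simps)
  ultimately have "(1 + e) * (q * b) \<le> (1 + e) * (2 * (\<Sum>\<chi>\<in>good. p \<chi>))" by linarith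
  then have "q * b \<le> 2 * (\<Sum>\<chi>\<in>good. p \<chi>)" using assms(2) by (simp add: mult_le_cancel_left_pos)
  \<comment> \<open>No single weight exceeds \<open>b\<^sup>2\<close>, so carrying half of the total
    takes many characters.\<close>
  also have "(\<Sum>\<chi>\<in>good. p \<chi>) \<le> (\<Sum>\<chi>\<in>good. b\<^sup>2)"
    unfolding p_def b_def using norm_ft_le gsub by (intro sum_mono power_mono) auto
  finally have "b * q \<le> b * (2 * b * real (card good))" by (simp add: power2_eq_square algebra_simps)
  then have "q \<le> 2 * b * real (card good)" using pos by (simp add: mult_le_cancel_left_pos)
  also have "\<dots> \<le> 2 * b * real (card (near_one \<delta>))"
  proof -
    have "near_one \<delta> \<subseteq> \<Xi>" by (auto simp: near_one_def)
    then have "card good \<le> card (near_one \<delta>)"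
      using good_sub finite_dual by (intro card_mono) (auto intro: finite_subset)
    then show ?thesis using pos by (intro mult_left_mono) auto
  qed
  finally show ?thesis unfolding q_def b_def .
qed

section \<open>The large spectrum\<close>

lemma finite_spectrum: "finite (spectrum \<rho>)"
  by (rule finite_subset[OF _ finite_dual]) (auto simp: spectrum_def)

text \<open>Chebyshev's inequality for the Fourier coefficients of \<open>A\<close>, whose square
  sum is known from Parseval.\<close>

lemma card_spectrum_le:
  assumes "separates A" "\<rho> > 0"
  shows "real (card (spectrum \<rho>)) * \<rho>\<^sup>2 * real (card A) \<le> real (card \<Xi>)"
proof -
  define n where "n = real (card A)"
  have n: "n > 0" using A_nonempty by (simp add: n_def)
  have "real (card (spectrum \<rho>)) * (\<rho> * n)\<^sup>2 = (\<Sum>\<chi>\<in>spectrum \<rho>. (\<rho> * n)\<^sup>2)" by simp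
  also have "\<dots> \<le> (\<Sum>\<chi>\<in>spectrum \<rho>. (norm (ft A \<chi>))\<^sup>2)"
    using assms(2) n by (intro sum_mono power_mono) (auto simp: spectrum_def n_def)
  also have "\<dots> \<le> (\<Sum>\<chi>\<in>\<Xi>. (norm (ft A \<chi>))\<^sup>2)"
    by (intro sum_mono2 finite_dual) (auto simp: spectrum_def)
  also have "\<dots> = real (card \<Xi>) * n" unfolding n_def by (rule parseval_ft[OF finite_A assms(1)])
  finally have "n * (real (card (spectrum \<rho>)) * \<rho>\<^sup>2 * n) \<le> n * real (card \<Xi>)"
    by (simp add: power2_eq_square algebra_simps)
  then show ?thesis unfolding n_def[symmetric] using n by (simp add: mult_le_cancel_left_pos)
qed

text \<open>The factor \<open>\<eta>\<close> moves each value of the character by at most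
  \<open>\<delta>\<close> on \<open>A\<close>, hence the coefficient by at most
  \<open>\<delta> * card A\<close>, which is no more than half of the threshold.\<close>

lemma spectrum_mult_near_one:
  assumes "\<chi> \<in> spectrum \<rho>" "\<eta> \<in> near_one \<delta>" "\<delta> \<le> \<rho> / 2"
  shows "(\<lambda>x. \<chi> x * \<eta> x) \<in> spectrum (\<rho> / 2)"
proof -
  have \<chi>: "\<chi> \<in> \<Xi>" and \<eta>: "\<eta> \<in> \<Xi>" using assms by (auto simp: spectrum_def near_one_def)
  have "norm (ft A (\<lambda>x. \<chi> x * \<eta> x) - ft A \<chi>) = norm (\<Sum>a\<in>A. \<chi> a * (\<eta> a - 1))"
    by (simp add: ft_def sum_subtractf algebra_simps)
  also have "\<dots> \<le> (\<Sum>a\<in>A. \<delta>)"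
    using assms(2) norm_char[OF \<chi>] by (intro sum_norm_le) (auto simp: norm_mult near_one_def)
  also have "\<dots> \<le> \<rho> / 2 * real (card A)" using mult_right_mono[OF assms(3), of "real (card A)"] by (simp add: mult.commute)
  finally have "norm (ft A \<chi>) - norm (ft A (\<lambda>x. \<chi> x * \<eta> x)) \<le> \<rho> / 2 * real (card A)"
    using norm_triangle_ineq3[of "ft A \<chi>" "ft A (\<lambda>x. \<chi> x * \<eta> x)"] by (simp add: norm_minus_commute)
  moreover have "\<rho> * real (card A) \<le> norm (ft A \<chi>)" using assms(1) by (simp add: spectrum_def)
  ultimately have "\<rho> / 2 * real (card A) \<le> norm (ft A (\<lambda>x. \<chi> x * \<eta> x))" by linarith
  then show ?thesis using dual_mult[OF \<chi> \<eta>] by (simp add: spectrum_def)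
qed

text \<open>Translates of \<open>near_one \<delta>\<close> by \<open>2 \<delta>\<close>-separated points of the spectrum are disjoint and lie in a slightly larger
  spectrum, whose size Parseval controls.\<close>

lemma spectrum_covering:
  assumes sep: "separates A" and \<rho>: "\<rho> > 0" "\<delta> \<le> \<rho> / 2"
    and M: "real (card \<Xi>) \<le> M * real (card A) * real (card (near_one \<delta>))"
  shows "\<exists>S\<subseteq>spectrum \<rho>. real (card S) \<le> 4 * M / \<rho>\<^sup>2 \<and>
    (\<forall>\<chi>\<in>spectrum \<rho>. \<exists>\<psi>\<in>S. \<forall>s\<in>A. norm (\<chi> s - \<psi> s) \<le> 2 * \<delta>)"
proof -
  let ?R = "\<lambda>\<chi> \<psi>. \<chi> = \<psi> \<or> (\<forall>s\<in>A. norm (\<chi> s - \<psi> s) \<le> 2 * \<delta>)"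
  have "\<exists>S\<subseteq>spectrum \<rho>. (\<forall>\<chi>\<in>S. \<forall>\<psi>\<in>S. ?R \<chi> \<psi> \<longrightarrow> \<chi> = \<psi>) \<and> (\<forall>\<chi>\<in>spectrum \<rho>. \<exists>\<psi>\<in>S. ?R \<chi> \<psi>)"
    by (rule ex_maximal_separated_subset[OF finite_spectrum]) (auto simp: norm_minus_commute)
  then obtain S where S: "S \<subseteq> spectrum \<rho>" "\<forall>\<chi>\<in>S. \<forall>\<psi>\<in>S. ?R \<chi> \<psi> \<longrightarrow> \<chi> = \<psi>"
    "\<forall>\<chi>\<in>spectrum \<rho>. \<exists>\<psi>\<in>S. ?R \<chi> \<psi>" by blast
  have near_pos: "real (card (near_one \<delta>)) > 0"
  proof (rule ccontr)
    assume "\<not> real (card (near_one \<delta>)) > 0"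
    then show False using M card_dual_pos by simp
  qed
  then obtain \<eta>\<^sub>0 where "\<eta>\<^sub>0 \<in> near_one \<delta>" by (metis card.empty equals0I less_irrefl of_nat_0)
  then have \<delta>0: "\<delta> \<ge> 0" using one_A norm_ge_zero order_trans unfolding near_one_def by blast
  have SX: "S \<subseteq> \<Xi>" using S(1) by (auto simp: spectrum_def)
  let ?m = "\<lambda>(\<chi>, \<eta>) x. \<chi> x * \<eta> x :: complex"
  have inj: "inj_on ?m (S \<times> near_one \<delta>)"
  proof (rule inj_onI, clarify)
    fix \<chi> \<eta> \<chi>' \<eta>' assume a: "\<chi> \<in> S" "\<eta> \<in> near_one \<delta>" "\<chi>' \<in> S" "\<eta>' \<in> near_one \<delta>"
      and eq: "(\<lambda>x. \<chi> x * \<eta> x) = (\<lambda>x. \<chi>' x * \<eta>' x)"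
    have X: "\<chi> \<in> \<Xi>" "\<chi>' \<in> \<Xi>" using a SX by auto
    have "norm (\<chi> s - \<chi>' s) \<le> 2 * \<delta>" if "s \<in> A" for s
    proof -
      have "\<chi> s - \<chi>' s = \<chi>' s * (\<eta>' s - 1) - \<chi> s * (\<eta> s - 1)"
        using fun_cong[OF eq, of s] by (simp add: algebra_simps)
      then have "norm (\<chi> s - \<chi>' s) \<le> norm (\<chi>' s * (\<eta>' s - 1)) + norm (\<chi> s * (\<eta> s - 1))"
        by (simp only: norm_triangle_ineq4)
      also have "\<dots> \<le> \<delta> + \<delta>"
        using a(2,4) that X by (intro add_mono) (auto simp: norm_mult norm_char near_one_def)
      finally show ?thesis by simp
    qed
    then have "\<chi> = \<chi>'" using S(2) a(1,3) by blast
    moreover have "\<eta> x = \<eta>' x" for x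
      using fun_cong[OF eq, of x] norm_char[OF X(1), of x] \<open>\<chi> = \<chi>'\<close> by auto
    ultimately show "\<chi> = \<chi>' \<and> \<eta> = \<eta>'" by blast
  qed
  have "card S * card (near_one \<delta>) = card (?m ` (S \<times> near_one \<delta>))"
    using card_image[OF inj] by (simp add: card_cartesian_product)
  also have "\<dots> \<le> card (spectrum (\<rho> / 2))"
    using spectrum_mult_near_one[OF _ _ \<rho>(2)] S(1) by (intro card_mono finite_spectrum) auto
  finally have "real (card S) * real (card (near_one \<delta>)) \<le> real (card (spectrum (\<rho> / 2)))"
    unfolding of_nat_mult[symmetric] of_nat_le_iff .
  then have "(real (card S) * real (card (near_one \<delta>))) * ((\<rho> / 2)\<^sup>2 * real (card A))
      \<le> real (card (spectrum (\<rho> / 2))) * ((\<rho> / 2)\<^sup>2 * real (card A))"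
    by (rule mult_right_mono) simp
  also have "\<dots> \<le> M * real (card A) * real (card (near_one \<delta>))"
    using card_spectrum_le[OF sep, of "\<rho> / 2"] \<rho>(1) M by (simp add: mult.assoc)
  finally have "(real (card A) * real (card (near_one \<delta>))) * (real (card S) * (\<rho> / 2)\<^sup>2)
      \<le> (real (card A) * real (card (near_one \<delta>))) * M" by (simp add: algebra_simps)
  then have "real (card S) * (\<rho> / 2)\<^sup>2 \<le> M"
    using near_pos A_nonempty by (simp add: mult_le_cancel_left_pos)
  then have "real (card S) \<le> 4 * M / \<rho>\<^sup>2" using \<rho>(1) by (simp add: field_simps power2_eq_square)
  moreover have "\<forall>\<chi>\<in>spectrum \<rho>. \<exists>\<psi>\<in>S. \<forall>s\<in>A. norm (\<chi> s - \<psi> s) \<le> 2 * \<delta>"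
  proof
    fix \<chi> assume "\<chi> \<in> spectrum \<rho>"
    then obtain \<psi> where "\<psi> \<in> S" "?R \<chi> \<psi>" using S(3) by blast
    then show "\<exists>\<psi>\<in>S. \<forall>s\<in>A. norm (\<chi> s - \<psi> s) \<le> 2 * \<delta>"
      using \<delta>0 by (intro bexI[of _ \<psi>]) auto
  qed
  ultimately show ?thesis using S(1) by blast
qed

text \<open>Symmetry of \<open>A\<close> makes the coefficient real. Its fourth power is therefore a
  nonnegative weight, and in \<open>bogolyubov\<close> only the factor \<open>Re (\<chi> x)\<close>
  can have a sign.\<close>

lemma ft_A_real:
  assumes "\<chi> \<in> \<Xi>"
  shows "ft A \<chi> ^ 4 = of_real ((norm (ft A \<chi>))\<^sup>2 * (norm (ft A \<chi>))\<^sup>2)"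
proof -
  have "cnj (ft A \<chi>) = (\<Sum>a\<in>A. \<chi> (inv a))"
    unfolding ft_def cnj_sum using A_carrier by (intro sum.cong refl) (auto simp: char_inv[OF assms])
  also have "\<dots> = ft A \<chi>" unfolding ft_def
    by (rule sum.reindex_bij_witness[where i = "\<lambda>a. inv a" and j = "\<lambda>a. inv a"])
      (use inv_A A_carrier in auto)
  finally have c: "cnj (ft A \<chi>) = ft A \<chi>" .
  have "complex_of_real ((norm (ft A \<chi>))\<^sup>2) = ft A \<chi> ^ 2"
    unfolding complex_norm_square c by (simp add: power2_eq_square)
  then show ?thesis by (simp only: of_real_mult) (simp add: power2_eq_square eval_nat_numeral algebra_simps)
qed

lemma ft_A_pow4:
  assumes "\<chi> \<in> \<Xi>"
  shows "ft A \<chi> ^ 4 = (\<Sum>(p, q)\<in>(A \<times> A) \<times> (A \<times> A). \<chi> ((fst p \<otimes> snd p) \<otimes> (fst q \<otimes> snd q)))"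
proof -
  have sq: "ft A \<chi> * ft A \<chi> = (\<Sum>p\<in>A \<times> A. \<chi> (fst p \<otimes> snd p))"
    unfolding ft_def sum_product sum.cartesian_product
    using A_carrier by (intro sum.cong refl) (auto intro!: char_mult[OF assms, symmetric])
  have "ft A \<chi> ^ 4 = (ft A \<chi> * ft A \<chi>) * (ft A \<chi> * ft A \<chi>)" by (simp add: eval_nat_numeral algebra_simps)
  also have "\<dots> = (\<Sum>(p, q)\<in>(A \<times> A) \<times> (A \<times> A). \<chi> (fst p \<otimes> snd p) * \<chi> (fst q \<otimes> snd q))"
    unfolding sq sum_product sum.cartesian_product by simp
  also have "\<dots> = (\<Sum>(p, q)\<in>(A \<times> A) \<times> (A \<times> A). \<chi> ((fst p \<otimes> snd p) \<otimes> (fst q \<otimes> snd q)))"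
    using A_carrier by (intro sum.cong refl) (auto intro!: char_mult[OF assms, symmetric] m_closed)
  finally show ?thesis .
qed

text \<open>If \<open>x\<close> were not in \<open>set_power G A 4\<close>, then the sum of \<open>ft A \<chi> ^ 4 * cnj (\<chi> x)\<close> would vanish, although
  the spectrum carries most of the fourth moment.\<close>

lemma bogolyubov:
  assumes sep: "separates (insert x (set_power G A 4))" and x: "x \<in> carrier G"
    and \<rho>: "\<rho> > 0" "4 * real r * \<rho>\<^sup>2 \<le> 1"
    and near: "\<And>\<chi>. \<chi> \<in> spectrum \<rho> \<Longrightarrow> 1 / 2 \<le> Re (\<chi> x)"
  shows "x \<in> set_power G A 4"
proof (rule ccontr)
  assume nx: "x \<notin> set_power G A 4"
  define t where "t \<chi> = (norm (ft A \<chi>))\<^sup>2 * (norm (ft A \<chi>))\<^sup>2" for \<chi>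
  define n where "n = real (card A)"
  define q where "q = real (card \<Xi>)"
  have pos: "n > 0" "q > 0" "r > 0" using A_nonempty card_dual_pos r_pos by (simp_all add: n_def q_def)
  have t0: "t \<chi> \<ge> 0" for \<chi> by (simp add: t_def)
  have A4: "(a \<otimes> b) \<otimes> (c \<otimes> d) \<in> set_power G A 4" if "a \<in> A" "b \<in> A" "c \<in> A" "d \<in> A" for a b c d
  proof -
    have "u \<otimes> v \<in> set_power G A 2" if "u \<in> A" "v \<in> A" for u v
      using that unfolding set_power_A_2 by (auto simp: set_mult_def)
    then have "(a \<otimes> b) \<otimes> (c \<otimes> d) \<in> set_power G A (2 + 2)"
      using that by (intro set_power_memI[OF A_carrier]) auto
    then show ?thesis by simp
  qed
  have "(\<Sum>\<chi>\<in>\<Xi>. ft A \<chi> ^ 4 * cnj (\<chi> x))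
      = (\<Sum>\<chi>\<in>\<Xi>. \<Sum>(p, q)\<in>(A \<times> A) \<times> (A \<times> A). \<chi> ((fst p \<otimes> snd p) \<otimes> (fst q \<otimes> snd q)) * cnj (\<chi> x))"
    by (intro sum.cong refl) (simp add: ft_A_pow4 sum_distrib_right case_prod_unfold)
  also have "\<dots> = (\<Sum>(p, q)\<in>(A \<times> A) \<times> (A \<times> A). \<Sum>\<chi>\<in>\<Xi>. \<chi> ((fst p \<otimes> snd p) \<otimes> (fst q \<otimes> snd q)) * cnj (\<chi> x))"
    unfolding case_prod_unfold by (rule sum.swap)
  also have "\<dots> = 0"
  proof (rule sum.neutral, clarify)
    fix a b c d assume "a \<in> A" "b \<in> A" "c \<in> A" "d \<in> A"
    then have m: "(a \<otimes> b) \<otimes> (c \<otimes> d) \<in> set_power G A 4" by (rule A4)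
    then have "(a \<otimes> b) \<otimes> (c \<otimes> d) \<noteq> x" using nx by auto
    then obtain \<chi> where "\<chi> \<in> \<Xi>" "\<chi> ((a \<otimes> b) \<otimes> (c \<otimes> d)) \<noteq> \<chi> x"
      using sep m unfolding separates_def by blast
    then show "(\<Sum>\<chi>\<in>\<Xi>. \<chi> ((fst (a, b) \<otimes> snd (a, b)) \<otimes> (fst (c, d) \<otimes> snd (c, d))) * cnj (\<chi> x)) = 0"
      using orthogonality by simp
  qed
  finally have "Re (\<Sum>\<chi>\<in>\<Xi>. ft A \<chi> ^ 4 * cnj (\<chi> x)) = 0" by simp
  moreover have "Re (\<Sum>\<chi>\<in>\<Xi>. ft A \<chi> ^ 4 * cnj (\<chi> x)) = (\<Sum>\<chi>\<in>\<Xi>. t \<chi> * Re (\<chi> x))"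
    unfolding Re_sum by (intro sum.cong refl) (simp only: ft_A_real t_def[symmetric], simp)
  ultimately have zero: "(\<Sum>\<chi>\<in>\<Xi>. t \<chi> * Re (\<chi> x)) = 0" by simp
  \<comment> \<open>On the spectrum at least half of \<open>t \<chi>\<close> survives. Off it the
    term may be as low as \<open>- t \<chi>\<close>, but there \<open>t \<chi>\<close> is at most
    \<open>(\<rho> * n)\<^sup>2\<close> times a quantity that Parseval sums; 3/2 is 1/2 + 1.\<close>
  have tail: "t \<chi> / 2 - 3 / 2 * ((\<rho> * n)\<^sup>2 * (norm (ft A \<chi>))\<^sup>2) \<le> t \<chi> * Re (\<chi> x)" if \<chi>: "\<chi> \<in> \<Xi>" for \<chi>
  proof (cases "\<chi> \<in> spectrum \<rho>")
    case True
    then have "t \<chi> * (1 / 2) \<le> t \<chi> * Re (\<chi> x)" using near t0 by (intro mult_left_mono) auto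
    moreover have "0 \<le> 3 / 2 * ((\<rho> * n)\<^sup>2 * (norm (ft A \<chi>))\<^sup>2)" by simp
    ultimately show ?thesis by linarith
  next
    case False
    then have "norm (ft A \<chi>) \<le> \<rho> * n" using \<chi> by (simp add: spectrum_def n_def)
    then have "(norm (ft A \<chi>))\<^sup>2 \<le> (\<rho> * n)\<^sup>2" by (intro power_mono) auto
    then have "t \<chi> \<le> (\<rho> * n)\<^sup>2 * (norm (ft A \<chi>))\<^sup>2" unfolding t_def by (intro mult_right_mono) auto
    moreover have "- 1 \<le> Re (\<chi> x)" using abs_Re_le_cmod[of "\<chi> x"] norm_char[OF \<chi>, of x] by linarith
    then have "t \<chi> * (- 1) \<le> t \<chi> * Re (\<chi> x)" using t0 by (intro mult_left_mono) auto
    ultimately show ?thesis by linarith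
  qed
  have sepA: "separates A"
    by (rule separates_subset[OF sep])
      (use set_power_mono[OF A_carrier one_A, of 1 4] set_power_1[OF A_carrier] in auto)
  have sepAA: "separates (A <#> A)" unfolding set_power_A_2[symmetric]
    by (rule separates_subset[OF sep]) (use set_power_mono[OF A_carrier one_A, of 2 4] in auto)
  have "(\<Sum>\<chi>\<in>\<Xi>. t \<chi> / 2 - 3 / 2 * ((\<rho> * n)\<^sup>2 * (norm (ft A \<chi>))\<^sup>2)) \<le> (\<Sum>\<chi>\<in>\<Xi>. t \<chi> * Re (\<chi> x))"
    by (intro sum_mono tail)
  also have "(\<Sum>\<chi>\<in>\<Xi>. t \<chi> / 2 - 3 / 2 * ((\<rho> * n)\<^sup>2 * (norm (ft A \<chi>))\<^sup>2))
      = (\<Sum>\<chi>\<in>\<Xi>. t \<chi>) / 2 - 3 / 2 * ((\<rho> * n)\<^sup>2 * (q * n))"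
    unfolding q_def n_def parseval_ft[OF finite_A sepA, symmetric]
    by (simp add: sum_subtractf sum_divide_distrib sum_distrib_left)
  finally have upper: "(\<Sum>\<chi>\<in>\<Xi>. t \<chi>) \<le> 3 * \<rho>\<^sup>2 * (q * n * n * n)"
    using zero by (simp add: power2_eq_square algebra_simps)
  \<comment> \<open>Small doubling bounds the fourth moment from below by
    \<open>q * n ^ 3 / r\<close>. With the upper bound this forces
    \<open>1 \<le> 3 * r * \<rho>\<^sup>2\<close>, against
    \<open>4 * r * \<rho>\<^sup>2 \<le> 1\<close>.\<close>
  have "q * (n * n)\<^sup>2 \<le> real (card (A <#> A)) * (\<Sum>\<chi>\<in>\<Xi>. t \<chi>)"
    unfolding q_def n_def t_def
    by (rule energy_lower_bound[OF finite_A finite_A A_carrier A_carrier sepAA])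
  also have "\<dots> \<le> (real r * n) * (\<Sum>\<chi>\<in>\<Xi>. t \<chi>)"
  proof (rule mult_right_mono)
    show "real (card (A <#> A)) \<le> real r * n" using card_AA unfolding n_def of_nat_mult[symmetric] of_nat_le_iff .
  qed (simp add: sum_nonneg t0)
  also have "\<dots> \<le> (real r * n) * (3 * \<rho>\<^sup>2 * (q * n * n * n))"
    using upper pos by (intro mult_left_mono) auto
  finally have "(q * n * n * n * n) * 1 \<le> (q * n * n * n * n) * (3 * (real r * \<rho>\<^sup>2))"
    by (simp add: power2_eq_square algebra_simps)
  then have "1 \<le> 3 * (real r * \<rho>\<^sup>2)" using pos by (simp add: mult_le_cancel_left_pos)
  moreover have "0 < real r * \<rho>\<^sup>2" using pos \<rho> by simp
  ultimately show False using \<rho>(2) by linarith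
qed

text \<open>Closeness on \<open>A\<close> telescopes along a product with a linear loss; this
  decides how small \<open>\<delta>\<close> must be relative to \<open>m\<close>.\<close>

lemma char_close_on_set_power:
  assumes "\<chi> \<in> \<Xi>" "\<psi> \<in> \<Xi>" "\<forall>s\<in>A. norm (\<chi> s - \<psi> s) \<le> d" "x \<in> set_power G A m"
  shows "norm (\<chi> x - \<psi> x) \<le> real m * d"
  using assms(4)
proof (induction m arbitrary: x)
  case 0
  then show ?case using char_one[OF assms(1)] char_one[OF assms(2)] by simp
next
  case (Suc m)
  then obtain y s where ys: "y \<in> set_power G A m" "s \<in> A" "x = y \<otimes> s" by (auto simp: set_mult_def)
  have c: "y \<in> carrier G" "s \<in> carrier G" using ys A_carrier set_power_closed[OF A_carrier] by auto
  have "\<chi> x - \<psi> x = (\<chi> y - \<psi> y) * \<chi> s + \<psi> y * (\<chi> s - \<psi> s)"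
    using c assms(1,2) ys(3) by (simp add: char_mult algebra_simps)
  then have "norm (\<chi> x - \<psi> x) \<le> norm ((\<chi> y - \<psi> y) * \<chi> s) + norm (\<psi> y * (\<chi> s - \<psi> s))"
    by (simp only: norm_triangle_ineq)
  also have "\<dots> \<le> real m * d + d"
    using Suc.IH[OF ys(1)] assms ys(2) by (intro add_mono) (simp_all add: norm_mult norm_char)
  finally show ?case by (simp add: algebra_simps)
qed

end

section \<open>Bohr neighbourhoods\<close>

definition unit_character :: "('a, 'b) monoid_scheme \<Rightarrow> ('a \<Rightarrow> complex) \<Rightarrow> bool" where
  "unit_character G \<chi> \<longleftrightarrow> (\<forall>x\<in>carrier G. \<forall>y\<in>carrier G. \<chi> (x \<otimes>\<^bsub>G\<^esub> y) = \<chi> x * \<chi> y) \<and> (\<forall>x. norm (\<chi> x) = 1)"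

section \<open>Arguments of unimodular numbers\<close>

lemma norm_cis_minus_1_le: "norm (cis t - 1) \<le> \<bar>t\<bar>"
proof -
  have "(norm (cis t - 1))\<^sup>2 = (cos t - 1)\<^sup>2 + (sin t)\<^sup>2" by (simp add: cmod_power2)
  also have "\<dots> = 2 - 2 * cos t"
    using sin_cos_squared_add[of t] by (simp add: power2_eq_square algebra_simps)
  also have "cos t = 1 - 2 * (sin (t / 2))\<^sup>2" using cos_double_sin[of "t / 2"] by simp
  also have "2 - 2 * (1 - 2 * (sin (t / 2))\<^sup>2) = (2 * \<bar>sin (t / 2)\<bar>)\<^sup>2" by (simp add: power_mult_distrib)
  also have "\<dots> \<le> \<bar>t\<bar>\<^sup>2"
  proof (rule power_mono)
    show "2 * \<bar>sin (t / 2)\<bar> \<le> \<bar>t\<bar>" using abs_sin_x_le_abs_x[of "t / 2"] by simp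
  qed simp
  finally show ?thesis by (rule power2_le_imp_le) simp
qed

lemma unit_eq_cis_Arg: "norm z = 1 \<Longrightarrow> z = cis (Arg z)"
  by (metis cis_Arg norm_zero sgn_div_norm inverse_1 scaleR_one zero_neq_one)

lemma Arg_mult_cnj:
  assumes "norm z = 1" "norm w = 1" "\<bar>Arg z - Arg w\<bar> < pi"
  shows "Arg (z * cnj w) = Arg z - Arg w"
proof (rule cis_Arg_unique)
  have "z * cnj w = cis (Arg z - Arg w)"
    using unit_eq_cis_Arg[OF assms(1)] unit_eq_cis_Arg[OF assms(2)]
    by (metis cis_cnj cis_mult diff_conv_add_uminus)
  then show "sgn (z * cnj w) = cis (Arg z - Arg w)" by (simp add: sgn_div_norm)
qed (use assms(3) in linarith)+

context comm_group
begin

lemma unit_character_mult_inv: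
  assumes "unit_character G \<chi>" "x \<in> carrier G" "y \<in> carrier G"
  shows "\<chi> (x \<otimes> inv y) = \<chi> x * cnj (\<chi> y)"
proof -
  have hom: "\<chi> (u \<otimes> v) = \<chi> u * \<chi> v" if "u \<in> carrier G" "v \<in> carrier G" for u v
    using assms(1) that unfolding unit_character_def by blast
  have n: "norm (\<chi> u) = 1" for u using assms(1) unfolding unit_character_def by blast
  have c: "\<chi> y * cnj (\<chi> y) = 1" using n[of y] by (simp add: complex_norm_square[symmetric])
  have "\<chi> (x \<otimes> inv y) * \<chi> y = \<chi> x"
    using hom[of "x \<otimes> inv y" y] assms(2,3) by (simp add: m_assoc)
  then have "\<chi> (x \<otimes> inv y) * (\<chi> y * cnj (\<chi> y)) = \<chi> x * cnj (\<chi> y)" by (simp add: mult.assoc[symmetric])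
  then show ?thesis by (simp add: c)
qed

lemma monomial_append:
  assumes "u \<in> {..<d + e} \<rightarrow> carrier G"
  shows "monomial G (d + e) u l = monomial G d u l \<otimes> monomial G e (\<lambda>k. u (d + k)) (\<lambda>k. l (d + k))"
  using assms
proof (induction e)
  case 0
  then show ?case using monomial_closed[of u d l] by (simp add: monomial_0)
next
  case (Suc e)
  have u: "u \<in> {..<d + e} \<rightarrow> carrier G" "u \<in> {..<d} \<rightarrow> carrier G" "(\<lambda>k. u (d + k)) \<in> {..<Suc e} \<rightarrow> carrier G"
    "(\<lambda>k. u (d + k)) \<in> {..<e} \<rightarrow> carrier G" "u (d + e) \<in> carrier G"
    using Suc.prems by auto
  have "u \<in> {..<Suc (d + e)} \<rightarrow> carrier G" using Suc.prems by simp
  then have "monomial G (d + Suc e) u l = monomial G (d + e) u l \<otimes> u (d + e) [^] l (d + e)"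
    by (simp add: monomial_Suc)
  also have "\<dots> = monomial G d u l \<otimes> monomial G (Suc e) (\<lambda>k. u (d + k)) (\<lambda>k. l (d + k))"
    unfolding Suc.IH[OF u(1)] monomial_Suc[OF u(3)]
    using monomial_closed[OF u(2), of l] monomial_closed[OF u(4), of "\<lambda>k. l (d + k)"] u(5) by (intro m_assoc) auto
  finally show ?case .
qed

lemma monomial_in_set_power:
  assumes "B \<subseteq> carrier G" "\<forall>x\<in>B. inv x \<in> B" "\<forall>i<d. u i \<in> set_power G B k"
  shows "monomial G d u l \<in> set_power G B (\<Sum>i<d. k * nat \<bar>l i\<bar>)"
proof -
  have "u \<in> {..<d} \<rightarrow> carrier G" using assms(1,3) set_power_closed[OF assms(1)] by auto
  then show ?thesis using assms(3)
  proof (induction d)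
    case 0
    show ?case by (simp add: monomial_0)
  next
    case (Suc d)
    have "u \<in> {..<d} \<rightarrow> carrier G" using Suc.prems(1) by auto
    then have "monomial G d u l \<in> set_power G B (\<Sum>i<d. k * nat \<bar>l i\<bar>)" using Suc by simp
    moreover have "u d [^] l d \<in> set_power G B (k * nat \<bar>l d\<bar>)"
      using Suc.prems(2) by (intro set_power_int_pow[OF assms(1,2)]) simp
    ultimately have "monomial G d u l \<otimes> u d [^] l d \<in> set_power G B ((\<Sum>i<d. k * nat \<bar>l i\<bar>) + k * nat \<bar>l d\<bar>)"
      by (rule set_power_memI[OF assms(1)])
    then show ?case unfolding monomial_Suc[OF Suc.prems(1)] by (simp only: sum.lessThan_Suc)
  qed
qed

end

text \<open>All that is retained of the Fourier analysis is \<open>small_in\<close>. A quotient of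
  two elements of \<open>A^4\<close> lies in \<open>A^8\<close>, and when every character in
  \<open>S\<close> is near 1 on it, it returns to \<open>A^4\<close>. This makes the neighbourhood
  below closed under short quotients.\<close>

locale bohr_neighbourhood = comm_group G for G (structure) +
  fixes A :: "'a set" and S :: "('a \<Rightarrow> complex) set"
  assumes A_carrier: "A \<subseteq> carrier G" and finite_A: "finite A" and one_A: "\<one> \<in> A"
    and inv_A: "\<forall>x\<in>A. inv x \<in> A"
    and finite_S: "finite S" and char: "\<chi> \<in> S \<Longrightarrow> unit_character G \<chi>"
    and small_in: "x \<in> set_power G A 8 \<Longrightarrow> (\<And>\<chi>. \<chi> \<in> S \<Longrightarrow> norm (\<chi> x - 1) \<le> 1 / 4) \<Longrightarrow> x \<in> set_power G A 4"
begin

text \<open>The radius 1/8 makes \<open>8 * Arg (\<chi> x)\<close> a coordinate in the unit cube and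
  keeps the arguments far below \<open>pi\<close>, so that the argument of a quotient is the
  difference of the arguments.\<close>

definition D :: "'a set" where
  "D = {x \<in> set_power G A 4. \<forall>\<chi>\<in>S. \<bar>Arg (\<chi> x)\<bar> \<le> 1 / 8}"

lemma char_norm: "\<chi> \<in> S \<Longrightarrow> norm (\<chi> x) = 1"
  using char unfolding unit_character_def by blast

lemma set_power_A_carrier: "set_power G A n \<subseteq> carrier G"
  by (rule set_power_closed[OF A_carrier])

lemma D_carrier: "x \<in> D \<Longrightarrow> x \<in> carrier G"
  using set_power_A_carrier unfolding D_def by blast

lemma Arg_diff:
  assumes "\<chi> \<in> S" "x \<in> carrier G" "y \<in> carrier G" "\<bar>Arg (\<chi> x) - Arg (\<chi> y)\<bar> \<le> 1"
  shows "Arg (\<chi> (x \<otimes> inv y)) = Arg (\<chi> x) - Arg (\<chi> y)"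
  unfolding unit_character_mult_inv[OF char[OF assms(1)] assms(2,3)]
  using assms(4) pi_ge_two by (intro Arg_mult_cnj char_norm assms(1)) simp

lemma diff_in_D:
  assumes "x \<in> set_power G A 4" "y \<in> set_power G A 4"
    and "\<And>\<chi>. \<chi> \<in> S \<Longrightarrow> \<bar>Arg (\<chi> x) - Arg (\<chi> y)\<bar> \<le> 1 / 8"
  shows "x \<otimes> inv y \<in> D"
proof -
  have c: "x \<in> carrier G" "y \<in> carrier G" using assms set_power_A_carrier by auto
  have eq: "Arg (\<chi> (x \<otimes> inv y)) = Arg (\<chi> x) - Arg (\<chi> y)" if "\<chi> \<in> S" for \<chi>
    using assms(3)[OF that] by (intro Arg_diff that c) simp
  have "x \<otimes> inv y \<in> set_power G A (4 + 4)"
    by (intro set_power_memI[OF A_carrier] assms(1) set_power_inv[OF A_carrier inv_A assms(2)])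
  then have "x \<otimes> inv y \<in> set_power G A 8" by simp
  moreover have "norm (\<chi> (x \<otimes> inv y) - 1) \<le> 1 / 4" if "\<chi> \<in> S" for \<chi>
  proof -
    have "norm (\<chi> (x \<otimes> inv y) - 1) = norm (cis (Arg (\<chi> (x \<otimes> inv y))) - 1)"
      using unit_eq_cis_Arg[OF char_norm[OF that, of "x \<otimes> inv y"]] by simp
    also have "\<dots> \<le> \<bar>Arg (\<chi> (x \<otimes> inv y))\<bar>" by (rule norm_cis_minus_1_le)
    finally show ?thesis using eq[OF that] assms(3)[OF that] by simp
  qed
  ultimately have "x \<otimes> inv y \<in> set_power G A 4" by (rule small_in)
  then show ?thesis using eq assms(3) unfolding D_def by simp
qed

lemma D_set_power: "x \<in> D \<Longrightarrow> x \<in> set_power G A 4"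
  by (simp add: D_def)

lemma Arg_one: "\<chi> \<in> S \<Longrightarrow> Arg (\<chi> \<one>) = 0"
  using Arg_diff[of \<chi> \<one> \<one>] by simp

lemma one_D: "\<one> \<in> D"
  using diff_in_D[of \<one> \<one>] one_in_set_power[OF one_A A_carrier] by simp

lemma inv_D:
  assumes "x \<in> D"
  shows "inv x \<in> D" and "\<chi> \<in> S \<Longrightarrow> Arg (\<chi> (inv x)) = - Arg (\<chi> x)"
proof -
  have b: "\<bar>Arg (\<chi> \<one>) - Arg (\<chi> x)\<bar> \<le> 1 / 8" if "\<chi> \<in> S" for \<chi>
    using assms that Arg_one by (simp add: D_def)
  have x: "x \<in> carrier G" using D_carrier[OF assms] .
  show "inv x \<in> D"
    using diff_in_D[OF one_in_set_power[OF one_A A_carrier] D_set_power[OF assms]] b x by simp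
  show "\<chi> \<in> S \<Longrightarrow> Arg (\<chi> (inv x)) = - Arg (\<chi> x)"
    using Arg_diff[of \<chi> \<one> x] b[of \<chi>] x Arg_one by simp
qed

lemma mult_in_D:
  assumes "x \<in> D" "y \<in> D" and "\<And>\<chi>. \<chi> \<in> S \<Longrightarrow> \<bar>Arg (\<chi> x) + Arg (\<chi> y)\<bar> \<le> 1 / 8"
  shows "x \<otimes> y \<in> D" and "\<chi> \<in> S \<Longrightarrow> Arg (\<chi> (x \<otimes> y)) = Arg (\<chi> x) + Arg (\<chi> y)"
proof -
  have c: "x \<in> carrier G" "y \<in> carrier G" using assms(1,2) D_carrier by auto
  have "x \<otimes> inv (inv y) \<in> D"
    using assms inv_D[OF assms(2)] by (intro diff_in_D D_set_power) auto
  then show "x \<otimes> y \<in> D" using c by simp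
  assume "\<chi> \<in> S"
  then have "Arg (\<chi> (x \<otimes> inv (inv y))) = Arg (\<chi> x) - Arg (\<chi> (inv y))"
    using assms(3)[OF \<open>\<chi> \<in> S\<close>] inv_D(2)[OF assms(2) \<open>\<chi> \<in> S\<close>] c by (intro Arg_diff) auto
  then show "Arg (\<chi> (x \<otimes> y)) = Arg (\<chi> x) + Arg (\<chi> y)" using c inv_D(2)[OF assms(2) \<open>\<chi> \<in> S\<close>] by simp
qed

lemma mult_pow_in_D:
  assumes "x \<in> D" "w \<in> D" and "\<And>\<chi>. \<chi> \<in> S \<Longrightarrow> \<bar>Arg (\<chi> x)\<bar> + real j * \<bar>Arg (\<chi> w)\<bar> \<le> 1 / 8"
  shows "x \<otimes> w [^] j \<in> D \<and> (\<forall>\<chi>\<in>S. Arg (\<chi> (x \<otimes> w [^] j)) = Arg (\<chi> x) + real j * Arg (\<chi> w))"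
  using assms(3)
proof (induction j)
  case 0
  then show ?case using assms(1) D_carrier by simp
next
  case (Suc j)
  have c: "x \<in> carrier G" "w \<in> carrier G" using assms(1,2) D_carrier by auto
  have b: "\<bar>Arg (\<chi> x)\<bar> + real j * \<bar>Arg (\<chi> w)\<bar> + \<bar>Arg (\<chi> w)\<bar> \<le> 1 / 8" if "\<chi> \<in> S" for \<chi>
    using Suc.prems[OF that] by (simp add: algebra_simps)
  have "\<bar>Arg (\<chi> x)\<bar> + real j * \<bar>Arg (\<chi> w)\<bar> \<le> 1 / 8" if "\<chi> \<in> S" for \<chi>
    using b[OF that] by linarith
  then have IH: "x \<otimes> w [^] j \<in> D" "\<And>\<chi>. \<chi> \<in> S \<Longrightarrow> Arg (\<chi> (x \<otimes> w [^] j)) = Arg (\<chi> x) + real j * Arg (\<chi> w)"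
    using Suc.IH by auto
  have "\<bar>Arg (\<chi> (x \<otimes> w [^] j)) + Arg (\<chi> w)\<bar> \<le> 1 / 8" if "\<chi> \<in> S" for \<chi>
  proof -
    have "\<bar>real j * Arg (\<chi> w)\<bar> = real j * \<bar>Arg (\<chi> w)\<bar>" by (simp add: abs_mult)
    then show ?thesis using b[OF that] IH(2)[OF that] by linarith
  qed
  from mult_in_D[OF IH(1) assms(2) this]
  have "(x \<otimes> w [^] j) \<otimes> w \<in> D" "\<And>\<chi>. \<chi> \<in> S \<Longrightarrow> Arg (\<chi> ((x \<otimes> w [^] j) \<otimes> w)) = Arg (\<chi> x) + real (Suc j) * Arg (\<chi> w)"
    using IH(2) by (simp_all add: algebra_simps)
  then show ?case using c by (simp add: m_assoc)
qed

lemma mult_int_pow_in_D: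
  assumes "x \<in> D" "w \<in> D" and "\<And>\<chi>. \<chi> \<in> S \<Longrightarrow> \<bar>Arg (\<chi> x)\<bar> + \<bar>of_int j\<bar> * \<bar>Arg (\<chi> w)\<bar> \<le> 1 / 8"
  shows "x \<otimes> w [^] (j :: int) \<in> D \<and> (\<forall>\<chi>\<in>S. Arg (\<chi> (x \<otimes> w [^] j)) = Arg (\<chi> x) + of_int j * Arg (\<chi> w))"
proof (cases j rule: int_cases2)
  case (nonneg k)
  then show ?thesis using mult_pow_in_D[OF assms(1,2), of k] assms(3) by (simp add: int_pow_int)
next
  case (nonpos k)
  have w: "w \<in> carrier G" using D_carrier[OF assms(2)] .
  have "x \<otimes> inv w [^] k \<in> D \<and> (\<forall>\<chi>\<in>S. Arg (\<chi> (x \<otimes> inv w [^] k)) = Arg (\<chi> x) + real k * Arg (\<chi> (inv w)))"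
    using assms(3) inv_D(2)[OF assms(2)] nonpos by (intro mult_pow_in_D assms(1) inv_D(1)[OF assms(2)]) simp
  moreover have "inv w [^] k = w [^] j" using w nonpos by (simp add: int_pow_neg_int nat_pow_inv)
  ultimately show ?thesis using inv_D(2)[OF assms(2)] nonpos by simp
qed

text \<open>The budget of \<open>progression_cover\<close>, for the coordinates
  \<open>8 * Arg\<close>, keeps every partial product in \<open>D\<close>; arguments then add along
  the whole product exactly, and not only modulo \<open>2 * pi\<close>.\<close>

lemma monomial_in_D:
  assumes u: "\<forall>k<d. u k \<in> D" and l: "\<forall>k<d. \<bar>l k\<bar> \<le> int (L k)"
    and s: "\<forall>k<d. \<forall>\<chi>\<in>S. 8 * \<bar>Arg (\<chi> (u k))\<bar> \<le> s k" and s0: "\<forall>k<d. 0 \<le> s k"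
    and tot: "(\<Sum>k<d. real (L k) * s k) \<le> 1"
  shows "monomial G d u l \<in> D \<and>
    (\<forall>\<chi>\<in>S. Arg (\<chi> (monomial G d u l)) = (\<Sum>k<d. of_int (l k) * Arg (\<chi> (u k))) \<and>
      8 * \<bar>Arg (\<chi> (monomial G d u l))\<bar> \<le> (\<Sum>k<d. real (L k) * s k))"
  using assms
proof (induction d)
  case 0
  then show ?case using one_D Arg_one by (simp add: monomial_0)
next
  case (Suc d)
  have "real (L d) * s d \<ge> 0" using Suc.prems(4) by simp
  then have t: "(\<Sum>k<d. real (L k) * s k) \<le> 1" using Suc.prems(5) by simp
  let ?x = "monomial G d u l"
  have IH: "?x \<in> D" "\<And>\<chi>. \<chi> \<in> S \<Longrightarrow> Arg (\<chi> ?x) = (\<Sum>k<d. of_int (l k) * Arg (\<chi> (u k)))"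
     "\<And>\<chi>. \<chi> \<in> S \<Longrightarrow> 8 * \<bar>Arg (\<chi> ?x)\<bar> \<le> (\<Sum>k<d. real (L k) * s k)"
    using Suc.IH[OF _ _ _ _ t] Suc.prems by auto
  have ud: "u d \<in> D" using Suc.prems(1) by simp
  have b: "\<bar>of_int (l d)\<bar> * (8 * \<bar>Arg (\<chi> (u d))\<bar>) \<le> real (L d) * s d" if "\<chi> \<in> S" for \<chi>
  proof (rule mult_mono)
    have "\<bar>l d\<bar> \<le> int (L d)" using Suc.prems(2) by simp
    then show "\<bar>real_of_int (l d)\<bar> \<le> real (L d)" by linarith
  qed (use Suc.prems(3) that in auto)
  have "\<bar>Arg (\<chi> ?x)\<bar> + \<bar>of_int (l d)\<bar> * \<bar>Arg (\<chi> (u d))\<bar> \<le> 1 / 8" if "\<chi> \<in> S" for \<chi>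
    using IH(3)[OF that] b[OF that] Suc.prems(5) by simp
  from mult_int_pow_in_D[OF IH(1) ud this]
  have st: "?x \<otimes> u d [^] l d \<in> D"
    "\<And>\<chi>. \<chi> \<in> S \<Longrightarrow> Arg (\<chi> (?x \<otimes> u d [^] l d)) = Arg (\<chi> ?x) + of_int (l d) * Arg (\<chi> (u d))" by auto
  have "u \<in> {..<Suc d} \<rightarrow> carrier G" using Suc.prems(1) D_carrier by auto
  then have e: "monomial G (Suc d) u l = ?x \<otimes> u d [^] l d" by (rule monomial_Suc)
  have "8 * \<bar>Arg (\<chi> (?x \<otimes> u d [^] l d))\<bar> \<le> (\<Sum>k<Suc d. real (L k) * s k)" if "\<chi> \<in> S" for \<chi>
  proof -
    have "\<bar>of_int (l d) * Arg (\<chi> (u d))\<bar> = \<bar>of_int (l d)\<bar> * \<bar>Arg (\<chi> (u d))\<bar>" by (simp add: abs_mult)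
    then have "8 * \<bar>of_int (l d) * Arg (\<chi> (u d))\<bar> \<le> real (L d) * s d" using b[OF that] by linarith
    then have "8 * \<bar>Arg (\<chi> ?x)\<bar> + 8 * \<bar>of_int (l d) * Arg (\<chi> (u d))\<bar> \<le> (\<Sum>k<Suc d. real (L k) * s k)"
      unfolding sum.lessThan_Suc by (intro add_mono IH(3)[OF that])
    moreover have "8 * \<bar>Arg (\<chi> ?x) + of_int (l d) * Arg (\<chi> (u d))\<bar>
        \<le> 8 * \<bar>Arg (\<chi> ?x)\<bar> + 8 * \<bar>of_int (l d) * Arg (\<chi> (u d))\<bar>"
      using abs_triangle_ineq[of "Arg (\<chi> ?x)" "of_int (l d) * Arg (\<chi> (u d))"] by simp
    ultimately show ?thesis unfolding st(2)[OF that] by (rule order_trans[rotated])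
  qed
  then show ?case unfolding e using st IH(2) by simp
qed

text \<open>The kernel of the map from \<open>D\<close> to the cube. It is closed under products
  without any shortness condition, because arguments equal to 0 stay 0.\<close>

definition H :: "'a set" where
  "H = {x \<in> D. \<forall>\<chi>\<in>S. Arg (\<chi> x) = 0}"

lemma H_subgroup: "subgroup H G"
proof (rule subgroup.intro)
  show "H \<subseteq> carrier G" using D_carrier by (auto simp: H_def)
  show "\<one> \<in> H" using one_D Arg_one by (simp add: H_def)
  show "inv x \<in> H" if "x \<in> H" for x using that inv_D[of x] by (simp add: H_def)
  show "x \<otimes> y \<in> H" if "x \<in> H" "y \<in> H" for x y using that mult_in_D[of x y] by (simp add: H_def)
qed

lemma finite_D: "finite D"
  by (rule finite_subset[OF _ finite_set_power[OF finite_A, of 4]]) (auto simp: D_def)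

lemma finite_H: "finite H"
  by (rule finite_subset[OF _ finite_D]) (auto simp: H_def)

text \<open>The progression in the cube is pulled back to the group. A point near 1 and the monomial
  with the same coordinates have a quotient all of whose arguments are 0, so it lies in
  \<open>H\<close>.\<close>

lemma ex_progression:
  "\<exists>d u L. d \<le> card S \<and> (\<forall>k<d. u k \<in> D \<and> 0 < L k) \<and>
    (\<forall>l. (\<forall>k<d. \<bar>l k\<bar> \<le> int (L k)) \<longrightarrow> monomial G d u l \<in> D) \<and>
    (\<forall>x\<in>D. (\<forall>\<chi>\<in>S. 8 * \<bar>Arg (\<chi> x)\<bar> \<le> (1 / 16) ^ card S) \<longrightarrow>
      (\<exists>l. (\<forall>k<d. \<bar>l k\<bar> \<le> int (L k)) \<and> x \<otimes> inv (monomial G d u l) \<in> H))"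
proof -
  define vec where "vec x = (\<lambda>\<chi>. if \<chi> \<in> S then 8 * Arg (\<chi> x) else 0)" for x :: 'a
  have "\<exists>d v L s. progression_cover S (vec ` D) d v L s"
  proof (rule local_subgroup_progression[OF finite_S])
    show "finite (vec ` D)" using finite_D by simp
    show "(\<lambda>_. 0) \<in> vec ` D" using one_D Arg_one by (intro image_eqI[of _ _ \<one>]) (auto simp: vec_def)
    show "x i = 0" if "x \<in> vec ` D" "i \<notin> S" for x i using that by (auto simp: vec_def)
    show "\<bar>x i\<bar> \<le> 1" if "x \<in> vec ` D" "i \<in> S" for x i using that by (auto simp: vec_def D_def abs_mult)
    fix f g assume fg: "f \<in> vec ` D" "g \<in> vec ` D" "\<forall>i\<in>S. \<bar>f i - g i\<bar> \<le> 1"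
    then obtain x y where xy: "x \<in> D" "f = vec x" "y \<in> D" "g = vec y" by blast
    have b: "\<bar>Arg (\<chi> x) - Arg (\<chi> y)\<bar> \<le> 1 / 8" if "\<chi> \<in> S" for \<chi>
    proof -
      have "\<bar>8 * Arg (\<chi> x) - 8 * Arg (\<chi> y)\<bar> \<le> 1" using bspec[OF fg(3) that] that unfolding xy(2,4) vec_def by simp
      then show ?thesis by linarith
    qed
    have "x \<otimes> inv y \<in> D" using xy b by (intro diff_in_D D_set_power)
    moreover have "(\<lambda>i. f i - g i) = vec (x \<otimes> inv y)"
    proof
      fix \<chi> show "f \<chi> - g \<chi> = vec (x \<otimes> inv y) \<chi>"
        using Arg_diff[of \<chi> x y] b[of \<chi>] D_carrier xy by (auto simp: vec_def)
    qed
    ultimately show "(\<lambda>i. f i - g i) \<in> vec ` D" by blast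
  qed
  then obtain d v L s where "progression_cover S (vec ` D) d v L s" by blast
  note P = this[unfolded progression_cover_def]
  have "\<forall>k\<in>{..<d}. \<exists>x. x \<in> D \<and> v k = vec x" using P by blast
  from bchoice[OF this] obtain u where u: "\<forall>k<d. u k \<in> D \<and> v k = vec (u k)" by auto
  have uD: "\<forall>k<d. u k \<in> D" using u by simp
  have us: "\<forall>k<d. \<forall>\<chi>\<in>S. 8 * \<bar>Arg (\<chi> (u k))\<bar> \<le> s k"
  proof (intro allI impI ballI)
    fix k \<chi> assume k: "k < d" "\<chi> \<in> S"
    then have "\<bar>v k \<chi>\<bar> \<le> s k" using P by blast
    then show "8 * \<bar>Arg (\<chi> (u k))\<bar> \<le> s k" using u k by (simp add: vec_def abs_mult)
  qed
  have s0: "\<forall>k<d. 0 \<le> s k" and L0: "\<forall>k<d. 0 < L k" and tot: "(\<Sum>k<d. real (L k) * s k) \<le> 1" using P by auto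
  have mono: "monomial G d u l \<in> D \<and>
    (\<forall>\<chi>\<in>S. Arg (\<chi> (monomial G d u l)) = (\<Sum>k<d. of_int (l k) * Arg (\<chi> (u k))))"
    if "\<forall>k<d. \<bar>l k\<bar> \<le> int (L k)" for l
    using monomial_in_D[OF uD that us s0 tot] by blast
  have cov: "\<exists>l. (\<forall>k<d. \<bar>l k\<bar> \<le> int (L k)) \<and> x \<otimes> inv (monomial G d u l) \<in> H"
    if x: "x \<in> D" and xs: "\<forall>\<chi>\<in>S. 8 * \<bar>Arg (\<chi> x)\<bar> \<le> (1 / 16) ^ card S" for x
  proof -
    have "\<forall>i\<in>S. \<bar>vec x i\<bar> \<le> (1/16) ^ card S" using xs by (simp add: vec_def abs_mult)
    moreover have "vec x \<in> vec ` D" using x by blast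
    ultimately have "\<exists>l :: nat \<Rightarrow> int. (\<forall>k<d. \<bar>l k\<bar> \<le> int (L k)) \<and> (\<forall>i. vec x i = (\<Sum>k<d. of_int (l k) * v k i))"
      using P by blast
    then obtain l where l: "\<forall>k<d. \<bar>l k\<bar> \<le> int (L k)" "\<And>i. vec x i = (\<Sum>k<d. of_int (l k) * v k i)" by blast
    let ?y = "monomial G d u l"
    have y: "?y \<in> D" "\<And>\<chi>. \<chi> \<in> S \<Longrightarrow> Arg (\<chi> ?y) = (\<Sum>k<d. of_int (l k) * Arg (\<chi> (u k)))" using mono[OF l(1)] by auto
    have eq: "Arg (\<chi> x) = Arg (\<chi> ?y)" if "\<chi> \<in> S" for \<chi>
    proof -
      have "8 * Arg (\<chi> x) = (\<Sum>k<d. of_int (l k) * v k \<chi>)" using l(2)[of \<chi>] that by (simp add: vec_def)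
      also have "\<dots> = (\<Sum>k<d. 8 * (of_int (l k) * Arg (\<chi> (u k))))"
        using u that by (intro sum.cong refl) (simp add: vec_def)
      finally show ?thesis using y(2)[OF that] by (simp add: sum_distrib_left[symmetric])
    qed
    then have "x \<otimes> inv ?y \<in> D" using x y by (intro diff_in_D D_set_power) auto
    moreover have "Arg (\<chi> (x \<otimes> inv ?y)) = 0" if "\<chi> \<in> S" for \<chi>
      using Arg_diff[OF that D_carrier[OF x] D_carrier[OF y(1)]] eq[OF that] by simp
    ultimately have "x \<otimes> inv ?y \<in> H" by (simp add: H_def)
    then show ?thesis using l(1) by blast
  qed
  show ?thesis
    using P uD L0 mono cov by (intro exI[of _ d] exI[of _ u] exI[of _ L]) auto
qed

text \<open>\<open>A\<close> need not lie in the neighbourhood covered so far, so a net of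
  \<open>A\<close> at that scale is added to the generators, each with length 1. The number
  \<open>(64 * 16 ^ card S + 1) ^ card S\<close> counts the cells of a grid with at most one net
  point each. The exponent is 4 for \<open>H\<close>, 4 for the progression and 1 for each net
  point.\<close>

lemma ex_coset_progression:
  "\<exists>d u L. d \<le> card S + (64 * 16 ^ card S + 1) ^ card S \<and> is_coset_progression G H d u L \<and>
    A \<subseteq> coset_progression G H d u L \<and>
    coset_progression G H d u L \<subseteq> set_power G A (8 + (64 * 16 ^ card S + 1) ^ card S)"
proof -
  obtain d u L where P: "d \<le> card S" "\<forall>k<d. u k \<in> D \<and> 0 < L k"
    "\<forall>l. (\<forall>k<d. \<bar>l k\<bar> \<le> int (L k)) \<longrightarrow> monomial G d u l \<in> D"
    "\<forall>x\<in>D. (\<forall>\<chi>\<in>S. 8 * \<bar>Arg (\<chi> x)\<bar> \<le> (1 / 16) ^ card S) \<longrightarrow>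
      (\<exists>l. (\<forall>k<d. \<bar>l k\<bar> \<le> int (L k)) \<and> x \<otimes> inv (monomial G d u l) \<in> H)"
    using ex_progression by (elim exE conjE) (rule that)
  define c :: real where "c = 16 ^ card S"
  have c: "c \<ge> 1" by (simp add: c_def)
  have cinv: "(1 / 16) ^ card S = 1 / c" by (simp add: c_def power_one_over)
  let ?R = "\<lambda>x y. \<forall>\<chi>\<in>S. 8 * \<bar>Arg (\<chi> x) - Arg (\<chi> y)\<bar> \<le> 1 / c"
  have "\<exists>Y\<subseteq>A. (\<forall>x\<in>Y. \<forall>y\<in>Y. ?R x y \<longrightarrow> x = y) \<and> (\<forall>x\<in>A. \<exists>y\<in>Y. ?R x y)"
    by (rule ex_maximal_separated_subset[OF finite_A]) (use c in \<open>auto simp: abs_minus_commute\<close>)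
  then obtain Y where Y: "Y \<subseteq> A" "\<forall>x\<in>Y. \<forall>y\<in>Y. ?R x y \<longrightarrow> x = y" "\<forall>x\<in>A. \<exists>y\<in>Y. ?R x y" by blast
  have finY: "finite Y" using Y(1) finite_A finite_subset by blast
  \<comment> \<open>Arguments have absolute value at most 4; multiplied by
    \<open>8 * 16 ^ card S\<close> and rounded down they take at most
    \<open>64 * 16 ^ card S + 1\<close> values per character. Two points of one cell are within the
    scale of the net.\<close>
  define cell where "cell y = (\<lambda>\<chi>\<in>S. \<lfloor>Arg (\<chi> y) * (8 * c)\<rfloor>)" for y :: 'a
  have "inj_on cell Y"
  proof (rule inj_onI)
    fix x y assume xy: "x \<in> Y" "y \<in> Y" "cell x = cell y"
    have "8 * \<bar>Arg (\<chi> x) - Arg (\<chi> y)\<bar> \<le> 1 / c" if "\<chi> \<in> S" for \<chi>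
    proof -
      have "\<lfloor>Arg (\<chi> x) * (8 * c)\<rfloor> = \<lfloor>Arg (\<chi> y) * (8 * c)\<rfloor>"
        using fun_cong[OF xy(3), of \<chi>] that by (simp add: cell_def)
      then have "\<bar>Arg (\<chi> x) * (8 * c) - Arg (\<chi> y) * (8 * c)\<bar> \<le> 1" by linarith
      then have "\<bar>(Arg (\<chi> x) - Arg (\<chi> y)) * (8 * c)\<bar> \<le> 1" by (simp add: algebra_simps)
      then have "\<bar>Arg (\<chi> x) - Arg (\<chi> y)\<bar> * (8 * c) \<le> 1" using c by (simp add: abs_mult)
      then show ?thesis using c by (simp add: field_simps)
    qed
    then show "x = y" using Y(2) xy by blast
  qed
  moreover have "cell ` Y \<subseteq> (\<Pi>\<^sub>E \<chi>\<in>S. {- (32 * 16 ^ card S)..32 * 16 ^ card S})"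
  proof
    fix f assume "f \<in> cell ` Y"
    then obtain y where y: "f = cell y" by blast
    have "- (32 * 16 ^ card S) \<le> \<lfloor>Arg (\<chi> y) * (8 * c)\<rfloor> \<and> \<lfloor>Arg (\<chi> y) * (8 * c)\<rfloor> \<le> 32 * 16 ^ card S" for \<chi>
    proof -
      have "\<bar>Arg (\<chi> y)\<bar> \<le> 4" using Arg_bounded[of "\<chi> y"] pi_less_4 by linarith
      then have "\<bar>Arg (\<chi> y) * (8 * c)\<bar> \<le> 4 * (8 * c)" using c by (simp add: abs_mult)
      then have "\<bar>Arg (\<chi> y) * (8 * c)\<bar> \<le> of_int (32 * 16 ^ card S)" by (simp add: c_def)
      then show ?thesis by linarith
    qed
    then show "f \<in> (\<Pi>\<^sub>E \<chi>\<in>S. {- (32 * 16 ^ card S)..32 * 16 ^ card S})" by (simp add: y cell_def)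
  qed
  moreover have "finite (\<Pi>\<^sub>E \<chi>\<in>S. {- (32 * 16 ^ card S)..32 * 16 ^ card S :: int})"
    using finite_S by (intro finite_PiE) auto
  ultimately have "card Y \<le> card (\<Pi>\<^sub>E \<chi>\<in>S. {- (32 * 16 ^ card S)..32 * 16 ^ card S :: int})"
    by (rule card_inj_on_le)
  also have "\<dots> = (64 * 16 ^ card S + 1) ^ card S"
    using finite_S by (simp add: card_PiE nat_add_distrib nat_mult_distrib nat_power_eq)
  finally have cY: "card Y \<le> (64 * 16 ^ card S + 1) ^ card S" .
  obtain f where f: "bij_betw f {..<card Y} Y" using ex_bij_betw_nat_finite[OF finY] by (auto simp: atLeast0LessThan)
  define e where "e = card Y"
  define u' where "u' k = (if k < d then u k else f (k - d))" for k
  define L' where "L' k = (if k < d then L k else 1)" for k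
  have fA: "f k \<in> A" if "k < e" for k using f that Y(1) by (auto simp: bij_betw_def e_def)
  have u'c: "u' \<in> {..<d + e} \<rightarrow> carrier G"
  proof
    fix k assume "k \<in> {..<d + e}"
    then show "u' k \<in> carrier G" using P(2) D_carrier fA[of "k - d"] A_carrier by (auto simp: u'_def)
  qed
  have uc: "u \<in> {..<d} \<rightarrow> carrier G" using P(2) D_carrier by auto
  have fc: "f \<in> {..<e} \<rightarrow> carrier G" using fA A_carrier by auto
  have split: "monomial G (d + e) u' l = monomial G d u l \<otimes> monomial G e f (\<lambda>k. l (d + k))" for l
  proof -
    have "monomial G d u' l = monomial G d u l"
      by (rule monomial_cong) (use uc in \<open>auto simp: u'_def\<close>)
    then show ?thesis unfolding monomial_append[OF u'c] by (simp add: u'_def)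
  qed
  have "A \<subseteq> coset_progression G H (d + e) u' L'"
  proof
    fix x assume x: "x \<in> A"
    then obtain y where y: "y \<in> Y" "?R x y" using Y(3) by blast
    have c: "x \<in> carrier G" "y \<in> carrier G" using x y Y(1) A_carrier by auto
    have x4: "x \<in> set_power G A 4" "y \<in> set_power G A 4"
      using set_power_mono[OF A_carrier one_A, of 1 4] set_power_1[OF A_carrier] x y Y(1) by auto
    have small: "\<bar>Arg (\<chi> x) - Arg (\<chi> y)\<bar> \<le> 1 / 8" if "\<chi> \<in> S" for \<chi>
    proof -
      have "8 * \<bar>Arg (\<chi> x) - Arg (\<chi> y)\<bar> \<le> 1 / c" using y(2) that by blast
      also have "\<dots> \<le> 1" using \<open>c \<ge> 1\<close> by simp
      finally show ?thesis by simp
    qed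
    have zD: "x \<otimes> inv y \<in> D" using x4 small by (rule diff_in_D)
    have "\<forall>\<chi>\<in>S. 8 * \<bar>Arg (\<chi> (x \<otimes> inv y))\<bar> \<le> (1 / 16) ^ card S"
    proof
      fix \<chi> assume \<chi>: "\<chi> \<in> S"
      have "Arg (\<chi> (x \<otimes> inv y)) = Arg (\<chi> x) - Arg (\<chi> y)"
        using small[OF \<chi>] by (intro Arg_diff \<chi> c) simp
      then show "8 * \<bar>Arg (\<chi> (x \<otimes> inv y))\<bar> \<le> (1 / 16) ^ card S" using y(2) \<chi> by (simp add: cinv)
    qed
    then obtain l where l: "\<forall>k<d. \<bar>l k\<bar> \<le> int (L k)" "(x \<otimes> inv y) \<otimes> inv (monomial G d u l) \<in> H"
      using P(4) zD by blast
    obtain j where j: "j < e" "y = f j" using f y(1) by (auto simp: bij_betw_def e_def)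
    \<comment> \<open>Among the added generators only the net point \<open>y\<close> near
      \<open>x\<close> is used, with exponent 1.\<close>
    define l' where "l' k = (if k < d then l k else if k - d = j then 1 else 0)" for k
    have mc: "monomial G d u l \<in> carrier G" by (rule monomial_closed[OF uc])
    have "monomial G (d + e) u' l' = monomial G d u l \<otimes> y"
    proof -
      have "monomial G d u l' = monomial G d u l" by (rule monomial_cong) (use uc in \<open>auto simp: l'_def\<close>)
      moreover have "monomial G e f (\<lambda>k. l' (d + k)) = f j [^] (1 :: int)"
        unfolding monomial_single[OF fc j(1), symmetric] by (simp add: l'_def)
      ultimately show ?thesis using j c by (simp add: split int_pow_1)
    qed
    then have "x = ((x \<otimes> inv y) \<otimes> inv (monomial G d u l)) \<otimes> monomial G (d + e) u' l'"
    proof -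
      have "((x \<otimes> inv y) \<otimes> inv (monomial G d u l)) \<otimes> (monomial G d u l \<otimes> y)
        = (x \<otimes> inv y) \<otimes> ((inv (monomial G d u l) \<otimes> monomial G d u l) \<otimes> y)"
        using c mc by (simp only: m_assoc m_closed inv_closed)
      also have "\<dots> = x" using c mc by (simp add: m_assoc)
      finally show ?thesis using \<open>monomial G (d + e) u' l' = monomial G d u l \<otimes> y\<close> by simp
    qed
    moreover have "\<forall>k<d + e. \<bar>l' k\<bar> \<le> int (L' k)" using l(1) by (simp add: l'_def L'_def)
    ultimately show "x \<in> coset_progression G H (d + e) u' L'"
      unfolding mem_coset_progression[OF u'c] using l(2)
      by (intro bexI[of _ "(x \<otimes> inv y) \<otimes> inv (monomial G d u l)"] exI[of _ l'] conjI)
  qed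
  moreover have "coset_progression G H (d + e) u' L' \<subseteq> set_power G A (8 + (64 * 16 ^ card S + 1) ^ card S)"
  proof
    fix x assume "x \<in> coset_progression G H (d + e) u' L'"
    then obtain h l where h: "h \<in> H" "\<forall>k<d + e. \<bar>l k\<bar> \<le> int (L' k)" "x = h \<otimes> monomial G (d + e) u' l"
      unfolding mem_coset_progression[OF u'c] by (elim bexE exE conjE) (rule that)
    have h4: "h \<in> set_power G A 4" using h(1) by (simp add: H_def D_def)
    have m4: "monomial G d u l \<in> set_power G A 4"
    proof -
      have "\<forall>k<d. \<bar>l k\<bar> \<le> int (L k)" using h(2) by (auto simp: L'_def) (metis trans_less_add1)
      then show ?thesis using P(3) D_set_power by blast
    qed
    have "monomial G e f (\<lambda>k. l (d + k)) \<in> set_power G A (\<Sum>k<e. 1 * nat \<bar>l (d + k)\<bar>)"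
      by (rule monomial_in_set_power[OF A_carrier inv_A]) (use fA set_power_1[OF A_carrier] in simp)
    moreover have "(\<Sum>k<e. 1 * nat \<bar>l (d + k)\<bar>) \<le> (\<Sum>k<e. 1)"
    proof (rule sum_mono)
      fix k assume "k \<in> {..<e}"
      then have "\<bar>l (d + k)\<bar> \<le> int (L' (d + k))" using h(2) by simp
      then show "1 * nat \<bar>l (d + k)\<bar> \<le> 1" by (simp add: L'_def)
    qed
    moreover have "(\<Sum>k<e. 1 :: nat) \<le> (64 * 16 ^ card S + 1) ^ card S" using cY by (simp add: e_def)
    ultimately have mY: "monomial G e f (\<lambda>k. l (d + k)) \<in> set_power G A ((64 * 16 ^ card S + 1) ^ card S)"
      using set_power_mono[OF A_carrier one_A] by (meson order_trans subsetD)
    have "h \<otimes> (monomial G d u l \<otimes> monomial G e f (\<lambda>k. l (d + k))) \<in>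
        set_power G A (4 + (4 + (64 * 16 ^ card S + 1) ^ card S))"
      by (intro set_power_memI[OF A_carrier] h4 m4 mY)
    then show "x \<in> set_power G A (8 + (64 * 16 ^ card S + 1) ^ card S)"
      unfolding h(3) split by (simp only: add.assoc[symmetric]) simp
  qed
  moreover have "is_coset_progression G H (d + e) u' L'"
    unfolding is_coset_progression_def
  proof (intro conjI allI impI)
    fix i assume "i < d + e"
    then show "u' i \<in> carrier G" "0 < L' i" using u'c P(2) by (auto simp: L'_def)
  qed (use comm_group_axioms H_subgroup finite_H in auto)
  moreover have "d + e \<le> card S + (64 * 16 ^ card S + 1) ^ card S" using P(1) cY by (simp add: e_def)
  ultimately show ?thesis by (intro exI[of _ "d + e"] exI[of _ u'] exI[of _ L'] conjI)
qed

end

section \<open>Characters of finitely generated abelian groups\<close>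

context approximate_subgroup_dual
begin

text \<open>The parameters are solved backwards: \<open>\<rho>\<close> gives equality in
  \<open>4 * r * \<rho>\<^sup>2 \<le> 1\<close>, \<open>\<delta>\<close> ensures
  \<open>m * (2 * \<delta>) \<le> 1 / 4\<close>, and the growth excess \<open>e\<close> is taken
  with \<open>8 * e * r = \<delta>\<^sup>2\<close>. The size \<open>32 * r * N ^ r\<close> is then
  \<open>4 * (2 * N ^ r) / \<rho>\<^sup>2\<close>. The power \<open>T\<close> contains every set
  whose points must be told apart.\<close>

lemma bohr_set_in_set_power_4:
  assumes m: "m \<ge> 4" and N: "N \<ge> 1"
    and step: "real (card (set_power G A (N + 2))) \<le>
      (1 + 1 / (512 * (real m)\<^sup>2 * real r ^ 3)) * real (card (set_power G A N))"
    and sep: "separates (set_power G A T)" and T: "N + 2 \<le> T" "m \<le> T"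
  shows "\<exists>S\<subseteq>\<Xi>. card S \<le> 32 * r * N ^ r \<and>
    (\<forall>x\<in>set_power G A m. (\<forall>\<chi>\<in>S. norm (\<chi> x - 1) \<le> 1 / 4) \<longrightarrow> x \<in> set_power G A 4)"
proof -
  define \<delta> where "\<delta> = 1 / (8 * real m * real r)"
  define \<rho> where "\<rho> = 1 / (2 * sqrt (real r))"
  have r: "real r \<ge> 1" using r_pos by simp
  have m': "real m \<ge> 4" using m by simp
  have sq: "sqrt (real r) \<ge> 1" "sqrt (real r) \<le> real r" "(sqrt (real r))\<^sup>2 = real r"
    using r real_sqrt_le_mono[of "real r" "(real r)\<^sup>2"] by (auto simp: self_le_power)
  have \<rho>0: "\<rho> > 0" using sq by (simp add: \<rho>_def)
  have \<rho>2: "\<rho>\<^sup>2 = 1 / (4 * real r)" by (simp add: \<rho>_def power_divide power_mult_distrib sq)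
  have \<delta>0: "\<delta> \<ge> 0" by (simp add: \<delta>_def)
  have \<delta>\<rho>: "\<delta> \<le> \<rho> / 2"
  proof -
    have "4 * sqrt (real r) \<le> 8 * real m * real r"
    proof -
      have "4 * sqrt (real r) \<le> 4 * real r" using sq by simp
      also have "\<dots> \<le> 8 * real m * real r" using m' r by (intro mult_right_mono) auto
      finally show ?thesis .
    qed
    then have "1 / (8 * real m * real r) \<le> 1 / (4 * sqrt (real r))" using sq r m' by (intro divide_left_mono mult_pos_pos) auto
    then show ?thesis by (simp add: \<delta>_def \<rho>_def)
  qed
  have sub: "set_power G A i \<subseteq> set_power G A T" if "i \<le> T" for i
    by (rule set_power_mono[OF A_carrier one_A that])
  have sepA: "separates A" using separates_subset[OF sep sub[of 1]] T set_power_1[OF A_carrier] by simp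
  have sepN: "separates (set_power G A (N + 2))" by (rule separates_subset[OF sep sub[OF T(1)]])
  let ?e = "1 / (512 * (real m)\<^sup>2 * real r ^ 3)"
  have e0: "?e > 0" using r m' by simp
  have e1: "8 * ?e * real r \<le> \<delta>\<^sup>2" using r m'
    by (simp add: \<delta>_def power2_eq_square power3_eq_cube field_simps)
  have g: "real (card (set_power G A N)) \<le> real N ^ r * real (card A)"
    using growth[of "N - 1"] N unfolding of_nat_power[symmetric] of_nat_mult[symmetric] of_nat_le_iff by simp
  have "real (card \<Xi>) \<le> 2 * real (card (set_power G A N)) * real (card (near_one \<delta>))"
    by (rule card_near_one_ge[OF sepN e0 step e1 \<delta>0])
  also have "\<dots> \<le> 2 * (real N ^ r * real (card A)) * real (card (near_one \<delta>))"
    using g by (intro mult_right_mono) auto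
  finally have "real (card \<Xi>) \<le> (2 * real N ^ r) * real (card A) * real (card (near_one \<delta>))"
    by (simp add: mult.assoc)
  from spectrum_covering[OF sepA \<rho>0 \<delta>\<rho> this] obtain S where S: "S \<subseteq> spectrum \<rho>"
    "real (card S) \<le> 4 * (2 * real N ^ r) / \<rho>\<^sup>2"
    "\<forall>\<chi>\<in>spectrum \<rho>. \<exists>\<psi>\<in>S. \<forall>s\<in>A. norm (\<chi> s - \<psi> s) \<le> 2 * \<delta>" by blast
  have SX: "S \<subseteq> \<Xi>" using S(1) by (auto simp: spectrum_def)
  have "real (card S) \<le> real (32 * r * N ^ r)" using S(2) r by (simp add: \<rho>2 mult_ac)
  then have cS: "card S \<le> 32 * r * N ^ r" by (simp only: of_nat_le_iff)
  have "x \<in> set_power G A 4"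
    if x: "x \<in> set_power G A m" and near: "\<forall>\<chi>\<in>S. norm (\<chi> x - 1) \<le> 1 / 4" for x
  proof (rule bogolyubov[OF _ _ \<rho>0])
    show "separates (insert x (set_power G A 4))"
      by (rule separates_subset[OF sep]) (use sub[OF T(2)] sub[of 4] x m T in auto)
    show "x \<in> carrier G" using x set_power_closed[OF A_carrier] by blast
    show "4 * real r * \<rho>\<^sup>2 \<le> 1" using r by (simp add: \<rho>2)
    fix \<chi> assume \<chi>: "\<chi> \<in> spectrum \<rho>"
    then obtain \<psi> where \<psi>: "\<psi> \<in> S" "\<forall>s\<in>A. norm (\<chi> s - \<psi> s) \<le> 2 * \<delta>" using S(3) by blast
    have "norm (\<chi> x - \<psi> x) \<le> real m * (2 * \<delta>)"
      using \<chi> \<psi> SX x by (intro char_close_on_set_power) (auto simp: spectrum_def)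
    also have "\<dots> \<le> 1 / 4" using r m' by (simp add: \<delta>_def field_simps)
    \<comment> \<open>One quarter is the distance from \<open>\<chi>\<close> to its representative
      in \<open>S\<close> at the point \<open>x\<close>, the other is the hypothesis on that
      representative.\<close>
    finally have "norm (\<chi> x - 1) \<le> 1 / 4 + 1 / 4"
      using near \<psi>(1) norm_triangle_ineq[of "\<chi> x - \<psi> x" "\<psi> x - 1"] by force
    then have "\<bar>Re (\<chi> x - 1)\<bar> \<le> 1 / 2" using abs_Re_le_cmod[of "\<chi> x - 1"] by linarith
    then show "1 / 2 \<le> Re (\<chi> x)" unfolding minus_complex.sel one_complex.sel by arith
  qed
  then show ?thesis using SX cS by blast
qed

end

text \<open>The value 1 outside the carrier makes these functions determined by their values on generators.\<close>

definition root_characters :: "('a, 'b) monoid_scheme \<Rightarrow> nat \<Rightarrow> ('a \<Rightarrow> complex) set" where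
  "root_characters G M = {\<chi>. (\<forall>x\<in>carrier G. \<forall>y\<in>carrier G. \<chi> (x \<otimes>\<^bsub>G\<^esub> y) = \<chi> x * \<chi> y) \<and>
     (\<forall>x. \<chi> x ^ M = 1) \<and> (\<forall>x. x \<notin> carrier G \<longrightarrow> \<chi> x = 1)}"

lemma cis_2pi_eq_1: "cis (2 * pi * t) = 1 \<longleftrightarrow> t \<in> \<int>"
proof
  assume "cis (2 * pi * t) = 1"
  then have "cos (2 * pi * t) = 1" by (metis cis.sel(1) one_complex.sel(1))
  then obtain n where "2 * pi * t = of_int n * 2 * pi" using cos_one_2pi_int by blast
  then have "t = of_int n" by simp
  then show "t \<in> \<int>" by simp
qed (simp add: cis_multiple_2pi)

context comm_group
begin

lemma generate_eq_monomials:
  assumes "B \<subseteq> carrier G" "bij_betw a {..<c} B" "x \<in> generate G B"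
  shows "\<exists>l. (\<forall>i\<ge>c. l i = 0) \<and> x = monomial G c a l"
proof -
  have a: "a \<in> {..<c} \<rightarrow> carrier G" using assms(1,2) by (auto simp: bij_betw_def)
  have gen: "\<exists>l. (\<forall>i\<ge>c. l i = 0) \<and> y [^] (n::int) = monomial G c a l" if "y \<in> B" for y n
  proof -
    obtain k where "k < c" "y = a k" using assms(2) \<open>y \<in> B\<close> by (auto simp: bij_betw_def)
    then show ?thesis
      using monomial_single[OF a, of k n] by (intro exI[of _ "\<lambda>i. if i = k then n else 0"]) auto
  qed
  show ?thesis using assms(3)
  proof (induction rule: generate.induct)
    case one
    show ?case using monomial_zero[OF a] by (intro exI[of _ "\<lambda>_. 0"]) auto
  next
    case (incl h)
    then have "h [^] (1 :: int) = h" using assms(1) by (intro int_pow_1) auto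
    then show ?case using gen[OF incl, of 1] by simp
  next
    case (inv h)
    have "h \<in> carrier G" using inv assms(1) by blast
    then have "h [^] (-1 :: int) = inv h" using int_pow_neg[of h 1] by (simp add: int_pow_1)
    then show ?case using gen[OF inv, of "-1"] by simp
  next
    case (eng h1 h2)
    then obtain l1 l2 where "\<forall>i\<ge>c. l1 i = 0" "h1 = monomial G c a l1" "\<forall>i\<ge>c. l2 i = 0" "h2 = monomial G c a l2"
      by blast
    then show ?case using monomial_add[OF a] by (intro exI[of _ "\<lambda>i. l1 i + l2 i"]) auto
  qed
qed

text \<open>The group is the free abelian group on \<open>B\<close> modulo the relations
  \<open>?R\<close>. A functional that is integral on the relations is well defined modulo 1 on the
  group, and so yields a character.\<close>

lemma ex_root_character:
  assumes "finite B" "B \<subseteq> carrier G" "generate G B = carrier G" "g \<in> carrier G" "g \<noteq> \<one>"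
  shows "\<exists>M>0. \<exists>\<chi>\<in>root_characters G M. \<chi> g \<noteq> 1"
proof -
  obtain a where bij: "bij_betw a {..<card B} B"
    using ex_bij_betw_nat_finite[OF assms(1)] by (auto simp: atLeast0LessThan)
  define c where "c = card B"
  note bij = bij[folded c_def]
  have a: "a \<in> {..<c} \<rightarrow> carrier G" using assms(2) bij by (auto simp: bij_betw_def)
  \<comment> \<open>Exponent vectors are not unique. An arbitrary choice will do, since two choices
    differ by an element of \<open>?R\<close>, where the functional is integral.\<close>
  define coords where "coords x = (SOME l. (\<forall>i\<ge>c. l i = 0) \<and> x = monomial G c a l)" for x
  have coords: "(\<forall>i\<ge>c. coords x i = 0) \<and> x = monomial G c a (coords x)" if "x \<in> carrier G" for x
  proof -
    have "\<exists>l. (\<forall>i\<ge>c. l i = 0) \<and> x = monomial G c a l"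
      by (rule generate_eq_monomials[OF assms(2) bij]) (use that assms(3) in simp)
    from someI_ex[OF this] show ?thesis unfolding coords_def .
  qed
  let ?R = "{l. (\<forall>i\<ge>c. l i = 0) \<and> monomial G c a l = \<one>}"
  have "\<exists>(p :: nat \<Rightarrow> real) (M :: nat). M > 0 \<and> (\<forall>i<c. real M * p i \<in> \<int>) \<and>
    (\<forall>x\<in>?R. (\<Sum>i<c. p i * of_int (x i)) \<in> \<int>) \<and> (\<Sum>i<c. p i * of_int (coords g i)) \<notin> \<int>"
  proof (rule sublattice_separating_functional)
    show "(\<lambda>_. 0) \<in> ?R" using monomial_zero[OF a] by simp
    show "coords g \<notin> ?R" using coords[OF assms(4)] assms(5) by auto
    show "(\<lambda>i. x i - y i) \<in> ?R" if "x \<in> ?R" "y \<in> ?R" for x y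
      using that monomial_diff[OF a, of x y] by simp
  qed (use coords[OF assms(4)] in auto)
  then obtain p :: "nat \<Rightarrow> real" and M :: nat where M: "M > 0" "\<forall>i<c. real M * p i \<in> \<int>"
    and pR: "\<forall>x\<in>?R. (\<Sum>i<c. p i * of_int (x i)) \<in> \<int>" and pg: "(\<Sum>i<c. p i * of_int (coords g i)) \<notin> \<int>" by blast
  define t where "t l = (\<Sum>i<c. p i * of_int (l i :: int))" for l
  define \<chi> where "\<chi> x = (if x \<in> carrier G then cis (2 * pi * t (coords x)) else 1)" for x
  have hom: "\<chi> (x \<otimes> y) = \<chi> x * \<chi> y" if "x \<in> carrier G" "y \<in> carrier G" for x y
  proof -
    have xy: "x \<otimes> y \<in> carrier G" using that by simp
    let ?l = "\<lambda>i. coords (x \<otimes> y) i - (coords x i + coords y i)"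
    have "monomial G c a ?l = (x \<otimes> y) \<otimes> inv (x \<otimes> y)"
      using coords[OF that(1)] coords[OF that(2)] coords[OF xy] by (simp add: monomial_diff[OF a] monomial_add[OF a])
    then have lR: "?l \<in> ?R" using coords[OF that(1)] coords[OF that(2)] coords[OF xy] xy by simp
    have "t ?l \<in> \<int>" unfolding t_def by (rule bspec[OF pR lR])
    moreover have "t ?l = t (coords (x \<otimes> y)) - (t (coords x) + t (coords y))"
      by (simp add: t_def sum_subtractf sum.distrib algebra_simps)
    ultimately have "cis (2 * pi * (t (coords (x \<otimes> y)) - (t (coords x) + t (coords y)))) = 1"
      by (simp add: cis_2pi_eq_1)
    then have "cis (2 * pi * t (coords (x \<otimes> y)) - 2 * pi * (t (coords x) + t (coords y))) = 1"
      by (simp add: algebra_simps)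
    then have "cis (2 * pi * t (coords (x \<otimes> y))) = cis (2 * pi * (t (coords x) + t (coords y)))"
      by (simp add: cis_divide[symmetric] )
    then show ?thesis using that xy by (simp add: \<chi>_def cis_mult algebra_simps)
  qed
  have "\<chi> x ^ M = 1" for x
  proof (cases "x \<in> carrier G")
    case True
    have "real M * t (coords x) = (\<Sum>i<c. (real M * p i) * of_int (coords x i))"
      by (simp add: t_def sum_distrib_left mult.assoc)
    also have "\<dots> \<in> \<int>"
    proof (rule Ints_sum)
      fix i assume "i \<in> {..<c}"
      then have "real M * p i \<in> \<int>" using M(2) by simp
      from Ints_mult[OF this Ints_of_int] show "(real M * p i) * of_int (coords x i) \<in> \<int>" .
    qed
    finally have "cis (2 * pi * (real M * t (coords x))) = 1" by (simp only: cis_2pi_eq_1)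
    then show ?thesis using True by (simp add: \<chi>_def DeMoivre algebra_simps)
  qed (simp add: \<chi>_def)
  then have "\<chi> \<in> root_characters G M" using hom unfolding root_characters_def by (simp add: \<chi>_def)
  moreover have "\<chi> g \<noteq> 1" using pg assms(4) unfolding \<chi>_def t_def by (simp add: cis_2pi_eq_1)
  ultimately show ?thesis using M(1) by blast
qed

text \<open>Finiteness is the substantial point: a character is determined by its values on the
  finitely many generators, and these are \<open>M\<close>-th roots of unity.\<close>

lemma root_characters_dual_family:
  assumes "M > 0" "finite B" "B \<subseteq> carrier G" "generate G B = carrier G"
  shows "dual_family G (root_characters G M)"
proof unfold_locales
  have norm: "norm (\<chi> x) = 1" if "\<chi> \<in> root_characters G M" for \<chi> x
  proof -
    have "\<chi> x ^ M = 1" using that unfolding root_characters_def by blast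
    then have "norm (\<chi> x) ^ M = 1 ^ M" by (metis norm_one norm_power power_one)
    then show ?thesis by (rule power_eq_imp_eq_base[OF _ _ _ assms(1)]) auto
  qed
  have char1: "\<chi> \<one> = 1" if "\<chi> \<in> root_characters G M" for \<chi>
  proof -
    have "\<chi> (\<one> \<otimes> \<one>) = \<chi> \<one> * \<chi> \<one>" using that unfolding root_characters_def by blast
    then show ?thesis using norm[OF that, of \<one>] by auto
  qed
  show "norm (\<chi> x) = 1" if "\<chi> \<in> root_characters G M" for \<chi> x by (rule norm[OF that])
  let ?U = "{z :: complex. z ^ M = 1}"
  have "inj_on (\<lambda>\<chi>. restrict \<chi> B) (root_characters G M)"
  proof (rule inj_onI, rule ext)
    fix \<chi> \<psi> x assume X: "\<chi> \<in> root_characters G M" "\<psi> \<in> root_characters G M" and eq: "restrict \<chi> B = restrict \<psi> B"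
    have B: "\<chi> b = \<psi> b" if "b \<in> B" for b using fun_cong[OF eq, of b] that by simp
    have hom: "\<phi> (y \<otimes> z) = \<phi> y * \<phi> z" if "y \<in> carrier G" "z \<in> carrier G" "\<phi> \<in> root_characters G M" for y z \<phi>
      using that unfolding root_characters_def by blast
    show "\<chi> x = \<psi> x"
    proof (cases "x \<in> carrier G")
      case False
      then show ?thesis using X unfolding root_characters_def by simp
    next
      case True
      then have "x \<in> generate G B" using assms(4) by simp
      then show ?thesis
      proof (induction rule: generate.induct)
        case one
        show ?case using char1[OF X(1)] char1[OF X(2)] by simp
      next
        case (incl h)
        then show ?case by (rule B)
      next
        case (inv h)
        have h: "h \<in> carrier G" using inv assms(3) by blast
        have "\<chi> h * \<chi> (inv h) = \<psi> h * \<psi> (inv h)"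
          using hom[OF h, of "inv h" \<chi>] hom[OF h, of "inv h" \<psi>] h X char1[OF X(1)] char1[OF X(2)] by simp
        then show ?case using B[OF inv] norm[OF X(2), of h] by auto
      next
        case (eng h1 h2)
        then have "h1 \<in> carrier G" "h2 \<in> carrier G" using assms(4) by auto
        then show ?case using hom[of h1 h2 \<chi>] hom[of h1 h2 \<psi>] X eng.IH by simp
      qed
    qed
  qed
  moreover have "(\<lambda>\<chi>. restrict \<chi> B) ` root_characters G M \<subseteq> (\<Pi>\<^sub>E b\<in>B. ?U)"
    unfolding root_characters_def by auto
  moreover have "finite (\<Pi>\<^sub>E b\<in>B. ?U)"
    using assms(1,2) by (intro finite_PiE finite_roots_unity) auto
  ultimately show "finite (root_characters G M)" using inj_on_finite by blast
  have "(\<lambda>_. 1) \<in> root_characters G M" unfolding root_characters_def by simp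
  then show "root_characters G M \<noteq> {}" by blast
  show "(\<lambda>x. cnj (\<chi> x)) \<in> root_characters G M" if "\<chi> \<in> root_characters G M" for \<chi>
    using that unfolding root_characters_def by (auto simp: complex_cnj_power[symmetric] simp del: complex_cnj_power)
qed (auto simp: root_characters_def power_mult_distrib)

text \<open>Each pair of points brings its own order. The product of these orders is a common
  exponent, and \<open>root_characters\<close> grows along divisibility of the exponent.\<close>

lemma ex_separating_dual_family:
  assumes "finite B" "B \<subseteq> carrier G" "generate G B = carrier G" "finite S" "S \<subseteq> carrier G"
  shows "\<exists>\<Xi>. dual_family G \<Xi> \<and> dual_family.separates \<Xi> S"
proof -
  let ?P = "{p \<in> S \<times> S. fst p \<noteq> snd p}"
  have "\<forall>p\<in>?P. \<exists>M. M > 0 \<and> (\<exists>\<chi>\<in>root_characters G M. \<chi> (fst p) \<noteq> \<chi> (snd p))"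
  proof
    fix p assume p: "p \<in> ?P"
    define x y where "x = fst p" and "y = snd p"
    have xy: "x \<in> carrier G" "y \<in> carrier G" "x \<noteq> y" using p assms(5) by (auto simp: x_def y_def)
    have "x \<otimes> inv y \<noteq> \<one>" using xy by (metis inv_equality inv_inv inv_closed)
    then obtain M \<chi> where M: "M > 0" "\<chi> \<in> root_characters G M" "\<chi> (x \<otimes> inv y) \<noteq> 1"
      using ex_root_character[OF assms(1-3), of "x \<otimes> inv y"] xy by auto
    interpret dual_family G "root_characters G M" by (rule root_characters_dual_family[OF M(1) assms(1-3)])
    have "\<chi> x \<noteq> \<chi> y" using M(3) char_mult[OF M(2), of x "inv y"] xy char_inv[OF M(2), of y] char_mult_cnj[OF M(2), of y]
      by auto
    then show "\<exists>M. M > 0 \<and> (\<exists>\<chi>\<in>root_characters G M. \<chi> (fst p) \<noteq> \<chi> (snd p))"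
      using M unfolding x_def y_def by blast
  qed
  from bchoice[OF this] obtain f where
    f: "\<forall>p\<in>?P. f p > 0 \<and> (\<exists>\<chi>\<in>root_characters G (f p). \<chi> (fst p) \<noteq> \<chi> (snd p))" by blast
  have fP: "finite ?P" using assms(4) by simp
  define M where "M = (\<Prod>p\<in>?P. f p)"
  have M: "M > 0" unfolding M_def using f by (intro prod_pos) blast
  interpret D: dual_family G "root_characters G M" by (rule root_characters_dual_family[OF M assms(1-3)])
  have "D.separates S" unfolding D.separates_def
  proof (intro ballI impI, rule ccontr)
    fix x y assume xy: "x \<in> S" "y \<in> S" "\<forall>\<chi>\<in>root_characters G M. \<chi> x = \<chi> y" "x \<noteq> y"
    then have p: "(x, y) \<in> ?P" by simp
    obtain \<chi> where \<chi>: "\<chi> \<in> root_characters G (f (x, y))" "\<chi> x \<noteq> \<chi> y" using bspec[OF f p] by auto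
    have "f (x, y) dvd M" unfolding M_def using dvd_prodI[OF fP p, of f] .
    then obtain k where "M = f (x, y) * k" by (elim dvdE)
    then have "\<chi> \<in> root_characters G M" using \<chi>(1) unfolding root_characters_def by (simp add: power_mult)
    then show False using \<chi>(2) xy(3) by blast
  qed
  then show ?thesis using D.dual_family_axioms by blast
qed

end

text \<open>The order of quantifiers is the content: \<open>n\<close> precedes the group. The scale
  \<open>N\<close> does depend on the group, but it is at most \<open>N0\<close>, which bounds the
  number of characters.\<close>

lemma bohr_constant:
  assumes "m \<ge> 4"
  shows "\<exists>n. \<forall>(G :: ('a, 'b) monoid_scheme) A X. approximate_subgroup G A X r \<longrightarrow> generate G A = carrier G \<longrightarrow>
    (\<exists>S. finite S \<and> card S \<le> n \<and> (\<forall>\<chi>\<in>S. unit_character G \<chi>) \<and>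
      (\<forall>x\<in>set_power G A m. (\<forall>\<chi>\<in>S. norm (\<chi> x - 1) \<le> 1 / 4) \<longrightarrow> x \<in> set_power G A 4))"
proof (cases "r = 0")
  \<comment> \<open>The covering set of an approximate subgroup is nonempty, so the claim is
    vacuous; the case is split off because the growth excess divides by \<open>r\<close>.\<close>
  case True
  have "\<not> approximate_subgroup G A X r" for G :: "('a, 'b) monoid_scheme" and A X
    using approximate_subgroup.r_pos[of G A X r] True by auto
  then show ?thesis by (intro exI[of _ 0] allI impI) simp
next
  case False
  then have "1 / (512 * (real m)\<^sup>2 * real r ^ 3) > 0" using assms by simp
  from polynomial_growth_pigeonhole[OF this, of r] obtain N0 where
    N0: "\<forall>f :: nat \<Rightarrow> real. 0 < f 1 \<longrightarrow> (\<forall>n. f (Suc n) \<le> real (Suc n) ^ r * f 1) \<longrightarrow>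
      (\<exists>N\<le>N0. 1 \<le> N \<and> f (N + 2) \<le> (1 + 1 / (512 * (real m)\<^sup>2 * real r ^ 3)) * f N)" by blast
  show ?thesis
  proof (intro exI[of _ "32 * r * N0 ^ r"] allI impI)
    fix G :: "('a, 'b) monoid_scheme" and A X
    assume "approximate_subgroup G A X r" and gen: "generate G A = carrier G"
    then interpret approximate_subgroup G A X r by simp
    define f where "f n = real (card (set_power G A n))" for n
    have f1: "f 1 = real (card A)" unfolding f_def using set_power_1[OF A_carrier] by simp
    have "\<exists>N\<le>N0. 1 \<le> N \<and> f (N + 2) \<le> (1 + 1 / (512 * (real m)\<^sup>2 * real r ^ 3)) * f N"
    proof (rule N0[rule_format])
      show "0 < f 1" using A_nonempty f1 by simp
      show "f (Suc n) \<le> real (Suc n) ^ r * f 1" for n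
        using growth[of n] unfolding f1 unfolding f_def of_nat_power[symmetric] of_nat_mult[symmetric] of_nat_le_iff .
    qed
    then obtain N where N: "N \<le> N0" "1 \<le> N" "f (N + 2) \<le> (1 + 1 / (512 * (real m)\<^sup>2 * real r ^ 3)) * f N" by blast
    \<comment> \<open>The dual family is chosen only after \<open>N\<close>, since a power depending
      on \<open>N\<close> has to be separated. The size of the family is uncontrolled; that of
      \<open>S\<close> is what must be uniform.\<close>
    obtain \<Xi> where \<Xi>: "dual_family G \<Xi>" "dual_family.separates \<Xi> (set_power G A (N + 2 + m))"
      using ex_separating_dual_family[OF finite_A A_carrier gen finite_set_power[OF finite_A] set_power_closed[OF A_carrier]]
      by blast
    interpret dual_family G \<Xi> by (rule \<Xi>(1))
    interpret approximate_subgroup_dual G A X r \<Xi> by unfold_locales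
    obtain S where S: "S \<subseteq> \<Xi>" "card S \<le> 32 * r * N ^ r"
      "\<forall>x\<in>set_power G A m. (\<forall>\<chi>\<in>S. norm (\<chi> x - 1) \<le> 1 / 4) \<longrightarrow> x \<in> set_power G A 4"
      using bohr_set_in_set_power_4[OF assms N(2) N(3)[unfolded f_def] \<Xi>(2)] by auto
    have "32 * r * N ^ r \<le> 32 * r * N0 ^ r" using N(1) by (intro mult_left_mono power_mono) auto
    then have "card S \<le> 32 * r * N0 ^ r" using S(2) by (rule order_trans[rotated])
    moreover have "\<forall>\<chi>\<in>S. unit_character G \<chi>" using S(1) char_mult norm_char unfolding unit_character_def by blast
    ultimately show "\<exists>S. finite S \<and> card S \<le> 32 * r * N0 ^ r \<and> (\<forall>\<chi>\<in>S. unit_character G \<chi>) \<and>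
      (\<forall>x\<in>set_power G A m. (\<forall>\<chi>\<in>S. norm (\<chi> x - 1) \<le> 1 / 4) \<longrightarrow> x \<in> set_power G A 4)"
      using S finite_subset[OF S(1) finite_dual] by (intro exI[of _ S]) auto
  qed
qed

section \<open>Rank reduction\<close>

lemma initial_coset_progression:
  "\<exists>d0 k0. \<forall>(G :: ('a, 'b) monoid_scheme) A X. approximate_subgroup G A X r \<longrightarrow> generate G A = carrier G \<longrightarrow>
    (\<exists>H d u L. d \<le> d0 \<and> is_coset_progression G H d u L \<and>
      A \<subseteq> coset_progression G H d u L \<and> coset_progression G H d u L \<subseteq> set_power G A k0)"
proof -
  have eight: "(4 :: nat) \<le> 8" by simp
  obtain n where n: "\<forall>(G :: ('a, 'b) monoid_scheme) A X. approximate_subgroup G A X r \<longrightarrow> generate G A = carrier G \<longrightarrow>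
    (\<exists>S. finite S \<and> card S \<le> n \<and> (\<forall>\<chi>\<in>S. unit_character G \<chi>) \<and>
      (\<forall>x\<in>set_power G A 8. (\<forall>\<chi>\<in>S. norm (\<chi> x - 1) \<le> 1 / 4) \<longrightarrow> x \<in> set_power G A 4))"
    using bohr_constant[of 8 r, where 'a = 'a and 'b = 'b, OF eight] by (elim exE) (rule that)
  let ?w = "\<lambda>s::nat. (64 * 16 ^ s + 1) ^ s :: nat"
  show ?thesis
  proof (rule exI[of _ "n + ?w n"], rule exI[of _ "8 + ?w n"], intro allI impI)
    fix G :: "('a, 'b) monoid_scheme" and A X
    assume AX: "approximate_subgroup G A X r" and gen: "generate G A = carrier G"
    then interpret approximate_subgroup G A X r by simp
    obtain S where S: "finite S" "card S \<le> n" "\<forall>\<chi>\<in>S. unit_character G \<chi>"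
      "\<forall>x\<in>set_power G A 8. (\<forall>\<chi>\<in>S. norm (\<chi> x - 1) \<le> 1 / 4) \<longrightarrow> x \<in> set_power G A 4"
      using n[rule_format, OF AX gen] by (elim exE conjE) (rule that)
    interpret bohr_neighbourhood G A S
      by unfold_locales (use S A_carrier finite_A one_A inv_A in auto)
    have w: "?w (card S) \<le> ?w n"
    proof -
      have "?w (card S) \<le> (64 * 16 ^ n + 1) ^ card S" using S(2) by (intro power_mono) (auto intro: power_increasing)
      also have "\<dots> \<le> ?w n" using S(2) by (intro power_increasing) auto
      finally show ?thesis .
    qed
    obtain d u L where P: "d \<le> card S + ?w (card S)" "is_coset_progression G H d u L"
      "A \<subseteq> coset_progression G H d u L" "coset_progression G H d u L \<subseteq> set_power G A (8 + ?w (card S))"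
      using ex_coset_progression by (elim exE conjE) (rule that)
    have "coset_progression G H d u L \<subseteq> set_power G A (8 + ?w n)"
      using P(4) set_power_mono[OF A_carrier one_A, of "8 + ?w (card S)" "8 + ?w n"] w by simp
    moreover have "d \<le> n + ?w n" using P(1) S(2) w by linarith
    ultimately show "\<exists>H d u L. d \<le> n + ?w n \<and> is_coset_progression G H d u L \<and>
      A \<subseteq> coset_progression G H d u L \<and> coset_progression G H d u L \<subseteq> set_power G A (8 + ?w n)"
      using P(2,3) by (intro exI[of _ H] exI[of _ d] exI[of _ u] exI[of _ L] conjI)
  qed
qed

context comm_group
begin

section \<open>Boxes of exponents inside powers of a coset progression\<close>

lemma is_coset_progressionD:
  assumes "is_coset_progression G H d u L"
  shows "subgroup H G" "finite H" "u \<in> {..<d} \<rightarrow> carrier G" "i < d \<Longrightarrow> 0 < L i"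
  using assms unfolding is_coset_progression_def by auto

lemma monomial_box_in_set_power:
  assumes P: "is_coset_progression G H d u L" and l: "\<forall>i<d. \<bar>l i\<bar> \<le> int (C * L i)"
  shows "monomial G d u l \<in> set_power G (coset_progression G H d u L) C"
  using l
proof (induction C arbitrary: l)
  case 0
  have u: "u \<in> {..<d} \<rightarrow> carrier G" by (rule is_coset_progressionD(3)[OF P])
  have "monomial G d u l = monomial G d u (\<lambda>_. 0)" by (rule monomial_cong) (use u 0 in auto)
  then show ?case using monomial_zero[OF u] by simp
next
  case (Suc C)
  have u: "u \<in> {..<d} \<rightarrow> carrier G" by (rule is_coset_progressionD(3)[OF P])
  \<comment> \<open>Clipping every coordinate to the original box takes one \<open>L i\<close> off
    whatever exceeds it.\<close>
  define q where "q i = (if l i > int (L i) then int (L i) else if l i < - int (L i) then - int (L i) else l i)" for i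
  have q: "\<forall>i<d. \<bar>q i\<bar> \<le> int (L i)" by (auto simp: q_def)
  have "\<forall>i<d. \<bar>l i - q i\<bar> \<le> int (C * L i)"
  proof (intro allI impI)
    fix i assume "i < d"
    then have "\<bar>l i\<bar> \<le> int (C * L i) + int (L i)" using Suc.prems[rule_format, OF \<open>i < d\<close>] by (simp add: algebra_simps)
    moreover have "0 \<le> int (C * L i)" by simp
    ultimately show "\<bar>l i - q i\<bar> \<le> int (C * L i)" unfolding q_def by (auto split: if_splits)
  qed
  then have "monomial G d u (\<lambda>i. l i - q i) \<in> set_power G (coset_progression G H d u L) C" by (rule Suc.IH)
  moreover have "monomial G d u q \<in> coset_progression G H d u L"
    unfolding mem_coset_progression[OF u]
    using q subgroup.one_closed[OF is_coset_progressionD(1)[OF P]] monomial_closed[OF u, of q]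
    by (intro bexI[of _ \<one>] exI[of _ q]) auto
  ultimately have "monomial G d u (\<lambda>i. l i - q i) \<otimes> monomial G d u q \<in> set_power G (coset_progression G H d u L) (Suc C)"
    by (rule set_power_Suc_memI)
  then show ?case using monomial_add[OF u, of "\<lambda>i. l i - q i" q] by simp
qed

lemma coset_box_in_set_power:
  assumes P: "is_coset_progression G H d u L" and l: "\<forall>i<d. \<bar>l i\<bar> \<le> int (C * L i)" and h: "h \<in> H"
  shows "h \<otimes> monomial G d u l \<in> set_power G (coset_progression G H d u L) (Suc C)"
proof -
  note PD = is_coset_progressionD[OF P]
  have hc: "h \<in> carrier G" using subgroup.mem_carrier[OF PD(1) h] .
  have "h \<in> coset_progression G H d u L"
    unfolding mem_coset_progression[OF PD(3)]
    using h hc monomial_zero[OF PD(3)] by (intro bexI[of _ h] exI[of _ "\<lambda>_. 0"]) auto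
  then have "monomial G d u l \<otimes> h \<in> set_power G (coset_progression G H d u L) (Suc C)"
    by (rule set_power_Suc_memI[OF monomial_box_in_set_power[OF P l]])
  then show ?thesis using m_comm[OF hc monomial_closed[OF PD(3)]] by simp
qed

text \<open>The multiples of the relation \<open>l\<close> are absorbed into \<open>H\<close>. What remains is the projection of the box along
  \<open>l\<close> to the coordinates other than the one with the largest ratio of \<open>l i\<close> to \<open>L i\<close>; in the rescaled
  coordinates this projection at most doubles lengths.\<close>

lemma rank_reduction:
  assumes P: "is_coset_progression G H d u L" and "d \<le> n"
    and l: "\<forall>i<d. \<bar>l i\<bar> \<le> int (M * L i)" and rel: "monomial G d u l \<in> H" and nz: "\<exists>i<d. l i \<noteq> 0"
  shows "\<exists>H' d' u' L'. d' < d \<and> is_coset_progression G H' d' u' L' \<and>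
    coset_progression G H d u L \<subseteq> coset_progression G H' d' u' L' \<and>
    coset_progression G H' d' u' L' \<subseteq> set_power G (coset_progression G H d u L) (Suc (2 * 16 ^ n + 2 * M))"
proof -
  note PD = is_coset_progressionD[OF P]
  note u = PD(3)
  \<comment> \<open>Eliminating the coordinate of largest ratio ensures that, for a point of the
    box, the multiple of \<open>l\<close> removed by the projection exceeds the box in no
    coordinate.\<close>
  define ratio where "ratio i = \<bar>real_of_int (l i)\<bar> / real (L i)" for i
  obtain i\<^sub>1 where i1: "i\<^sub>1 < d" "l i\<^sub>1 \<noteq> 0" using nz by blast
  have "\<exists>i\<in>{..<d}. \<forall>j\<in>{..<d}. ratio j \<le> ratio i"
    using i1(1) by (intro bexI[of _ "arg_min_on (\<lambda>i. - ratio i) {..<d}"])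
      (auto intro: arg_min_least[of "{..<d}" _ "\<lambda>i. - ratio i", simplified] arg_min_if_finite(1)[of "{..<d}" "\<lambda>i. - ratio i", simplified])
  then obtain i\<^sub>0 where i0: "i\<^sub>0 < d" "\<And>j. j < d \<Longrightarrow> ratio j \<le> ratio i\<^sub>0" by auto
  have "ratio i\<^sub>1 > 0" using i1 PD(4) by (simp add: ratio_def)
  then have l0: "l i\<^sub>0 \<noteq> 0" using i0(2)[OF i1(1)] by (auto simp: ratio_def)
  have L0: "real (L i) > 0" if "i < d" for i using PD(4) that by simp
  define I where "I = {..<d} - {i\<^sub>0}"
  have cI: "card I = d - 1" "finite I" using i0(1) by (auto simp: I_def)
  \<comment> \<open>Points of the box have rescaled projections of size at most 2. Division by
    \<open>C\<close> turns this into \<open>(1 / 16) ^ n\<close>, which is within the radius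
    \<open>(1 / 16) ^ card I\<close> covered by \<open>local_subgroup_progression\<close>.\<close>
  define C :: real where "C = 2 * 16 ^ n"
  have C0: "C > 0" by (simp add: C_def)
  define p where "p x j = (if j \<in> I then (of_int (x j) - of_int (l j) * (of_int (x i\<^sub>0) / of_int (l i\<^sub>0))) / real (L j) else 0)"
    for x :: "nat \<Rightarrow> int" and j :: nat
  have p_lin: "p (\<lambda>i. x i + a * y i) j = p x j + of_int a * p y j" for x a y j
  proof (cases "j \<in> I")
    case True
    then have "real (L j) \<noteq> 0" using L0[of j] by (simp add: I_def)
    then show ?thesis using True l0 by (simp add: p_def field_simps)
  qed (simp add: p_def)
  have p_diff: "p (\<lambda>i. x i - y i) j = p x j - p y j" for x y j
    using p_lin[of x "-1" y j] by simp
  have p_sum: "p (\<lambda>i. \<Sum>k<e. a k * z k i) j = (\<Sum>k<e. of_int (a k) * p (z k) j)" for e :: nat and a z j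
  proof (induction e)
    case 0
    show ?case by (simp add: p_def)
  next
    case (Suc e)
    then show ?case using p_lin[of "\<lambda>i. \<Sum>k<e. a k * z k i" "a e" "z e" j] by simp
  qed
  have p_0: "p (\<lambda>_. 0) j = 0" for j by (simp add: p_def)
  have p_l: "p (\<lambda>i. t * l i) j = 0" for t j using l0 by (simp add: p_def)
  have p_cong: "p x = p y" if "\<And>i. i < d \<Longrightarrow> x i = y i" for x y
    using that i0(1) by (auto simp: p_def I_def fun_eq_iff)
  have p_zero: "x j * l i\<^sub>0 = l j * x i\<^sub>0" if "p x j = 0" "j < d" for x j
  proof (cases "j = i\<^sub>0")
    case False
    then have "of_int (x j) - of_int (l j) * (of_int (x i\<^sub>0) / of_int (l i\<^sub>0)) = (0 :: real)"
      using that L0[OF that(2)] by (simp add: p_def I_def)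
    then have "of_int (x j) * of_int (l i\<^sub>0) = (of_int (l j) * of_int (x i\<^sub>0) :: real)" using l0 by (simp add: field_simps)
    then show ?thesis by (simp only: of_int_mult[symmetric] of_int_eq_iff)
  qed (simp add: mult.commute)
  \<comment> \<open>Reduction modulo \<open>l\<close> bounds the eliminated coordinate. It leaves
    the projection alone and changes the monomial only by an element of \<open>H\<close>.\<close>
  define red where "red x i = x i - (x i\<^sub>0 div l i\<^sub>0) * l i" for x i
  have red0: "\<bar>red x i\<^sub>0\<bar> \<le> \<bar>l i\<^sub>0\<bar>" for x
  proof -
    have "red x i\<^sub>0 = x i\<^sub>0 mod l i\<^sub>0" by (simp add: red_def minus_div_mult_eq_mod)
    then show ?thesis using abs_mod_less[OF l0, of "x i\<^sub>0"] by simp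
  qed
  have p_red: "p (red x) = p x" for x
    unfolding red_def by (rule ext) (simp only: p_diff p_l diff_zero)
  have red_box: "\<bar>red x j\<bar> \<le> int ((2 * 16 ^ n + M) * L j)" if px: "\<forall>j\<in>I. \<bar>p x j\<bar> \<le> C" and j: "j < d" for x j
  proof (cases "j = i\<^sub>0")
    case True
    have "\<bar>red x j\<bar> \<le> int (M * L j)" using red0[of x] l i0(1) True by fastforce
    also have "\<dots> \<le> int ((2 * 16 ^ n + M) * L j)" by (simp add: algebra_simps)
    finally show ?thesis .
  next
    case False
    then have jI: "j \<in> I" using j by (simp add: I_def)
    define q where "q = real_of_int (red x i\<^sub>0) / of_int (l i\<^sub>0)"
    have "\<bar>real_of_int (red x i\<^sub>0)\<bar> \<le> \<bar>of_int (l i\<^sub>0)\<bar>" using red0[of x] by linarith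
    then have q: "\<bar>q\<bar> \<le> 1" using l0 by (simp add: q_def abs_divide)
    have "p (red x) j * real (L j) = of_int (red x j) - of_int (l j) * q"
      using L0[OF j] jI by (simp add: p_def q_def)
    then have e: "of_int (red x j) = p x j * real (L j) + of_int (l j) * q" by (simp add: p_red)
    have "\<bar>p x j * real (L j)\<bar> \<le> C * real (L j)"
      using px jI by (simp add: abs_mult mult_right_mono)
    moreover have "\<bar>of_int (l j) * q\<bar> \<le> real (M * L j)"
    proof -
      have "\<bar>of_int (l j) * q\<bar> = \<bar>of_int (l j)\<bar> * \<bar>q\<bar>" by (simp add: abs_mult)
      also have "\<dots> \<le> \<bar>of_int (l j)\<bar> * 1" using q by (intro mult_left_mono) auto
      also have "\<dots> \<le> real (M * L j)" using l j by (metis mult.right_neutral of_int_abs of_int_le_iff of_int_of_nat_eq)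
      finally show ?thesis .
    qed
    ultimately have "\<bar>real_of_int (red x j)\<bar> \<le> C * real (L j) + real (M * L j)" unfolding e by linarith
    also have "\<dots> = real ((2 * 16 ^ n + M) * L j)" by (simp add: C_def algebra_simps)
    finally have "real_of_int \<bar>red x j\<bar> \<le> real_of_int (int ((2 * 16 ^ n + M) * L j))" by simp
    then show ?thesis by (simp only: of_int_le_iff)
  qed
  have mon_red: "monomial G d u x = monomial G d u (red x) \<otimes> monomial G d u l [^] (x i\<^sub>0 div l i\<^sub>0)" for x
  proof -
    have "monomial G d u x = monomial G d u (\<lambda>i. red x i + (x i\<^sub>0 div l i\<^sub>0) * l i)" by (simp add: red_def)
    then show ?thesis by (simp only: monomial_add[OF u] monomial_mult[OF u])
  qed
  have relH: "monomial G d u l [^] t \<in> H" for t :: int by (rule subgroup_int_pow_closed[OF PD(1) rel])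
  define E where "E = {e. \<exists>x. e = (\<lambda>j. p x j / C) \<and> (\<forall>j\<in>I. \<bar>p x j / C\<bar> \<le> 1)}"
  have E_bound: "\<forall>j\<in>I. \<bar>p x j\<bar> \<le> C" if "\<forall>j\<in>I. \<bar>p x j / C\<bar> \<le> 1" for x
    using that C0 by (simp add: abs_divide)
  have "\<exists>e v N s. progression_cover I E e v N s"
  proof (rule local_subgroup_progression[OF cI(2)])
    let ?B = "\<Pi>\<^sub>E j\<in>{..<d}. {- int ((2 * 16 ^ n + M) * L j)..int ((2 * 16 ^ n + M) * L j)}"
    have "E \<subseteq> (\<lambda>x j. p x j / C) ` ?B"
    proof
      fix e assume "e \<in> E"
      then obtain x where x: "e = (\<lambda>j. p x j / C)" "\<forall>j\<in>I. \<bar>p x j / C\<bar> \<le> 1" unfolding E_def by blast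
      let ?y = "restrict (red x) {..<d}"
      have "p ?y = p (red x)" by (rule p_cong) simp
      then have "e = (\<lambda>j. p ?y j / C)" using x(1) p_red[of x] by simp
      moreover have "?y \<in> ?B"
      proof (rule restrict_PiE_iff[THEN iffD2], rule ballI)
        fix j assume "j \<in> {..<d}"
        then have "\<bar>red x j\<bar> \<le> int ((2 * 16 ^ n + M) * L j)" using red_box[OF E_bound[OF x(2)]] by simp
        then show "red x j \<in> {- int ((2 * 16 ^ n + M) * L j)..int ((2 * 16 ^ n + M) * L j)}"
          unfolding atLeastAtMost_iff by linarith
      qed
      ultimately show "e \<in> (\<lambda>x j. p x j / C) ` ?B" by (rule image_eqI)
    qed
    moreover have "finite ?B" by (intro finite_PiE) auto
    ultimately show "finite E" by (rule finite_surj[rotated])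
    show "(\<lambda>_. 0) \<in> E" unfolding E_def by (intro CollectI exI[of _ "\<lambda>_. 0"]) (simp add: p_0)
    show "x i = 0" if "x \<in> E" "i \<notin> I" for x i using that unfolding E_def by (auto simp: p_def)
    show "\<bar>x i\<bar> \<le> 1" if "x \<in> E" "i \<in> I" for x i using that unfolding E_def by auto
    fix e f assume ef: "e \<in> E" "f \<in> E" "\<forall>i\<in>I. \<bar>e i - f i\<bar> \<le> 1"
    obtain x where x: "e = (\<lambda>j. p x j / C)" using ef(1) unfolding E_def by blast
    obtain y where y: "f = (\<lambda>j. p y j / C)" using ef(2) unfolding E_def by blast
    have "(\<lambda>i. e i - f i) = (\<lambda>j. p (\<lambda>i. x i - y i) j / C)" unfolding x y by (simp add: p_diff diff_divide_distrib)
    moreover have "\<forall>j\<in>I. \<bar>p (\<lambda>i. x i - y i) j / C\<bar> \<le> 1"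
      using ef(3) unfolding x y by (simp add: p_diff diff_divide_distrib)
    ultimately show "(\<lambda>i. e i - f i) \<in> E" unfolding E_def by (intro CollectI exI[of _ "\<lambda>i. x i - y i"] conjI)
  qed
  then obtain e v N s where "progression_cover I E e v N s" by blast
  note Q = this[unfolded progression_cover_def]
  have "\<forall>k\<in>{..<e}. \<exists>x. v k = (\<lambda>j. p x j / C)"
  proof
    fix k assume "k \<in> {..<e}"
    then have "v k \<in> E" using Q by simp
    then show "\<exists>x. v k = (\<lambda>j. p x j / C)" unfolding E_def by blast
  qed
  from bchoice[OF this] obtain z where z: "\<And>k. k < e \<Longrightarrow> v k = (\<lambda>j. p (z k) j / C)" by auto
  have N0: "\<forall>k<e. 0 < N k" and tot: "(\<Sum>k<e. real (N k) * s k) \<le> 1"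
    and vs: "\<And>k i. k < e \<Longrightarrow> i \<in> I \<Longrightarrow> \<bar>v k i\<bar> \<le> s k" and e: "e < d" using Q cI(1) i0(1) by auto
  define u' where "u' k = monomial G d u (z k)" for k
  have u'c: "u' \<in> {..<e} \<rightarrow> carrier G" using monomial_closed[OF u] by (auto simp: u'_def)
  have mon': "monomial G e u' a = monomial G d u (\<lambda>i. \<Sum>k<e. a k * z k i)" for a
    unfolding u'_def by (rule monomial_monomial[OF u])
  \<comment> \<open>The kernel of the projection consists of the integer vectors parallel to
    \<open>l\<close>, which need not be multiples of \<open>l\<close>. Only multiples of
    \<open>l\<close> are known to land in \<open>H\<close>, so \<open>H\<close> is enlarged by the
    monomials of the whole kernel; it stays finite because these can be reduced modulo
    \<open>l\<close>.\<close>
  let ?K = "{y. \<forall>j<d. y j * l i\<^sub>0 = l j * y i\<^sub>0}"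
  define H' where "H' = {h \<otimes> monomial G d u y | h y. h \<in> H \<and> y \<in> ?K}"
  have H'I: "h \<otimes> monomial G d u y \<in> H'" if "h \<in> H" "y \<in> ?K" for h y
    unfolding H'_def using that by blast
  have Hc: "h \<in> carrier G" if "h \<in> H" for h using subgroup.mem_carrier[OF PD(1) that] .
  have K_red: "\<bar>red y j\<bar> \<le> \<bar>l j\<bar>" if "y \<in> ?K" "j < d" for y j
  proof -
    have "red y j * l i\<^sub>0 = l j * red y i\<^sub>0"
      using that by (simp add: red_def algebra_simps)
    then have "\<bar>red y j\<bar> * \<bar>l i\<^sub>0\<bar> = \<bar>l j\<bar> * \<bar>red y i\<^sub>0\<bar>" by (metis abs_mult)
    also have "\<dots> \<le> \<bar>l j\<bar> * \<bar>l i\<^sub>0\<bar>" using red0 by (intro mult_left_mono) auto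
    finally show ?thesis using l0 by simp
  qed
  have H'_red: "\<exists>h\<in>H. \<exists>y. (\<forall>j<d. \<bar>y j\<bar> \<le> \<bar>l j\<bar>) \<and> x = h \<otimes> monomial G d u y" if "x \<in> H'" for x
  proof -
    obtain h y where hy: "h \<in> H" "y \<in> ?K" "x = h \<otimes> monomial G d u y"
      using \<open>x \<in> H'\<close> unfolding H'_def by blast
    let ?t = "monomial G d u l [^] (y i\<^sub>0 div l i\<^sub>0)"
    have "x = h \<otimes> (?t \<otimes> monomial G d u (red y))"
      unfolding hy(3) mon_red[of y] using monomial_closed[OF u] by (simp add: m_comm)
    also have "\<dots> = (h \<otimes> ?t) \<otimes> monomial G d u (red y)"
      using Hc[OF hy(1)] monomial_closed[OF u] by (simp add: m_assoc)
    finally have x: "x = (h \<otimes> ?t) \<otimes> monomial G d u (red y)" .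
    have ht: "h \<otimes> ?t \<in> H" by (intro subgroup.m_closed[OF PD(1)] hy(1) relH)
    show ?thesis
      by (rule bexI[OF _ ht], rule exI[of _ "red y"]) (use x K_red[OF hy(2)] in blast)
  qed
  have H'sub: "subgroup H' G"
  proof (rule subgroup.intro)
    show "H' \<subseteq> carrier G" unfolding H'_def using Hc monomial_closed[OF u] by auto
    have "\<one> \<otimes> monomial G d u (\<lambda>_. 0) \<in> H'"
      by (intro H'I subgroup.one_closed[OF PD(1)]) simp
    then show "\<one> \<in> H'" using monomial_zero[OF u] by simp
  next
    fix x y assume "x \<in> H'" "y \<in> H'"
    then obtain h a g b where hy: "h \<in> H" "a \<in> ?K" "x = h \<otimes> monomial G d u a"
      "g \<in> H" "b \<in> ?K" "y = g \<otimes> monomial G d u b" unfolding H'_def by blast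
    have xy: "x \<otimes> y = (h \<otimes> g) \<otimes> monomial G d u (\<lambda>i. a i + b i)"
      unfolding hy(3,6) monomial_add[OF u] using Hc[OF hy(1)] Hc[OF hy(4)] monomial_closed[OF u]
      by (simp add: m_ac)
    show "x \<otimes> y \<in> H'" unfolding xy
      by (intro H'I subgroup.m_closed[OF PD(1)] hy(1,4)) (use hy(2,5) in \<open>simp add: algebra_simps\<close>)
  next
    fix x assume "x \<in> H'"
    then obtain h a where hy: "h \<in> H" "a \<in> ?K" "x = h \<otimes> monomial G d u a" unfolding H'_def by blast
    have ix: "inv x = inv h \<otimes> monomial G d u (\<lambda>i. - a i)"
      unfolding hy(3) monomial_minus[OF u] using Hc[OF hy(1)] monomial_closed[OF u] by (simp add: inv_mult)
    show "inv x \<in> H'" unfolding ix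
      by (intro H'I subgroup.m_inv_closed[OF PD(1)] hy(1)) (use hy(2) in simp)
  qed
  have "finite H'"
  proof -
    let ?B = "\<Pi>\<^sub>E j\<in>{..<d}. {- \<bar>l j\<bar>..\<bar>l j\<bar>}"
    have "H' \<subseteq> (\<lambda>(h, y). h \<otimes> monomial G d u y) ` (H \<times> ?B)"
    proof
      fix x assume "x \<in> H'"
      then obtain h y where hy: "h \<in> H" "\<forall>j<d. \<bar>y j\<bar> \<le> \<bar>l j\<bar>" "x = h \<otimes> monomial G d u y"
        using H'_red by blast
      have "monomial G d u y = monomial G d u (restrict y {..<d})" by (rule monomial_cong) (use u in auto)
      then have "x = (\<lambda>(h, y). h \<otimes> monomial G d u y) (h, restrict y {..<d})" using hy(3) by simp
      moreover have "(h, restrict y {..<d}) \<in> H \<times> ?B" using hy(1,2) by (auto simp: abs_le_iff)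
      ultimately show "x \<in> (\<lambda>(h, y). h \<otimes> monomial G d u y) ` (H \<times> ?B)" by (rule image_eqI)
    qed
    moreover have "finite (H \<times> ?B)" using PD(2) by (intro finite_cartesian_product finite_PiE) auto
    ultimately show ?thesis by (rule finite_surj[rotated])
  qed
  then have P': "is_coset_progression G H' e u' N"
    unfolding is_coset_progression_def using comm_group_axioms H'sub u'c N0 by auto
  have "coset_progression G H d u L \<subseteq> coset_progression G H' e u' N"
  proof
    fix x assume "x \<in> coset_progression G H d u L"
    then obtain h y where hy: "h \<in> H" "\<forall>i<d. \<bar>y i\<bar> \<le> int (L i)" "x = h \<otimes> monomial G d u y"
      unfolding mem_coset_progression[OF u] by (elim bexE exE conjE) (rule that)
    have yL: "\<bar>real_of_int (y i)\<bar> \<le> real (L i)" if "i < d" for i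
      using hy(2) that by (metis of_int_abs of_int_le_iff of_int_of_nat_eq)
    have p2: "\<bar>p y j\<bar> \<le> 2" if "j \<in> I" for j
    proof -
      have j: "j < d" using that by (simp add: I_def)
      have "\<bar>of_int (l j) * (of_int (y i\<^sub>0) / of_int (l i\<^sub>0)) / real (L j)\<bar> = ratio j * (\<bar>of_int (y i\<^sub>0)\<bar> / \<bar>of_int (l i\<^sub>0)\<bar>)"
        by (simp add: abs_mult ratio_def)
      also have "\<dots> \<le> ratio i\<^sub>0 * (\<bar>of_int (y i\<^sub>0)\<bar> / \<bar>of_int (l i\<^sub>0)\<bar>)"
        by (intro mult_right_mono i0(2)[OF j]) simp
      also have "\<dots> = \<bar>of_int (y i\<^sub>0)\<bar> / real (L i\<^sub>0)" using l0 by (simp add: ratio_def)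
      also have "\<dots> \<le> 1" using yL[OF i0(1)] L0[OF i0(1)] by simp
      finally have a: "\<bar>of_int (l j) * (of_int (y i\<^sub>0) / of_int (l i\<^sub>0)) / real (L j)\<bar> \<le> 1" .
      have b: "\<bar>of_int (y j) / real (L j)\<bar> \<le> 1" using yL[OF j] L0[OF j] by simp
      have "p y j = of_int (y j) / real (L j) - of_int (l j) * (of_int (y i\<^sub>0) / of_int (l i\<^sub>0)) / real (L j)"
        using that by (simp add: p_def diff_divide_distrib)
      then show ?thesis using a b by linarith
    qed
    have pw: "2 / C \<le> (1 / 16) ^ card I"
    proof -
      have "(1 / 16 :: real) ^ n \<le> (1 / 16) ^ card I"
        using cI(1) \<open>d \<le> n\<close> by (intro power_decreasing) auto
      then show ?thesis by (simp add: C_def power_one_over)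
    qed
    have small: "\<bar>p y j / C\<bar> \<le> (1 / 16) ^ card I" if "j \<in> I" for j
    proof -
      have "\<bar>p y j / C\<bar> \<le> 2 / C" using p2[OF that] C0 by (simp add: abs_divide divide_right_mono)
      then show ?thesis using pw by linarith
    qed
    have "(1 / 16 :: real) ^ card I \<le> 1" by (simp add: power_le_one)
    then have "\<forall>j\<in>I. \<bar>p y j / C\<bar> \<le> 1" using small by (meson order_trans)
    then have yE: "(\<lambda>j. p y j / C) \<in> E" unfolding E_def by (intro CollectI exI[of _ y] conjI refl)
    have "\<forall>i\<in>I. \<bar>p y i / C\<bar> \<le> (1 / 16) ^ card I" using small by simp
    then have "\<exists>a :: nat \<Rightarrow> int. (\<forall>k<e. \<bar>a k\<bar> \<le> int (N k)) \<and> (\<forall>i. p y i / C = (\<Sum>k<e. of_int (a k) * v k i))"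
      using Q[THEN conjunct2, THEN conjunct2, THEN conjunct2, rule_format, OF yE] by blast
    then obtain a where a: "\<forall>k<e. \<bar>a k\<bar> \<le> int (N k)" "\<And>i. p y i / C = (\<Sum>k<e. of_int (a k) * v k i)" by auto
    \<comment> \<open>The difference between \<open>y\<close> and the combination with the same
      projection lies in the kernel, so \<open>H'\<close> accounts for it.\<close>
    let ?w = "\<lambda>i. y i - (\<Sum>k<e. a k * z k i)"
    have "p ?w j = 0" for j
    proof -
      have "p y j / C = (\<Sum>k<e. of_int (a k) * p (z k) j) / C"
        unfolding a(2) sum_divide_distrib by (intro sum.cong refl) (simp add: z)
      then show ?thesis using C0 by (simp add: p_diff p_sum)
    qed
    then have wK: "?w \<in> ?K" using p_zero[of ?w] by blast
    have "x = (h \<otimes> monomial G d u ?w) \<otimes> monomial G e u' a"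
      unfolding hy(3) mon' using monomial_add[OF u, of ?w "\<lambda>i. \<Sum>k<e. a k * z k i"] Hc[OF hy(1)] monomial_closed[OF u]
      by (simp add: m_assoc)
    moreover have "h \<otimes> monomial G d u ?w \<in> H'"
      by (rule H'I[OF hy(1) wK])
    ultimately show "x \<in> coset_progression G H' e u' N"
      unfolding mem_coset_progression[OF u'c] using a(1)
      by (intro bexI[of _ "h \<otimes> monomial G d u ?w"] exI[of _ a] conjI)
  qed
  moreover have "coset_progression G H' e u' N \<subseteq> set_power G (coset_progression G H d u L) (Suc (2 * 16 ^ n + 2 * M))"
  proof
    fix x assume "x \<in> coset_progression G H' e u' N"
    then obtain h' a where ha: "h' \<in> H'" "\<forall>k<e. \<bar>a k\<bar> \<le> int (N k)" "x = h' \<otimes> monomial G e u' a"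
      unfolding mem_coset_progression[OF u'c] by (elim bexE exE conjE) (rule that)
    obtain h y where hy: "h \<in> H" "\<forall>j<d. \<bar>y j\<bar> \<le> \<bar>l j\<bar>" "h' = h \<otimes> monomial G d u y" using H'_red[OF ha(1)] by blast
    let ?X = "\<lambda>i. \<Sum>k<e. a k * z k i"
    have "\<bar>p ?X j / C\<bar> \<le> 1" if "j \<in> I" for j
    proof -
      have "p ?X j / C = (\<Sum>k<e. of_int (a k) * v k j)"
        unfolding p_sum sum_divide_distrib by (intro sum.cong refl) (simp add: z)
      also have "\<bar>\<dots>\<bar> \<le> (\<Sum>k<e. \<bar>of_int (a k) * v k j\<bar>)" by (rule sum_abs)
      also have "\<dots> \<le> (\<Sum>k<e. real (N k) * s k)"
      proof (rule sum_mono)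
        fix k assume k: "k \<in> {..<e}"
        then have "\<bar>a k\<bar> \<le> int (N k)" using ha(2) by simp
        then have "\<bar>real_of_int (a k)\<bar> \<le> real (N k)" by linarith
        then show "\<bar>of_int (a k) * v k j\<bar> \<le> real (N k) * s k"
          unfolding abs_mult using vs[of k j] k that by (intro mult_mono) auto
      qed
      finally show ?thesis using tot by linarith
    qed
    then have XC: "\<forall>j\<in>I. \<bar>p ?X j\<bar> \<le> C" by (intro E_bound) blast
    let ?t = "monomial G d u l [^] (?X i\<^sub>0 div l i\<^sub>0)"
    have "x = (h \<otimes> monomial G d u y) \<otimes> (monomial G d u (red ?X) \<otimes> ?t)"
      unfolding ha(3) hy(3) mon' mon_red[of ?X] ..
    also have "\<dots> = (h \<otimes> ?t) \<otimes> monomial G d u (\<lambda>i. y i + red ?X i)"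
      unfolding monomial_add[OF u] using Hc[OF hy(1)] monomial_closed[OF u] Hc[OF relH]
      by (simp add: m_ac)
    finally have x: "x = (h \<otimes> ?t) \<otimes> monomial G d u (\<lambda>i. y i + red ?X i)" .
    have ht: "h \<otimes> ?t \<in> H" by (intro subgroup.m_closed[OF PD(1)] hy(1) relH)
    \<comment> \<open>One \<open>M\<close> comes from the representative of \<open>H'\<close> and
      one from the reduction modulo \<open>l\<close>, while \<open>2 * 16 ^ n\<close> is the size of
      the projection. The factor in \<open>H\<close> adds the \<open>Suc\<close>.\<close>
    have "\<forall>i<d. \<bar>y i + red ?X i\<bar> \<le> int ((2 * 16 ^ n + 2 * M) * L i)"
    proof (intro allI impI)
      fix i assume i: "i < d"
      have "\<bar>y i\<bar> \<le> int (M * L i)" using hy(2) l i by (meson order_trans)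
      moreover have "\<bar>red ?X i\<bar> \<le> int ((2 * 16 ^ n + M) * L i)" by (rule red_box[OF XC i])
      ultimately have "\<bar>y i + red ?X i\<bar> \<le> int (M * L i) + int ((2 * 16 ^ n + M) * L i)" by linarith
      also have "\<dots> = int ((2 * 16 ^ n + 2 * M) * L i)" by (simp add: algebra_simps)
      finally show "\<bar>y i + red ?X i\<bar> \<le> int ((2 * 16 ^ n + 2 * M) * L i)" .
    qed
    then show "x \<in> set_power G (coset_progression G H d u L) (Suc (2 * 16 ^ n + 2 * M))"
      unfolding x by (rule coset_box_in_set_power[OF P _ ht])
  qed
  ultimately show ?thesis using e P'
    by (intro exI[of _ H'] exI[of _ e] exI[of _ u'] exI[of _ N] conjI)
qed

end

text \<open>Asking for properness \<open>k' + 6\<close>, where \<open>k'\<close> is the exponent reached so far, makes the coordinates of the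
  elements of \<open>A\<close> satisfy every relation of length \<open>k'\<close> exactly; the rank bound rests on this.\<close>

lemma ex_proper_coset_progression:
  "\<exists>k. \<forall>(G :: ('a, 'b) monoid_scheme) A H d u L. comm_group G \<longrightarrow> A \<subseteq> carrier G \<longrightarrow> \<one>\<^bsub>G\<^esub> \<in> A \<longrightarrow> d \<le> n \<longrightarrow>
    is_coset_progression G H d u L \<longrightarrow> A \<subseteq> coset_progression G H d u L \<longrightarrow>
    coset_progression G H d u L \<subseteq> set_power G A k0 \<longrightarrow>
    (\<exists>H d u L k'. k' \<le> k \<and> proper_coset_progression G (max m (real k' + 6)) H d u L \<and>
      A \<subseteq> coset_progression G H d u L \<and> coset_progression G H d u L \<subseteq> set_power G A k')"
proof (induction n arbitrary: k0)
  case 0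
  show ?case
  proof (intro exI[of _ k0] allI impI)
    fix G :: "('a, 'b) monoid_scheme" and A H d u L
    assume "comm_group G" and as: "d \<le> (0 :: nat)" "is_coset_progression G H d u L"
      "A \<subseteq> coset_progression G H d u L" "coset_progression G H d u L \<subseteq> set_power G A k0"
    then interpret comm_group G by simp
    have "proper_coset_progression G (max m (real k0 + 6)) H d u L"
      by (rule properI[OF as(2)]) (use as(1) in simp)
    then show "\<exists>H d u L k'. k' \<le> k0 \<and> proper_coset_progression G (max m (real k' + 6)) H d u L \<and>
      A \<subseteq> coset_progression G H d u L \<and> coset_progression G H d u L \<subseteq> set_power G A k'"
      using as(3,4)
      by (rule_tac exI[of _ H], rule_tac exI[of _ d], rule_tac exI[of _ u], rule_tac exI[of _ L], rule_tac exI[of _ k0]) auto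
  qed
next
  case (Suc n)
  define m0 where "m0 = max m (real k0 + 6)"
  \<comment> \<open>Twice \<open>m0\<close>, since a violation of properness is a relation in the
    doubled box.\<close>
  define M where "M = nat \<lceil>2 * m0\<rceil>"
  \<comment> \<open>The rank may be as large as \<open>Suc n\<close>, hence this power of 16. The
    next round starts from the exponent \<open>k1\<close>, so the induction must leave
    \<open>k0\<close> arbitrary.\<close>
  define k1 where "k1 = k0 * Suc (2 * 16 ^ Suc n + 2 * M)"
  obtain k where k: "\<forall>(G :: ('a, 'b) monoid_scheme) A H d u L. comm_group G \<longrightarrow> A \<subseteq> carrier G \<longrightarrow> \<one>\<^bsub>G\<^esub> \<in> A \<longrightarrow> d \<le> n \<longrightarrow>
    is_coset_progression G H d u L \<longrightarrow> A \<subseteq> coset_progression G H d u L \<longrightarrow>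
    coset_progression G H d u L \<subseteq> set_power G A k1 \<longrightarrow>
    (\<exists>H d u L k'. k' \<le> k \<and> proper_coset_progression G (max m (real k' + 6)) H d u L \<and>
      A \<subseteq> coset_progression G H d u L \<and> coset_progression G H d u L \<subseteq> set_power G A k')"
    using Suc.IH[of k1] by (elim exE) (rule that)
  show ?case
  proof (intro exI[of _ "max k0 k"] allI impI)
    fix G :: "('a, 'b) monoid_scheme" and A H d u L
    assume cG: "comm_group G" and A: "A \<subseteq> carrier G" "\<one>\<^bsub>G\<^esub> \<in> A" and as: "d \<le> Suc n" "is_coset_progression G H d u L"
      "A \<subseteq> coset_progression G H d u L" "coset_progression G H d u L \<subseteq> set_power G A k0"
    interpret comm_group G by (rule cG)
    show "\<exists>H d u L k'. k' \<le> max k0 k \<and> proper_coset_progression G (max m (real k' + 6)) H d u L \<and>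
      A \<subseteq> coset_progression G H d u L \<and> coset_progression G H d u L \<subseteq> set_power G A k'"
    proof (cases "proper_coset_progression G m0 H d u L")
      case True
      then show ?thesis
        using as(3,4) unfolding m0_def
        by (rule_tac exI[of _ H], rule_tac exI[of _ d], rule_tac exI[of _ u], rule_tac exI[of _ L], rule_tac exI[of _ k0]) auto
    next
      case False
      have "\<exists>l. (\<forall>i<d. \<bar>real_of_int (l i)\<bar> \<le> 2 * m0 * real (L i)) \<and> monomial G d u l \<in> H \<and> (\<exists>i<d. l i \<noteq> 0)"
      proof (rule ccontr)
        assume neg: "\<not> ?thesis"
        have "proper_coset_progression G m0 H d u L"
          by (rule properI[OF as(2)]) (use neg in meson)
        then show False using False by simp
      qed
      then obtain l where l: "\<And>i. i < d \<Longrightarrow> \<bar>real_of_int (l i)\<bar> \<le> 2 * m0 * real (L i)"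
        "monomial G d u l \<in> H" "\<exists>i<d. l i \<noteq> 0" by blast
      have lM: "\<forall>i<d. \<bar>l i\<bar> \<le> int (M * L i)"
      proof (intro allI impI)
        fix i assume "i < d"
        have "2 * m0 \<le> real M" unfolding M_def by linarith
        then have "2 * m0 * real (L i) \<le> real M * real (L i)" by (rule mult_right_mono) simp
        then have "real_of_int \<bar>l i\<bar> \<le> real_of_int (int (M * L i))" using l(1)[OF \<open>i < d\<close>] by simp
        then show "\<bar>l i\<bar> \<le> int (M * L i)" by (simp only: of_int_le_iff)
      qed
      obtain H' d' u' L' where R: "d' < d" "is_coset_progression G H' d' u' L'"
        "coset_progression G H d u L \<subseteq> coset_progression G H' d' u' L'"
        "coset_progression G H' d' u' L' \<subseteq> set_power G (coset_progression G H d u L) (Suc (2 * 16 ^ Suc n + 2 * M))"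
        using rank_reduction[OF as(2,1) lM l(2,3)] by (elim exE conjE) (rule that)
      have "d' \<le> n" using R(1) as(1) by simp
      moreover have "A \<subseteq> coset_progression G H' d' u' L'" using as(3) R(3) by blast
      moreover have "coset_progression G H' d' u' L' \<subseteq> set_power G A k1"
        using R(4) set_power_subset_set_power[OF A(1) as(4)] unfolding k1_def by blast
      ultimately have "\<exists>H d u L k'. k' \<le> k \<and> proper_coset_progression G (max m (real k' + 6)) H d u L \<and>
          A \<subseteq> coset_progression G H d u L \<and> coset_progression G H d u L \<subseteq> set_power G A k'"
        by (rule k[rule_format, OF cG A _ R(2)])
      then obtain H'' d'' u'' L'' k' where F: "k' \<le> k" "proper_coset_progression G (max m (real k' + 6)) H'' d'' u'' L''"
        "A \<subseteq> coset_progression G H'' d'' u'' L''" "coset_progression G H'' d'' u'' L'' \<subseteq> set_power G A k'"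
        by (elim exE conjE) (rule that)
      then show ?thesis
        by (rule_tac exI[of _ H''], rule_tac exI[of _ d''], rule_tac exI[of _ u''], rule_tac exI[of _ L''], rule_tac exI[of _ k']) auto
    qed
  qed
qed

section \<open>The rank of a proper coset progression\<close>

text \<open>All integer sequences are taken so that the dimension, which varies with the
  progression, does not enter the type; the vectors that matter vanish from \<open>d\<close>
  on.\<close>

definition int_vectors :: "(nat \<Rightarrow> int) monoid" where
  "int_vectors = \<lparr>carrier = UNIV, monoid.mult = (\<lambda>x y i. x i + y i), one = (\<lambda>_. 0)\<rparr>"

lemma int_vectors_simps [simp]:
  "carrier int_vectors = UNIV" "x \<otimes>\<^bsub>int_vectors\<^esub> y = (\<lambda>i. x i + y i)" "\<one>\<^bsub>int_vectors\<^esub> = (\<lambda>_. 0)"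
  by (simp_all add: int_vectors_def)

lemma comm_group_int_vectors: "comm_group int_vectors"
proof (rule comm_groupI)
  fix x :: "nat \<Rightarrow> int"
  show "\<exists>y\<in>carrier int_vectors. y \<otimes>\<^bsub>int_vectors\<^esub> x = \<one>\<^bsub>int_vectors\<^esub>"
    by (intro bexI[of _ "\<lambda>i. - x i"]) simp_all
qed (simp_all add: algebra_simps)

lemma bounded_degree:
  fixes d r k :: nat
  assumes "\<And>N. (N + 1) ^ d \<le> (k * N + 1) ^ r * c"
  shows "d \<le> r"
proof (rule ccontr)
  assume "\<not> d \<le> r"
  then have dr: "Suc r \<le> d" by simp
  \<comment> \<open>One factor \<open>N + 1\<close> is left over on the left, so \<open>N\<close> is
    chosen equal to the constant factor on the right.\<close>
  define N where "N = (k + 1) ^ r * c"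
  have "(N + 1) * (N + 1) ^ r = (N + 1) ^ Suc r" by simp
  also have "\<dots> \<le> (N + 1) ^ d" using dr by (intro power_increasing) auto
  also have "\<dots> \<le> (k * N + 1) ^ r * c" by (rule assms)
  also have "\<dots> \<le> ((k + 1) * (N + 1)) ^ r * c" by (intro mult_right_mono power_mono) (auto simp: algebra_simps)
  also have "\<dots> = ((k + 1) ^ r * c) * (N + 1) ^ r" by (simp only: power_mult_distrib mult_ac)
  also have "\<dots> = N * (N + 1) ^ r" by (simp only: N_def[symmetric])
  finally show False by simp
qed

context approximate_subgroup
begin

text \<open>By properness the coordinate vectors of \<open>A\<close> again satisfy the covering condition, now in the integer vectors,
  so their sumsets grow with exponent at most \<open>r\<close>; but they generate the unit vectors, so these sumsets
  contain boxes of dimension \<open>d\<close>.\<close>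

lemma rank_le:
  assumes P: "proper_coset_progression G m H d u L" and m: "real k + 6 \<le> m"
    and AP: "A \<subseteq> coset_progression G H d u L" and PA: "coset_progression G H d u L \<subseteq> set_power G A k"
  shows "d \<le> r"
proof -
  have icp: "is_coset_progression G H d u L" using P by (simp add: proper_coset_progression_def)
  note PD = is_coset_progressionD[OF icp]
  note u = PD(3)
  note Hm = subgroup.m_closed[OF PD(1)]
  note Hi = subgroup.m_inv_closed[OF PD(1)]
  note mc = monomial_closed[OF u]
  have Hc: "h \<in> carrier G" if "h \<in> H" for h using subgroup.mem_carrier[OF PD(1) that] .
  have k6: "6 * int (L i) \<le> int ((k + 6) * L i)" for i by (simp add: algebra_simps)
  \<comment> \<open>The form in which properness is used: a short exponent vector of the trivial
    coset is 0. The summand 6 is needed for \<open>uniq\<close>, the summand \<open>k\<close> for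
    \<open>unit\<close>.\<close>
  have zero: "x = (\<lambda>_. 0)"
    if "monomial G d u x \<in> H" "\<And>i. i < d \<Longrightarrow> \<bar>x i\<bar> \<le> int ((k + 6) * L i)" "\<And>i. i \<ge> d \<Longrightarrow> x i = 0" for x
  proof
    fix i
    show "x i = 0"
    proof (cases "i < d")
      case True
      have "\<forall>i<d. \<bar>of_int (x i)\<bar> \<le> m * real (L i)"
      proof (intro allI impI)
        fix i assume "i < d"
        then have "real_of_int \<bar>x i\<bar> \<le> real_of_int (int ((k + 6) * L i))"
          using that(2) by (simp only: of_int_le_iff)
        also have "\<dots> = (real k + 6) * real (L i)" by simp
        also have "\<dots> \<le> m * real (L i)" using m by (intro mult_right_mono) auto
        finally show "\<bar>of_int (x i)\<bar> \<le> m * real (L i)" by simp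
      qed
      moreover have "0 \<le> m" using m by linarith
      ultimately show ?thesis using properD[OF P _ _ that(1) True] by blast
    next
      case False
      then show ?thesis using that(3) by simp
    qed
  qed
  have "\<forall>a\<in>A. \<exists>l. (\<forall>i<d. \<bar>l i\<bar> \<le> int (L i)) \<and> (\<forall>i\<ge>d. l i = 0) \<and> a \<otimes> inv (monomial G d u l) \<in> H"
  proof
    fix a assume "a \<in> A"
    then have "a \<in> coset_progression G H d u L" using AP by blast
    then obtain h l where hl: "h \<in> H" "\<forall>i<d. \<bar>l i\<bar> \<le> int (L i)" "a = h \<otimes> monomial G d u l"
      unfolding mem_coset_progression[OF u] by (elim bexE exE conjE) (rule that)
    let ?l = "\<lambda>i. if i < d then l i else 0"
    have "monomial G d u ?l = monomial G d u l" by (rule monomial_cong) (use u in auto)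
    then have "a \<otimes> inv (monomial G d u ?l) = h" using hl(1,3) Hc mc by (simp add: m_assoc)
    then have "a \<otimes> inv (monomial G d u ?l) \<in> H" using hl(1) by simp
    then show "\<exists>l. (\<forall>i<d. \<bar>l i\<bar> \<le> int (L i)) \<and> (\<forall>i\<ge>d. l i = 0) \<and> a \<otimes> inv (monomial G d u l) \<in> H"
      using hl(2) by (intro exI[of _ ?l] conjI) auto
  qed
  from bchoice[OF this] obtain c where
    c: "\<forall>a\<in>A. (\<forall>i<d. \<bar>c a i\<bar> \<le> int (L i)) \<and> (\<forall>i\<ge>d. c a i = 0) \<and> a \<otimes> inv (monomial G d u (c a)) \<in> H" by blast
  have cL: "\<bar>c a i\<bar> \<le> int (L i)" if "a \<in> A" "i < d" for a i using c that by blast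
  have c0: "c a i = 0" if "a \<in> A" "i \<ge> d" for a i using c that by blast
  have cH: "a \<otimes> inv (monomial G d u (c a)) \<in> H" if "a \<in> A" for a using c that by blast
  \<comment> \<open>\<open>rel x l\<close> says that \<open>l\<close> represents the coset of
    \<open>x\<close>. The relation is multiplicative without size restrictions; it is uniqueness of
    \<open>l\<close> that requires properness.\<close>
  define rel where "rel x l \<longleftrightarrow> x \<in> carrier G \<and> x \<otimes> inv (monomial G d u l) \<in> H" for x l
  have rel_c: "rel a (c a)" if "a \<in> A" for a using cH[OF that] A_carrier that by (auto simp: rel_def)
  have rel_mult: "rel (x \<otimes> y) (\<lambda>i. l i + l' i)" if "rel x l" "rel y l'" for x y l l'
  proof -
    have "(x \<otimes> y) \<otimes> inv (monomial G d u (\<lambda>i. l i + l' i))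
        = (x \<otimes> inv (monomial G d u l)) \<otimes> (y \<otimes> inv (monomial G d u l'))"
      using that mc unfolding rel_def monomial_add[OF u] by (simp add: inv_mult m_ac)
    then show ?thesis using that Hm by (simp add: rel_def)
  qed
  have rel_inv: "rel (inv x) (\<lambda>i. - l i)" if "rel x l" for x l
  proof -
    have "inv x \<otimes> inv (monomial G d u (\<lambda>i. - l i)) = inv (x \<otimes> inv (monomial G d u l))"
      using that mc unfolding rel_def monomial_minus[OF u] by (simp add: inv_mult)
    then show ?thesis using that Hi by (simp add: rel_def)
  qed
  have rel_one: "monomial G d u l \<in> H" if "rel \<one> l" for l
  proof -
    have "inv (\<one> \<otimes> inv (monomial G d u l)) \<in> H" using that Hi by (simp add: rel_def)
    then show ?thesis using mc by simp
  qed
  define cA where "cA = c ` A"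
  have finite_cA: "finite cA" unfolding cA_def using finite_A by simp
  have zero_cA: "(\<lambda>_. 0) \<in> cA"
  proof -
    have "c \<one> = (\<lambda>_. 0)"
    proof (rule zero[OF rel_one[OF rel_c[OF one_A]]])
      show "\<bar>c \<one> i\<bar> \<le> int ((k + 6) * L i)" if "i < d" for i
        using cL[OF one_A that] k6[of i] by linarith
    qed (use c0[OF one_A] in simp)
    then show ?thesis unfolding cA_def using one_A by (metis imageI)
  qed
  \<comment> \<open>An element \<open>x\<close> of the covering set may have no short coordinates of
    its own. It receives those of \<open>a \<otimes> b \<otimes> inv e\<close> for an instance of
    the covering; two instances differ by six coordinate vectors of \<open>A\<close>, so properness
    makes them agree. If \<open>x\<close> occurs in no instance, its image is arbitrary.\<close>
  define P' where "P' x l \<longleftrightarrow> (\<exists>a\<in>A. \<exists>b\<in>A. \<exists>e\<in>A. a \<otimes> b = x \<otimes> e \<and> l = (\<lambda>i. c a i + c b i - c e i))" for x l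
  define \<mu> where "\<mu> x = (SOME l. P' x l)" for x
  let ?X = "\<mu> ` X"
  have uniq: "l = l'" if "x \<in> carrier G" and Pl: "P' x l" and Pl': "P' x l'" for x l l'
  proof -
    obtain a b e where 1: "a \<in> A" "b \<in> A" "e \<in> A" "a \<otimes> b = x \<otimes> e" "l = (\<lambda>i. c a i + c b i - c e i)"
      using Pl unfolding P'_def by blast
    obtain a' b' e' where 2: "a' \<in> A" "b' \<in> A" "e' \<in> A" "a' \<otimes> b' = x \<otimes> e'" "l' = (\<lambda>i. c a' i + c b' i - c e' i)"
      using Pl' unfolding P'_def by blast
    have relx: "rel x (\<lambda>i. c a i + c b i - c e i)"
      if "a \<in> A" "b \<in> A" "e \<in> A" "a \<otimes> b = x \<otimes> e" for a b e
    proof -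
      have "rel ((a \<otimes> b) \<otimes> inv e) (\<lambda>i. (c a i + c b i) + - c e i)"
        using that by (intro rel_mult rel_inv rel_c)
      moreover have "(a \<otimes> b) \<otimes> inv e = x"
        using that A_carrier \<open>x \<in> carrier G\<close> by (auto simp: m_assoc)
      ultimately show ?thesis by simp
    qed
    have "rel x l" using relx[OF 1(1-4)] 1(5) by simp
    moreover have "rel x l'" using relx[OF 2(1-4)] 2(5) by simp
    ultimately have "rel (x \<otimes> inv x) (\<lambda>i. l i + - l' i)" by (intro rel_mult rel_inv)
    then have "rel \<one> (\<lambda>i. l i - l' i)" using \<open>x \<in> carrier G\<close> by simp
    from zero[OF rel_one[OF this]] have "(\<lambda>i. l i - l' i) = (\<lambda>_. 0)"
    proof this
      fix i assume i: "i < d"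
      have "\<bar>l i - l' i\<bar> \<le> 6 * int (L i)"
        using cL[OF 1(1) i] cL[OF 1(2) i] cL[OF 1(3) i] cL[OF 2(1) i] cL[OF 2(2) i] cL[OF 2(3) i]
        unfolding 1(5) 2(5) by linarith
      then show "\<bar>l i - l' i\<bar> \<le> int ((k + 6) * L i)" using k6[of i] by linarith
    next
      fix i assume "d \<le> i"
      then show "l i - l' i = 0" using 1 2 c0 by simp
    qed
    then have li: "l i - l' i = 0" for i by (rule fun_cong)
    show ?thesis by (rule ext) (use li in \<open>simp only: right_minus_eq\<close>)
  qed
  interpret Z: comm_group int_vectors by (rule comm_group_int_vectors)
  have double: "cA <#>\<^bsub>int_vectors\<^esub> cA \<subseteq> ?X <#>\<^bsub>int_vectors\<^esub> cA"
  proof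
    fix v assume "v \<in> cA <#>\<^bsub>int_vectors\<^esub> cA"
    then obtain a b where ab: "a \<in> A" "b \<in> A" "v = (\<lambda>i. c a i + c b i)"
      unfolding cA_def set_mult_def by auto
    have "a \<otimes> b \<in> X <#> A" using AA ab by (auto simp: set_mult_def)
    then obtain x e where xe: "x \<in> X" "e \<in> A" "a \<otimes> b = x \<otimes> e" by (auto simp: set_mult_def)
    let ?l = "\<lambda>i. c a i + c b i - c e i"
    have Px: "P' x ?l" unfolding P'_def using ab xe by blast
    have "P' x (\<mu> x)" unfolding \<mu>_def by (rule someI[of "P' x", OF Px])
    then have "\<mu> x = ?l" using uniq[of x] Px X_carrier xe(1) by blast
    then have "v = \<mu> x \<otimes>\<^bsub>int_vectors\<^esub> c e" using ab(3) by simp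
    moreover have "\<mu> x \<in> ?X" "c e \<in> cA" using xe by (auto simp: cA_def)
    ultimately show "v \<in> ?X <#>\<^bsub>int_vectors\<^esub> cA" unfolding set_mult_def by blast
  qed
  have growth': "card (set_power int_vectors cA (Suc n)) \<le> Suc n ^ r * card A" for n
  proof -
    have "card (set_power int_vectors cA (Suc n)) \<le> Suc n ^ card ?X * card cA"
      by (rule Z.polynomial_growth[OF _ finite_cA _ _ double]) (use finite_X in auto)
    also have "\<dots> \<le> Suc n ^ r * card A"
      using card_image_le[OF finite_X, of \<mu>] card_X card_image_le[OF finite_A, of c]
      unfolding cA_def by (intro mult_mono power_increasing) auto
    finally show ?thesis .
  qed
  have lift: "\<exists>y\<in>set_power int_vectors cA n. rel x y \<and> (\<forall>i<d. \<bar>y i\<bar> \<le> int (n * L i)) \<and> (\<forall>i\<ge>d. y i = 0)"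
    if "x \<in> set_power G A n" for x n
    using that
  proof (induction n arbitrary: x)
    case 0
    have "rel \<one> (\<lambda>_. 0)" using subgroup.one_closed[OF PD(1)] by (simp add: rel_def monomial_zero[OF u])
    then show ?case using 0 by simp
  next
    case (Suc n)
    then obtain y a where ya: "y \<in> set_power G A n" "a \<in> A" "x = y \<otimes> a" by (auto simp: set_mult_def)
    obtain l where l: "l \<in> set_power int_vectors cA n" "rel y l" "\<forall>i<d. \<bar>l i\<bar> \<le> int (n * L i)" "\<forall>i\<ge>d. l i = 0"
      using Suc.IH[OF ya(1)] by blast
    have "(\<lambda>i. l i + c a i) \<in> set_power int_vectors cA (Suc n)"
      using set_power.simps(2)[of int_vectors cA n] l(1) ya(2) Z.set_power_Suc_memI[OF l(1), of "c a"] by (simp add: cA_def)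
    moreover have "rel x (\<lambda>i. l i + c a i)" unfolding ya(3) by (intro rel_mult l(2) rel_c ya(2))
    moreover have "\<bar>l i + c a i\<bar> \<le> int (Suc n * L i)" if "i < d" for i
    proof -
      have "\<bar>l i + c a i\<bar> \<le> int (n * L i) + int (L i)" using l(3) that cL[OF ya(2) that] by (smt (verit))
      then show ?thesis by (simp add: algebra_simps)
    qed
    moreover have "l i + c a i = 0" if "i \<ge> d" for i using l(4) that c0[OF ya(2) that] by simp
    ultimately show ?case by (intro bexI[of _ "\<lambda>i. l i + c a i"] conjI allI impI)
  qed
  let ?e = "\<lambda>j (n :: int) i. if i = j then n else 0"
  \<comment> \<open>The generator \<open>u j\<close> lies in \<open>A^k\<close> and lifts to a sum
    of \<open>k\<close> coordinate vectors of \<open>A\<close>. That sum and the unit vector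
    represent the same coset and differ by at most \<open>(k + 1) * L i\<close>, so they are
    equal.\<close>
  have unit: "?e j 1 \<in> set_power int_vectors cA k" if j: "j < d" for j
  proof -
    have uj: "monomial G d u (?e j 1) = u j" using monomial_single[OF u j, of 1] u j by (simp add: int_pow_1 Pi_iff)
    have ujc: "u j \<in> carrier G" using u j by auto
    have "u j \<in> coset_progression G H d u L"
      unfolding mem_coset_progression[OF u]
      using subgroup.one_closed[OF PD(1)] uj ujc PD(4) by (intro bexI[of _ \<one>] exI[of _ "?e j 1"]) (auto simp: Suc_le_eq)
    then have "u j \<in> set_power G A k" using PA by blast
    then obtain y where y: "y \<in> set_power int_vectors cA k" "rel (u j) y" "\<forall>i<d. \<bar>y i\<bar> \<le> int (k * L i)" "\<forall>i\<ge>d. y i = 0"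
      using lift by blast
    have "rel (u j) (?e j 1)" using uj ujc subgroup.one_closed[OF PD(1)] by (simp add: rel_def)
    then have "rel (u j \<otimes> inv (u j)) (\<lambda>i. y i + - ?e j 1 i)" by (intro rel_mult rel_inv y(2))
    then have "rel \<one> (\<lambda>i. y i - ?e j 1 i)" using ujc by simp
    from zero[OF rel_one[OF this]] have "(\<lambda>i. y i - ?e j 1 i) = (\<lambda>_. 0)"
    proof this
      fix i assume i: "i < d"
      have "\<bar>?e j 1 i\<bar> \<le> int (L i)" using PD(4)[OF i] by auto
      moreover have "\<bar>y i\<bar> \<le> int (k * L i)" using y(3) i by blast
      ultimately have "\<bar>y i - ?e j 1 i\<bar> \<le> int (k * L i) + int (L i)" by linarith
      then show "\<bar>y i - ?e j 1 i\<bar> \<le> int ((k + 6) * L i)" by (simp add: algebra_simps)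
    next
      fix i assume "d \<le> i"
      then show "y i - ?e j 1 i = 0" using y(4) j by simp
    qed
    then have yi: "y i - ?e j 1 i = 0" for i by (rule fun_cong)
    have "y = ?e j 1" by (rule ext) (use yi in \<open>simp only: right_minus_eq\<close>)
    then show ?thesis using y(1) by simp
  qed
  have mult_unit: "?e j (int n) \<in> set_power int_vectors cA (k * n)" if j: "j < d" for j n
  proof (induction n)
    case 0
    show ?case by (simp add: fun_eq_iff)
  next
    case (Suc n)
    have "?e j (int n) \<otimes>\<^bsub>int_vectors\<^esub> ?e j 1 \<in> set_power int_vectors cA (k * n + k)"
      by (rule Z.set_power_memI[OF _ Suc unit[OF j]]) simp
    moreover have "?e j (int n) \<otimes>\<^bsub>int_vectors\<^esub> ?e j 1 = ?e j (int (Suc n))" by (auto simp: fun_eq_iff)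
    moreover have "k * n + k = k * Suc n" by simp
    ultimately show ?case by (simp only:)
  qed
  have box: "v \<in> set_power int_vectors cA (k * N * j)"
    if "j \<le> d" "\<And>i. i < j \<Longrightarrow> v i \<in> {0..int N}" "\<And>i. i \<ge> j \<Longrightarrow> v i = 0" for v N j
    using that
  proof (induction j arbitrary: v)
    case 0
    then have "v = (\<lambda>_. 0)" by auto
    then show ?case by simp
  next
    case (Suc j)
    have "v(j := 0) \<in> set_power int_vectors cA (k * N * j)"
      using Suc.prems by (intro Suc.IH) (auto simp: not_less_eq_eq)
    moreover have "?e j (v j) \<in> set_power int_vectors cA (k * N)"
    proof -
      have "v j \<in> {0..int N}" using Suc.prems(2)[of j] by simp
      then obtain n where n: "v j = int n" "n \<le> N" using zero_le_imp_eq_int[of "v j"] by auto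
      have "?e j (v j) \<in> set_power int_vectors cA (k * n)"
        unfolding n(1) using Suc.prems(1) by (intro mult_unit) simp
      moreover have "set_power int_vectors cA (k * n) \<subseteq> set_power int_vectors cA (k * N)"
        using n(2) zero_cA by (intro Z.set_power_mono) auto
      ultimately show ?thesis by blast
    qed
    ultimately have "v(j := 0) \<otimes>\<^bsub>int_vectors\<^esub> ?e j (v j) \<in> set_power int_vectors cA (k * N * j + k * N)"
      by (intro Z.set_power_memI) simp
    moreover have "v(j := 0) \<otimes>\<^bsub>int_vectors\<^esub> ?e j (v j) = v" by (auto simp: fun_eq_iff)
    moreover have "k * N * j + k * N = k * N * Suc j" by simp
    ultimately show ?case by (simp only:)
  qed
  \<comment> \<open>The box has \<open>(N + 1) ^ d\<close> points but lies in a
    \<open>k * d * N\<close>-fold sumset, whose size has degree at most \<open>r\<close> in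
    \<open>N\<close>.\<close>
  have "(N + 1) ^ d \<le> (k * d * N + 1) ^ r * card A" for N
  proof -
    let ?B = "\<Pi>\<^sub>E i\<in>{..<d}. {0..int N}"
    let ?f = "\<lambda>v i. if i < d then v i else (0 :: int)"
    have "inj_on ?f ?B"
    proof (rule inj_onI)
      fix v w assume vw: "v \<in> ?B" "w \<in> ?B" "?f v = ?f w"
      show "v = w"
      proof (rule PiE_ext[OF vw(1,2)])
        fix i assume "i \<in> {..<d}"
        then show "v i = w i" using fun_cong[OF vw(3), of i] by simp
      qed
    qed
    then have "card ?B = card (?f ` ?B)" by (simp add: card_image)
    also have "\<dots> \<le> card (set_power int_vectors cA (Suc (k * N * d)))"
    proof (rule card_mono[OF Z.finite_set_power[OF finite_cA]])
      have "?f ` ?B \<subseteq> set_power int_vectors cA (k * N * d)"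
      proof
        fix w assume "w \<in> ?f ` ?B"
        then obtain v where v: "v \<in> ?B" "w = ?f v" by blast
        show "w \<in> set_power int_vectors cA (k * N * d)"
          unfolding v(2) by (rule box) (use v(1) in \<open>auto simp: PiE_iff\<close>)
      qed
      also have "\<dots> \<subseteq> set_power int_vectors cA (Suc (k * N * d))"
        using zero_cA by (intro Z.set_power_mono) auto
      finally show "?f ` ?B \<subseteq> set_power int_vectors cA (Suc (k * N * d))" .
    qed
    also have "\<dots> \<le> Suc (k * N * d) ^ r * card A" by (rule growth')
    finally show ?thesis by (simp add: card_PiE nat_add_distrib mult_ac)
  qed
  then show ?thesis by (rule bounded_degree)
qed

end

lemma proper_coset_progression_mono:
  assumes "proper_coset_progression G m' H d u L" "m \<le> m'"
  shows "proper_coset_progression G m H d u L"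
proof -
  have "(\<Pi>\<^sub>E i\<in>{..<d}. {j. real_of_int \<bar>j\<bar> \<le> m * real (L i)}) \<subseteq> (\<Pi>\<^sub>E i\<in>{..<d}. {j. real_of_int \<bar>j\<bar> \<le> m' * real (L i)})"
    using mult_right_mono[OF assms(2), of "real (L _)"] by (intro PiE_mono) (auto intro: order_trans)
  then show ?thesis using assms(1) inj_on_subset unfolding proper_coset_progression_def by blast
qed

lemma freiman_comm_group:
  "\<exists>k. \<forall>(G :: ('a, 'b) monoid_scheme) A X. approximate_subgroup G A X r \<longrightarrow> generate G A = carrier G \<longrightarrow>
    (\<exists>H d u L. d \<le> r \<and> proper_coset_progression G m H d u L \<and>
      A \<subseteq> coset_progression G H d u L \<and> coset_progression G H d u L \<subseteq> set_power G A k)"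
proof -
  obtain d0 k0 where 1: "\<forall>(G :: ('a, 'b) monoid_scheme) A X. approximate_subgroup G A X r \<longrightarrow> generate G A = carrier G \<longrightarrow>
    (\<exists>H d u L. d \<le> d0 \<and> is_coset_progression G H d u L \<and>
      A \<subseteq> coset_progression G H d u L \<and> coset_progression G H d u L \<subseteq> set_power G A k0)"
    using initial_coset_progression[of r, where 'a = 'a and 'b = 'b] by (elim exE) (rule that)
  obtain k where 2: "\<forall>(G :: ('a, 'b) monoid_scheme) A H d u L. comm_group G \<longrightarrow> A \<subseteq> carrier G \<longrightarrow> \<one>\<^bsub>G\<^esub> \<in> A \<longrightarrow> d \<le> d0 \<longrightarrow>
    is_coset_progression G H d u L \<longrightarrow> A \<subseteq> coset_progression G H d u L \<longrightarrow>
    coset_progression G H d u L \<subseteq> set_power G A k0 \<longrightarrow>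
    (\<exists>H d u L k'. k' \<le> k \<and> proper_coset_progression G (max m (real k' + 6)) H d u L \<and>
      A \<subseteq> coset_progression G H d u L \<and> coset_progression G H d u L \<subseteq> set_power G A k')"
    using ex_proper_coset_progression[of d0 k0 m, where 'a = 'a and 'b = 'b] by (elim exE) (rule that)
  show ?thesis
  proof (intro exI[of _ k] allI impI)
    fix G :: "('a, 'b) monoid_scheme" and A X
    assume AX: "approximate_subgroup G A X r" and gen: "generate G A = carrier G"
    interpret approximate_subgroup G A X r by (rule AX)
    obtain H\<^sub>0 d\<^sub>0 u\<^sub>0 L\<^sub>0 where F: "d\<^sub>0 \<le> d0" "is_coset_progression G H\<^sub>0 d\<^sub>0 u\<^sub>0 L\<^sub>0"
      "A \<subseteq> coset_progression G H\<^sub>0 d\<^sub>0 u\<^sub>0 L\<^sub>0" "coset_progression G H\<^sub>0 d\<^sub>0 u\<^sub>0 L\<^sub>0 \<subseteq> set_power G A k0"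
      using 1[rule_format, OF AX gen] by (elim exE conjE) (rule that)
    have "\<exists>H d u L k'. k' \<le> k \<and> proper_coset_progression G (max m (real k' + 6)) H d u L \<and>
      A \<subseteq> coset_progression G H d u L \<and> coset_progression G H d u L \<subseteq> set_power G A k'"
      by (rule 2[rule_format, OF comm_group_axioms A_carrier one_A F])
    then obtain H d u L k' where Q: "k' \<le> k" "proper_coset_progression G (max m (real k' + 6)) H d u L"
      "A \<subseteq> coset_progression G H d u L" "coset_progression G H d u L \<subseteq> set_power G A k'"
      by (elim exE conjE) (rule that)
    have "d \<le> r" by (rule rank_le[OF Q(2) _ Q(3,4)]) simp
    moreover have "proper_coset_progression G m H d u L" by (rule proper_coset_progression_mono[OF Q(2)]) simp
    moreover have "coset_progression G H d u L \<subseteq> set_power G A k"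
      using Q(4) set_power_mono[OF A_carrier one_A Q(1)] by blast
    ultimately show "\<exists>H d u L. d \<le> r \<and> proper_coset_progression G m H d u L \<and>
      A \<subseteq> coset_progression G H d u L \<and> coset_progression G H d u L \<subseteq> set_power G A k"
      using Q(3) by (intro exI[of _ H] exI[of _ d] exI[of _ u] exI[of _ L] conjI)
  qed
qed

section \<open>Passage to the generated subgroup\<close>

lemma set_power_subgroup_generated: "set_power (subgroup_generated G B) A n = set_power G A n"
  by (induction n) (simp_all add: subgroup_generated_def set_mult_def)

lemma (in group) generate_subgroup_generated:
  assumes "A \<subseteq> carrier G"
  shows "generate (subgroup_generated G A) A = carrier (subgroup_generated G A)"
proof -
  have "generate (subgroup_generated G A) (carrier (subgroup_generated G A) \<inter> A) = carrier (subgroup_generated G A)"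
    unfolding carrier_subgroup_generated[of "subgroup_generated G A" A, symmetric] subgroup_generated2 ..
  then show ?thesis unfolding Int_absorb1[OF subgroup_generated_subset_carrier_subset[OF assms]] .
qed

text \<open>The covering set may stick out of the subgroup generated by \<open>A\<close>. But if
  \<open>a \<otimes> b = x \<otimes> c\<close> with \<open>a\<close>, \<open>b\<close>,
  \<open>c\<close> in \<open>A\<close>, then \<open>x\<close> is a quotient of members of that
  subgroup, so the rest of \<open>X\<close> can be discarded.\<close>

lemma (in group) approximate_group_subgroup_generated:
  assumes A: "approximate_group G K A" and cG: "comm_group (subgroup_generated G A)"
  shows "\<exists>X. approximate_subgroup (subgroup_generated G A) A X (nat \<lfloor>K\<rfloor>)"
    and "generate (subgroup_generated G A) A = carrier (subgroup_generated G A)"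
proof -
  let ?S = "subgroup_generated G A"
  interpret S: comm_group ?S by (rule cG)
  have Ac: "A \<subseteq> carrier G" and fin: "finite A" and inv: "set_inv A = A" and one: "\<one> \<in> A"
    using A unfolding approximate_group_def by auto
  obtain X where X: "X \<subseteq> carrier G" "finite X" "real (card X) \<le> K" "set_power G A 2 \<subseteq> X <#> A"
    using A unfolding approximate_group_def by blast
  have AS: "A \<subseteq> carrier ?S" by (rule subgroup_generated_subset_carrier_subset[OF Ac])
  have mult: "x \<otimes>\<^bsub>?S\<^esub> y = x \<otimes> y" for x y by (simp add: subgroup_generated_def)
  let ?X = "X \<inter> carrier ?S"
  have invA: "inv\<^bsub>?S\<^esub> x \<in> A" if "x \<in> A" for x
  proof -
    have "inv x \<in> set_inv A" using that by (auto simp: SET_INV_def)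
    then show ?thesis using inv inv_subgroup_generated[of x A] AS that by auto
  qed
  have cov: "A <#>\<^bsub>?S\<^esub> A \<subseteq> ?X <#>\<^bsub>?S\<^esub> A"
  proof
    fix z assume "z \<in> A <#>\<^bsub>?S\<^esub> A"
    then obtain a b where ab: "a \<in> A" "b \<in> A" "z = a \<otimes> b" by (auto simp: set_mult_def mult)
    have "\<one> \<otimes> a = a" using ab Ac by auto
    then have "z \<in> set_power G A 2"
      using ab by (force simp: numeral_2_eq_2 set_mult_def)
    then have "z \<in> X <#> A" using X(4) by blast
    then obtain x c where xc: "x \<in> X" "c \<in> A" "z = x \<otimes> c" by (auto simp: set_mult_def)
    have c: "x \<in> carrier G" "c \<in> carrier G" using xc X(1) Ac by auto
    have "z \<otimes>\<^bsub>?S\<^esub> inv\<^bsub>?S\<^esub> c \<in> carrier ?S"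
      using ab xc AS mult S.m_closed[of a b] by (intro S.m_closed S.inv_closed) auto
    moreover have "z \<otimes>\<^bsub>?S\<^esub> inv\<^bsub>?S\<^esub> c = x"
      using c xc(2,3) AS inv_subgroup_generated[of c A] by (auto simp: mult m_assoc)
    ultimately have "x \<in> ?X" using xc(1) by simp
    then show "z \<in> ?X <#>\<^bsub>?S\<^esub> A" using xc(2,3) unfolding set_mult_def by (auto simp: mult)
  qed
  have "card ?X \<le> card X" using X(2) by (intro card_mono) auto
  then have cX: "card ?X \<le> nat \<lfloor>K\<rfloor>" using X(3) by linarith
  have "approximate_subgroup ?S A ?X (nat \<lfloor>K\<rfloor>)"
    by unfold_locales (use AS fin one invA X(2) cX cov in \<open>auto simp: subgroup_generated_def\<close>)
  then show "\<exists>X. approximate_subgroup ?S A X (nat \<lfloor>K\<rfloor>)" by blast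
  show "generate ?S A = carrier ?S" by (rule generate_subgroup_generated[OF Ac])
qed

lemma ex_abelian_freiman:
  "\<exists>a>0. \<exists>k. \<forall>G :: ('a, 'b) monoid_scheme. group G \<longrightarrow> abelian_freiman G a k"
proof -
  define good where "good K m k \<longleftrightarrow> (\<forall>(G :: ('a, 'b) monoid_scheme) A X. approximate_subgroup G A X (nat \<lfloor>K\<rfloor>) \<longrightarrow> generate G A = carrier G \<longrightarrow>
    (\<exists>H d u L. d \<le> nat \<lfloor>K\<rfloor> \<and> proper_coset_progression G m H d u L \<and>
      A \<subseteq> coset_progression G H d u L \<and> coset_progression G H d u L \<subseteq> set_power G A k))"
    for K m :: real and k
  \<comment> \<open>The exponent is selected for each pair \<open>K\<close>, \<open>m\<close> before
    any group is fixed.\<close>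
  define k where "k K m = (SOME k. good K m k)" for K m
  have "\<exists>k. good K m k" for K m unfolding good_def by (rule freiman_comm_group)
  then have "good K m (k K m)" for K m unfolding k_def by (rule someI_ex)
  note k = this[unfolded good_def]
  have "abelian_freiman G 1 k" if "group G" for G :: "('a, 'b) monoid_scheme"
    unfolding abelian_freiman_def
  proof (intro allI impI, elim conjE)
    fix K A and m :: real
    assume K: "1 \<le> K" and A: "approximate_group G K A" "comm_group (subgroup_generated G A)" and "0 < m"
    interpret group G by fact
    obtain X where X: "approximate_subgroup (subgroup_generated G A) A X (nat \<lfloor>K\<rfloor>)"
      using approximate_group_subgroup_generated(1)[OF A] by blast
    obtain H d u L where F: "d \<le> nat \<lfloor>K\<rfloor>" "proper_coset_progression (subgroup_generated G A) m H d u L"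
      "A \<subseteq> coset_progression (subgroup_generated G A) H d u L"
      "coset_progression (subgroup_generated G A) H d u L \<subseteq> set_power (subgroup_generated G A) A (k K m)"
      using k[of K m, rule_format, OF X approximate_group_subgroup_generated(2)[OF A]] by (elim exE conjE) (rule that)
    have "real d \<le> K powr 1" using F(1) K by simp linarith
    then show "\<exists>H d u L. proper_coset_progression (subgroup_generated G A) m H d u L \<and> real d \<le> K powr 1 \<and>
      A \<subseteq> coset_progression (subgroup_generated G A) H d u L \<and>
      coset_progression (subgroup_generated G A) H d u L \<subseteq> set_power G A (k K m)"
      using F(2-4) unfolding set_power_subgroup_generated
      by (intro exI[of _ H] exI[of _ d] exI[of _ u] exI[of _ L] conjI)
  qed
  then show ?thesis by (intro exI[of _ "1 :: real"] conjI exI[of _ k]) auto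
qed

section \<open>Transport to groups of natural numbers\<close>

lemma set_mult_image:
  assumes "h \<in> hom G G'" "B \<subseteq> carrier G" "C \<subseteq> carrier G"
  shows "h ` (B <#>\<^bsub>G\<^esub> C) = h ` B <#>\<^bsub>G'\<^esub> h ` C"
proof
  show "h ` (B <#>\<^bsub>G\<^esub> C) \<subseteq> h ` B <#>\<^bsub>G'\<^esub> h ` C"
    using hom_mult[OF assms(1)] assms(2,3) unfolding set_mult_def by fastforce
  show "h ` B <#>\<^bsub>G'\<^esub> h ` C \<subseteq> h ` (B <#>\<^bsub>G\<^esub> C)"
  proof
    fix y assume "y \<in> h ` B <#>\<^bsub>G'\<^esub> h ` C"
    then obtain b c where bc: "b \<in> B" "c \<in> C" "y = h b \<otimes>\<^bsub>G'\<^esub> h c" unfolding set_mult_def by blast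
    then have "b \<in> carrier G" "c \<in> carrier G" using assms(2,3) by auto
    then have "y = h (b \<otimes>\<^bsub>G\<^esub> c)" using hom_mult[OF assms(1)] bc(3) by simp
    moreover have "b \<otimes>\<^bsub>G\<^esub> c \<in> B <#>\<^bsub>G\<^esub> C" using bc unfolding set_mult_def by blast
    ultimately show "y \<in> h ` (B <#>\<^bsub>G\<^esub> C)" by blast
  qed
qed

locale comm_group_iso = G: comm_group G + G': comm_group G' for G (structure) and G' +
  fixes h
  assumes iso: "h \<in> iso G G'"
begin

lemma hom: "h \<in> hom G G'"
  using iso by (simp add: iso_def)

sublocale group_hom G G' h
  by unfold_locales (rule hom)

lemma inj: "inj_on h (carrier G)" and surj: "h ` carrier G = carrier G'"
  using iso by (auto simp: iso_def bij_betw_def)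

lemma set_power_image: "B \<subseteq> carrier G \<Longrightarrow> h ` set_power G B n = set_power G' (h ` B) n"
  by (induction n) (simp_all add: set_mult_image[OF hom G.set_power_closed])

lemma monomial_image:
  assumes "u \<in> {..<d} \<rightarrow> carrier G"
  shows "h (monomial G d u l) = monomial G' d (h \<circ> u) l"
  using assms
proof (induction d)
  case 0
  show ?case by (simp add: G.monomial_0 G'.monomial_0)
next
  case (Suc d)
  have u: "u \<in> {..<d} \<rightarrow> carrier G" "u d \<in> carrier G" using Suc.prems by auto
  have "h \<circ> u \<in> {..<Suc d} \<rightarrow> carrier G'" using Suc.prems by (auto simp: Pi_iff)
  then show ?case
    using Suc.IH[OF u(1)] u G.monomial_closed[OF u(1)] hom_int_pow[OF u(2), of "l d"]
    unfolding G.monomial_Suc[OF Suc.prems] by (subst G'.monomial_Suc) (simp_all add: o_def)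
qed

lemma progression_image:
  assumes "u \<in> {..<d} \<rightarrow> carrier G"
  shows "h ` progression G d u L = progression G' d (h \<circ> u) L"
  unfolding progression_def image_image by (simp add: monomial_image[OF assms])

lemma coset_progression_image:
  assumes "u \<in> {..<d} \<rightarrow> carrier G" "H \<subseteq> carrier G"
  shows "h ` coset_progression G H d u L = coset_progression G' (h ` H) d (h \<circ> u) L"
proof -
  have "progression G d u L \<subseteq> carrier G" unfolding progression_def using G.monomial_closed[OF assms(1)] by auto
  then show ?thesis
    unfolding coset_progression_def by (simp add: set_mult_image[OF hom assms(2)] progression_image[OF assms(1)])
qed

text \<open>Properness compares cosets, that is, subsets of the carrier, and an injective map on the
  carrier is also injective on its subsets.\<close>

lemma proper_coset_progression_image:
  assumes P: "proper_coset_progression G m H d u L"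
  shows "proper_coset_progression G' m (h ` H) d (h \<circ> u) L"
proof -
  have H: "subgroup H G" "finite H" and u: "u \<in> {..<d} \<rightarrow> carrier G" and L: "\<forall>i<d. 0 < L i"
    using P unfolding proper_coset_progression_def is_coset_progression_def by auto
  have Hc: "H \<subseteq> carrier G" using subgroup.subset[OF H(1)] .
  have rcos: "h ` (H #>\<^bsub>G\<^esub> x) = h ` H #>\<^bsub>G'\<^esub> h x" if "x \<in> carrier G" for x
    using set_mult_image[OF hom Hc, of "{x}"] that by (simp add: r_coset_eq_set_mult)
  have sub: "subgroup (h ` H) G'" by (rule subgroup_img_is_subgroup[OF H(1)])
  have "is_coset_progression G' (h ` H) d (h \<circ> u) L"
    unfolding is_coset_progression_def using G'.comm_group_axioms sub H(2) u L by (auto simp: Pi_iff)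
  moreover have "inj_on (\<lambda>l. h ` H #>\<^bsub>G'\<^esub> monomial G' d (h \<circ> u) l) (\<Pi>\<^sub>E i\<in>{..<d}. {j. real_of_int \<bar>j\<bar> \<le> m * real (L i)})"
  proof (rule inj_onI)
    fix l l' assume l: "l \<in> (\<Pi>\<^sub>E i\<in>{..<d}. {j. real_of_int \<bar>j\<bar> \<le> m * real (L i)})"
      "l' \<in> (\<Pi>\<^sub>E i\<in>{..<d}. {j. real_of_int \<bar>j\<bar> \<le> m * real (L i)})"
      "h ` H #>\<^bsub>G'\<^esub> monomial G' d (h \<circ> u) l = h ` H #>\<^bsub>G'\<^esub> monomial G' d (h \<circ> u) l'"
    have mc: "monomial G d u x \<in> carrier G" for x by (rule G.monomial_closed[OF u])
    have sc: "H #>\<^bsub>G\<^esub> monomial G d u x \<subseteq> carrier G" for x by (rule G.r_coset_subset_G[OF Hc mc])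
    have "h ` (H #>\<^bsub>G\<^esub> monomial G d u l) = h ` (H #>\<^bsub>G\<^esub> monomial G d u l')"
      using l(3) by (simp add: rcos[OF mc] monomial_image[OF u])
    then have "H #>\<^bsub>G\<^esub> monomial G d u l = H #>\<^bsub>G\<^esub> monomial G d u l'"
      using inj_on_image_eq_iff[OF inj sc sc] by blast
    then show "l = l'" using P l(1,2) unfolding proper_coset_progression_def by (elim conjE, elim inj_onD)
  qed
  ultimately show ?thesis unfolding proper_coset_progression_def by blast
qed

end

text \<open>An abelian group on finitely many generators is covered by the monomials with exponents
  from finite lists of integers.\<close>

lemma (in group) countable_generate:
  assumes "finite A" "A \<subseteq> carrier G" "comm_group (subgroup_generated G A)"
  shows "countable (carrier (subgroup_generated G A))"
proof -
  let ?S = "subgroup_generated G A"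
  interpret S: comm_group ?S by (rule assms(3))
  have AS: "A \<subseteq> carrier ?S" by (rule subgroup_generated_subset_carrier_subset[OF assms(2)])
  obtain a where a: "bij_betw a {..<card A} A" using ex_bij_betw_nat_finite[OF assms(1)] by (auto simp: atLeast0LessThan)
  have gen: "generate ?S A = carrier ?S" by (rule generate_subgroup_generated[OF assms(2)])
  let ?F = "\<lambda>xs :: int list. monomial ?S (card A) a (\<lambda>i. xs ! i)"
  have "carrier ?S \<subseteq> range ?F"
  proof
    fix x assume "x \<in> carrier ?S"
    then obtain l where l: "x = monomial ?S (card A) a l"
      using S.generate_eq_monomials[OF AS a] gen by blast
    have ac: "a \<in> {..<card A} \<rightarrow> carrier ?S" using a AS by (auto simp: bij_betw_def)
    have "x = ?F (map l [0..<card A])" unfolding l by (rule S.monomial_cong) (use ac in auto)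
    then show "x \<in> range ?F" by blast
  qed
  then show ?thesis by (rule countable_subset) simp
qed

lemma ex_nat_group_iso:
  assumes "comm_group S" and "countable (carrier S)"
  shows "\<exists>(N :: nat monoid) f. comm_group N \<and> f \<in> iso S N"
proof -
  interpret S: comm_group S by fact
  define f where "f = to_nat_on (carrier S)"
  have finj: "inj_on f (carrier S)" unfolding f_def by (rule inj_on_to_nat_on[OF assms(2)])
  define g where "g = the_inv_into (carrier S) f"
  have gf: "g (f x) = x" if "x \<in> carrier S" for x unfolding g_def by (rule the_inv_into_f_f[OF finj that])
  define N :: "nat monoid" where
    "N = \<lparr>carrier = f ` carrier S, monoid.mult = (\<lambda>x y. f (g x \<otimes>\<^bsub>S\<^esub> g y)), one = f \<one>\<^bsub>S\<^esub>\<rparr>"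
  have Nc: "carrier N = f ` carrier S" and No: "\<one>\<^bsub>N\<^esub> = f \<one>\<^bsub>S\<^esub>"
    and Nm: "x \<otimes>\<^bsub>N\<^esub> y = f (g x \<otimes>\<^bsub>S\<^esub> g y)" for x y by (simp_all add: N_def)
  have "comm_group N"
  proof (rule comm_groupI)
    fix x assume "x \<in> carrier N"
    then obtain s where s: "s \<in> carrier S" "x = f s" by (auto simp: Nc)
    show "\<exists>y\<in>carrier N. y \<otimes>\<^bsub>N\<^esub> x = \<one>\<^bsub>N\<^esub>"
      using s by (intro bexI[of _ "f (inv\<^bsub>S\<^esub> s)"]) (auto simp: Nc No Nm gf)
  qed (auto simp: Nc No Nm gf S.m_ac)
  moreover have "f \<in> iso S N"
    using finj by (auto simp: iso_def bij_betw_def Nc Nm gf intro!: homI)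
  ultimately show ?thesis by blast
qed

text \<open>\<open>abelian_freiman\<close> constrains \<open>G\<close> only through subgroups
  generated by approximate groups. Such a subgroup is countable, so it has a copy on
  \<open>nat\<close>; the hypothesis is applied to the copy and the progression is carried back. The
  constants pass through unchanged, so arbitrary \<open>a\<close> and \<open>k\<close> can be
  treated.\<close>

lemma abelian_freiman_transfer:
  fixes G :: "('g, 'b) monoid_scheme"
  assumes all: "\<forall>G :: nat monoid. group G \<longrightarrow> abelian_freiman G a k" and "group G"
  shows "abelian_freiman G a k"
  unfolding abelian_freiman_def
proof (intro allI impI, elim conjE)
  fix K A and m :: real
  assume K: "1 \<le> K" and A: "approximate_group G K A" and cG: "comm_group (subgroup_generated G A)" and m: "0 < m"
  interpret G: group G by fact
  let ?S = "subgroup_generated G A"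
  interpret S: comm_group ?S by (rule cG)
  have Ac: "A \<subseteq> carrier G" and fin: "finite A" using A unfolding approximate_group_def by auto
  have AS: "A \<subseteq> carrier ?S" by (rule G.subgroup_generated_subset_carrier_subset[OF Ac])
  \<comment> \<open>The covering set is first cut down to the generated subgroup, which is where the
    isomorphism is defined.\<close>
  obtain X r where AX: "approximate_subgroup ?S A X r" "real r \<le> K"
  proof -
    have "real (nat \<lfloor>K\<rfloor>) \<le> K" using K by linarith
    then show ?thesis using G.approximate_group_subgroup_generated(1)[OF A cG] that by blast
  qed
  interpret AX: approximate_subgroup ?S A X r by (rule AX(1))
  obtain N :: "nat monoid" and f where cN: "comm_group N" and fiso: "f \<in> iso ?S N"
    using ex_nat_group_iso[OF cG G.countable_generate[OF fin Ac cG]] by blast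
  interpret N: comm_group N by (rule cN)
  interpret F: comm_group_iso ?S N f by unfold_locales (rule fiso)
  note Nc = F.surj[symmetric]
  define g where "g = inv_into (carrier ?S) f"
  have giso: "g \<in> iso N ?S" unfolding g_def by (rule S.iso_set_sym[OF fiso])
  interpret B: comm_group_iso N ?S g by unfold_locales (rule giso)
  have gf: "g (f x) = x" if "x \<in> carrier ?S" for x unfolding g_def by (rule inv_into_f_f[OF F.inj that])
  let ?B = "f ` A"
  have BN: "?B \<subseteq> carrier N" using AS by (auto simp: Nc)
  have gB: "g ` ?B = A" using gf AS by (force simp: image_image)
  have "approximate_group N K ?B"
    unfolding approximate_group_def
  proof (intro conjI BN exI[of _ "f ` X"])
    show "finite ?B" using fin by simp
    show "\<one>\<^bsub>N\<^esub> \<in> ?B" using imageI[OF AX.one_A, of f] by (simp only: F.hom_one)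
    have finv: "inv\<^bsub>N\<^esub> (f x) = f (inv\<^bsub>?S\<^esub> x)" if "x \<in> A" for x
      using F.hom_inv[of x] AS that by auto
    have invA: "inv\<^bsub>?S\<^esub> x \<in> A" if "x \<in> A" for x using AX.inv_A that by blast
    show "set_inv\<^bsub>N\<^esub> ?B = ?B"
    proof (intro equalityI subsetI)
      fix y assume "y \<in> set_inv\<^bsub>N\<^esub> ?B"
      then obtain x where "x \<in> A" "y = inv\<^bsub>N\<^esub> (f x)" unfolding SET_INV_def by blast
      then show "y \<in> ?B" using finv invA by simp
    next
      fix y assume "y \<in> ?B"
      then obtain x where x: "x \<in> A" "y = f x" by blast
      have "y = inv\<^bsub>N\<^esub> (f (inv\<^bsub>?S\<^esub> x))" unfolding finv[OF invA[OF x(1)]] S.inv_inv[OF subsetD[OF AS x(1)]] by (rule x(2))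
      then show "y \<in> set_inv\<^bsub>N\<^esub> ?B" using invA[OF x(1)] unfolding SET_INV_def by blast
    qed
    show "f ` X \<subseteq> carrier N" using AX.X_carrier by (auto simp: Nc)
    show "finite (f ` X)" using AX.finite_X by simp
    show "real (card (f ` X)) \<le> K" using card_image_le[OF AX.finite_X, of f] AX.card_X AX(2) by linarith
    have "set_power N ?B 2 = f ` set_power ?S A 2" by (rule F.set_power_image[OF AS, symmetric])
    also have "\<dots> \<subseteq> f ` (X <#>\<^bsub>?S\<^esub> A)" using AX.AA unfolding AX.set_power_A_2 by (rule image_mono)
    also have "\<dots> = f ` X <#>\<^bsub>N\<^esub> ?B" by (rule set_mult_image[OF F.hom AX.X_carrier AS])
    finally show "set_power N ?B 2 \<subseteq> f ` X <#>\<^bsub>N\<^esub> ?B" .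
  qed
  \<comment> \<open>The image of \<open>A\<close> generates all of \<open>N\<close>, so the
    conclusion for the generated subgroup of \<open>N\<close> is about \<open>N\<close>
    itself.\<close>
  moreover have gen: "subgroup_generated N ?B = N"
  proof -
    have "generate ?S A = carrier ?S" by (rule G.approximate_group_subgroup_generated(2)[OF A cG])
    then have "generate N ?B = carrier N" using F.generate_img[OF AS] by (simp add: Nc)
    then show ?thesis using BN by (simp add: subgroup_generated_def Int_absorb1)
  qed
  moreover have "abelian_freiman N a k" using all N.is_group by blast
  ultimately obtain H d u L where Q: "proper_coset_progression N m H d u L" "real d \<le> K powr a"
    "?B \<subseteq> coset_progression N H d u L" "coset_progression N H d u L \<subseteq> set_power N ?B (k K m)"
    using K m cN unfolding abelian_freiman_def by metis
  have Hc: "H \<subseteq> carrier N" and u: "u \<in> {..<d} \<rightarrow> carrier N"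
    using Q(1) subgroup.subset unfolding proper_coset_progression_def is_coset_progression_def by auto
  note im = B.coset_progression_image[OF u Hc, of L]
  have "proper_coset_progression ?S m (g ` H) d (g \<circ> u) L" by (rule B.proper_coset_progression_image[OF Q(1)])
  moreover have "A \<subseteq> coset_progression ?S (g ` H) d (g \<circ> u) L"
    using image_mono[OF Q(3), of g] unfolding im gB .
  moreover have "coset_progression ?S (g ` H) d (g \<circ> u) L \<subseteq> set_power G A (k K m)"
    using image_mono[OF Q(4), of g] unfolding im B.set_power_image[OF BN] gB set_power_subgroup_generated .
  ultimately show "\<exists>H d u L. proper_coset_progression ?S m H d u L \<and> real d \<le> K powr a \<and>
      A \<subseteq> coset_progression ?S H d u L \<and> coset_progression ?S H d u L \<subseteq> set_power G A (k K m)"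
    using Q(2) by (intro exI[of _ "g ` H"] exI[of _ d] exI[of _ "g \<circ> u"] exI[of _ L] conjI)
qed

theorem theorem1p9:
  shows "(\<exists>a>0. \<exists>k. \<forall>G :: nat monoid. group G \<longrightarrow> abelian_freiman G a k) \<and>
    (\<forall>a>0. \<forall>k. (\<forall>G :: nat monoid. group G \<longrightarrow> abelian_freiman G a k) \<longrightarrow>
       (\<forall>G :: ('g, 'b) monoid_scheme. group G \<longrightarrow> abelian_freiman G a k))"
  using ex_abelian_freiman abelian_freiman_transfer by blast

end
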